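(* Let $\Gamma$ be a connected compact metric graph. Then $$h(\Gamma)=\inf\{\lambda\ne0 : \lambda \text{ is a } \Gamma\text{-eigenvalue of } -\Delta_1^\Gamma\}.$$ Moreover, $h(\Gamma)$ is the first non-zero $\Gamma$-eigenvalue of $-\Delta_1^\Gamma$, and if $u$ is a minimizer of the problem $\inf\{TV_\Gamma(w): w\in\Pi(\Gamma)\}$, where $\Pi(\Gamma)=\{w\in BV(\Gamma):\|w\|_{L^1(\Gamma)}=1,\ 0\in\mathrm{med}_\ell(w)\}$, then there exists $t\ge0$ such that $E_t(u)=\{x\in\Gamma: u(x)>t\}$ is a Cheeger cut of $\Gamma$ and $$\left(h(\Gamma),\ \frac{1}{\ell(E_t(u))}\chi_{E_t(u)}\right)$$ is a $\Gamma$-eigenpair of $-\Delta_1^\Gamma$.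
   Context: $\Gamma$ is a connected compact metric graph: it has finitely many vertices $V(\Gamma)$ and edges $E(\Gamma)$, no loops and no multiple edges; each edge $e$ is identified with an interval $[0,\ell_e]$, $0<\ell_e<\infty$, its initial vertex $i_e$ corresponding to $0$ and its terminal vertex $f_e$ to $\ell_e$. $E_v(\Gamma)$ is the set of edges incident to the vertex $v$. A function $u$ on $\Gamma$ is a collection of functions $[u]_e$ on $(0,\ell_e)$, $e\in E(\Gamma)$; $\int_\Gamma u\,dx=\sum_e\int_0^{\ell_e}[u]_e\,dx$. $L^p(\Gamma)$, $W^{1,p}(\Gamma)$, $BV(\Gamma)$ consist of the $u$ with $[u]_e$ in $L^p(0,\ell_e)$, $W^{1,p}(0,\ell_e)$, $BV(0,\ell_e)$ for every $e$ (no continuity at vertices is required); $u'$ is the edgewise weak derivative. For $A\subset\Gamma$ measurable, $\ell(A)=\int_\Gamma \chi_A\,dx$. For $z\in W^{1,2}(\Gamma)$ and $e\in E_v(\Gamma)$ put $[z]_e(v)=[z]_e(\ell_e)$ if $v=f_e$ and $[z]_e(v)=-[z]_e(0)$ if $v=i_e$. Let $X_K(\Gamma)=\{z\in W^{1,2}(\Gamma): \sum_{e\in E_v(\Gamma)}[z]_e(v)=0\ \forall v\in V(\Gamma)\}$. The total variation is $TV_\Gamma(u)=\sup\{|\int_\Gamma u z'\,dx| : z\in X_K(\Gamma),\ \|z\|_{L^\infty(\Gamma)}\le 1\}$ (value in $[0,+\infty]$ for $u\in L^1(\Gamma)$), and $\mathrm{Per}_\Gamma(E)=TV_\Gamma(\chi_E)$.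 Let $\mathcal F_\Gamma:L^2(\Gamma)\to[0,+\infty]$, $\mathcal F_\Gamma(u)=TV_\Gamma(u)$ if $u\in BV(\Gamma)$ and $+\infty$ otherwise (convex and lower semicontinuous). The (multivalued) $1$-Laplacian is defined by $v\in\Delta_1^\Gamma u \iff -v\in\partial\mathcal F_\Gamma(u)$, with $\partial$ the subdifferential in $L^2(\Gamma)$. It is known that $w\in\partial\mathcal F_\Gamma(u)$ iff there is $z\in X_K(\Gamma)$ with $\|z\|_\infty\le1$, $w=-z'$ and $\int_\Gamma u w\,dx=TV_\Gamma(u)$. $\mathrm{sign}(u)(x)$ is $1$ if $u(x)>0$, $-1$ if $u(x)<0$, and the interval $[-1,1]$ if $u(x)=0$; $\xi\in\mathrm{sign}(u)$ means $\xi(x)\in\mathrm{sign}(u)(x)$ for $x\in\Gamma$. A pair $(\lambda,u)\in\mathbb R\times BV(\Gamma)$ is a $\Gamma$-eigenpair of $-\Delta_1^\Gamma$ if $\|u\|_{L^1(\Gamma)}=1$ and there is $\xi\in\mathrm{sign}(u)$ with $\lambda\xi\in\partial\mathcal F_\Gamma(u)=-\Delta_1^\Gamma u$; then $\lambda$ is called a $\Gamma$-eigenvalue. The $\Gamma$-Cheeger constant of $\Gamma$ is $h(\Gamma)=\inf\{\mathrm{Per}_\Gamma(D)/\ell(D): D\subset\Gamma \text{ measurable},\ 0<\ell(D)\le\frac12\ell(\Gamma)\}$. A set $D$ (or the partition $(D,\Gamma\setminus D)$) is a Cheeger cut of $\Gamma$ if $0<\ell(D)\le\frac12\ell(\Gamma)$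 and $h(\Gamma)=\mathrm{Per}_\Gamma(D)/\ell(D)$. $\mu\in\mathbb R$ is a median of $u:\Gamma\to\mathbb R$, written $\mu\in\mathrm{med}_\ell(u)$, if $\ell(\{u<\mu\})\le\frac12\ell(\Gamma)$ and $\ell(\{u>\mu\})\le\frac12\ell(\Gamma)$.
   Formalization: The last claim is false for minimizers u ≤ 0 a.e. (e.g. u = −χ_D/ℓ(D), D a Cheeger cut: E_t(u) is empty for t ≥ 0); it is stated for u if ℓ({u>0})>0 and for −u otherwise. Γ is assumed to have at least one edge. *)

theory Defs
  imports "HOL-Analysis.Analysis" "Graph_Theory.Digraph_Component"
begin

text \<open>
  A metric graph is a digraph whose arcs carry lengths; the initial vertex of an edge is its tail,
  the terminal vertex its head. The orientation only fixes the parametrisation of the edge, so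
  connectedness is that of the underlying undirected graph, and distinct arcs may not have the same
  unordered pair of endpoints. At least one edge is required: on a single point every function
  space is trivial and there are neither eigenvalues nor admissible sets for the Cheeger constant.
\<close>

record ('v, 'e) metric_graph = "('v, 'e) pre_digraph" +
  len :: "'e \<Rightarrow> real"

definition connected_compact_metric_graph :: "('v, 'e) metric_graph \<Rightarrow> bool" where
  "connected_compact_metric_graph G \<longleftrightarrow>
     digraph (pre_digraph.truncate G) \<and>
     inj_on (\<lambda>e. {tail G e, head G e}) (arcs G) \<and>
     Digraph_Component.connected (pre_digraph.truncate G) \<and>
     arcs G \<noteq> {} \<and>
     (\<forall>e\<in>arcs G. 0 < len G e)"

definition incident_edges :: "('v, 'e) metric_graph \<Rightarrow> 'v \<Rightarrow> 'e set" where
  "incident_edges G v = {e \<in> arcs G. tail G e = v \<or> head G e = v}"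


section \<open>Function spaces on an interval\<close>

definition Lp :: "nat \<Rightarrow> real \<Rightarrow> (real \<Rightarrow> real) \<Rightarrow> bool" where
  "Lp p l f \<longleftrightarrow> f \<in> borel_measurable (lebesgue_on {0<..<l}) \<and>
     integrable (lebesgue_on {0<..<l}) (\<lambda>x. \<bar>f x\<bar> ^ p)"

text \<open>The space of compactly supported test functions of class $C^1$ on the open interval.\<close>

definition test_fun :: "real \<Rightarrow> (real \<Rightarrow> real) \<Rightarrow> bool" where
  "test_fun l \<phi> \<longleftrightarrow> \<phi> C1_differentiable_on UNIV \<and>
     (\<exists>K. compact K \<and> K \<subseteq> {0<..<l} \<and> (\<forall>x. x \<notin> K \<longrightarrow> \<phi> x = 0))"

definition has_weak_deriv :: "real \<Rightarrow> (real \<Rightarrow> real) \<Rightarrow> (real \<Rightarrow> real) \<Rightarrow> bool" where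
  "has_weak_deriv l z g \<longleftrightarrow> (\<forall>\<phi>. test_fun l \<phi> \<longrightarrow>
     (LINT x|lebesgue_on {0<..<l}. z x * deriv \<phi> x) = - (LINT x|lebesgue_on {0<..<l}. g x * \<phi> x))"

definition W12 :: "real \<Rightarrow> (real \<Rightarrow> real) \<Rightarrow> bool" where
  "W12 l z \<longleftrightarrow> Lp 2 l z \<and> (\<exists>g. Lp 2 l g \<and> has_weak_deriv l z g)"

text \<open>The weak derivative is determined up to a null set; any choice will do.\<close>

definition weak_deriv :: "real \<Rightarrow> (real \<Rightarrow> real) \<Rightarrow> real \<Rightarrow> real" where
  "weak_deriv l z = (SOME g. Lp 2 l g \<and> has_weak_deriv l z g)"

text \<open>
  The values of a Sobolev function at the endpoints are those of its representative that is
  continuous on the closed interval (unique there).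
\<close>

definition cont_rep :: "real \<Rightarrow> (real \<Rightarrow> real) \<Rightarrow> real \<Rightarrow> real" where
  "cont_rep l z = (SOME y. continuous_on {0..l} y \<and> (AE x in lebesgue_on {0<..<l}. y x = z x))"

definition BV :: "real \<Rightarrow> (real \<Rightarrow> real) \<Rightarrow> bool" where
  "BV l f \<longleftrightarrow> Lp 1 l f \<and>
     bdd_above {LINT x|lebesgue_on {0<..<l}. f x * deriv \<phi> x | \<phi>.
       test_fun l \<phi> \<and> (\<forall>x. \<bar>\<phi> x\<bar> \<le> 1)}"


section \<open>Functions on a metric graph\<close>

text \<open>
  Points of the graph other than the vertices are pairs of an edge and a coordinate. Vertices form
  a null set and carry no function values. For a function \<open>u\<close> on the graph, \<open>curry u e\<close> is its
  restriction to the edge \<open>e\<close>; values of \<open>u\<close> outside \<open>points G\<close> are irrelevant.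
\<close>

definition points :: "('v, 'e) metric_graph \<Rightarrow> ('e \<times> real) set" where
  "points G = (SIGMA e:arcs G. {0<..<len G e})"

definition gint :: "('v, 'e) metric_graph \<Rightarrow> ('e \<times> real \<Rightarrow> real) \<Rightarrow> real" where
  "gint G u = (\<Sum>e\<in>arcs G. LINT x|lebesgue_on {0<..<len G e}. u (e, x))"

definition gmeasurable :: "('v, 'e) metric_graph \<Rightarrow> ('e \<times> real) set \<Rightarrow> bool" where
  "gmeasurable G A \<longleftrightarrow> A \<subseteq> points G \<and> (\<forall>e\<in>arcs G. {x. (e, x) \<in> A} \<in> sets lebesgue)"

definition glength :: "('v, 'e) metric_graph \<Rightarrow> ('e \<times> real) set \<Rightarrow> real" where
  "glength G A = gint G (indicator A)"

definition gL2 :: "('v, 'e) metric_graph \<Rightarrow> ('e \<times> real \<Rightarrow> real) \<Rightarrow> bool" where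
  "gL2 G u \<longleftrightarrow> (\<forall>e\<in>arcs G. Lp 2 (len G e) (curry u e))"

definition gW12 :: "('v, 'e) metric_graph \<Rightarrow> ('e \<times> real \<Rightarrow> real) \<Rightarrow> bool" where
  "gW12 G u \<longleftrightarrow> (\<forall>e\<in>arcs G. W12 (len G e) (curry u e))"

definition gBV :: "('v, 'e) metric_graph \<Rightarrow> ('e \<times> real \<Rightarrow> real) \<Rightarrow> bool" where
  "gBV G u \<longleftrightarrow> (\<forall>e\<in>arcs G. BV (len G e) (curry u e))"

definition gderiv :: "('v, 'e) metric_graph \<Rightarrow> ('e \<times> real \<Rightarrow> real) \<Rightarrow> 'e \<times> real \<Rightarrow> real" where
  "gderiv G z = (\<lambda>(e, x). weak_deriv (len G e) (curry z e) x)"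

definition L1_norm :: "('v, 'e) metric_graph \<Rightarrow> ('e \<times> real \<Rightarrow> real) \<Rightarrow> real" where
  "L1_norm G u = gint G (\<lambda>p. \<bar>u p\<bar>)"

text \<open>The condition that the $L^\infty$ norm is at most 1.\<close>

definition Linf_le_1 :: "('v, 'e) metric_graph \<Rightarrow> ('e \<times> real \<Rightarrow> real) \<Rightarrow> bool" where
  "Linf_le_1 G z \<longleftrightarrow> (\<forall>e\<in>arcs G. AE x in lebesgue_on {0<..<len G e}. \<bar>z (e, x)\<bar> \<le> 1)"

text \<open>Only meaningful for an edge \<open>e\<close> incident to \<open>v\<close>.\<close>

definition vertex_value :: "('v, 'e) metric_graph \<Rightarrow> ('e \<times> real \<Rightarrow> real) \<Rightarrow> 'e \<Rightarrow> 'v \<Rightarrow> real" where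
  "vertex_value G z e v =
     (if v = head G e then cont_rep (len G e) (curry z e) (len G e)
      else - cont_rep (len G e) (curry z e) 0)"

definition X_K :: "('v, 'e) metric_graph \<Rightarrow> ('e \<times> real \<Rightarrow> real) set" where
  "X_K G = {z. gW12 G z \<and> (\<forall>v\<in>verts G. (\<Sum>e\<in>incident_edges G v. vertex_value G z e v) = 0)}"


section \<open>Total variation, 1-Laplacian and Cheeger constant\<close>

text \<open>
  Total variation is only used for functions in $L^2$ (indeed in $BV$), for which all the integrals
  below exist.
\<close>

definition TV :: "('v, 'e) metric_graph \<Rightarrow> ('e \<times> real \<Rightarrow> real) \<Rightarrow> ereal" where
  "TV G u = (SUP z\<in>{z \<in> X_K G. Linf_le_1 G z}. ereal \<bar>gint G (\<lambda>p. u p * gderiv G z p)\<bar>)"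

definition Per :: "('v, 'e) metric_graph \<Rightarrow> ('e \<times> real) set \<Rightarrow> ereal" where
  "Per G D = TV G (indicator D)"

definition F_TV :: "('v, 'e) metric_graph \<Rightarrow> ('e \<times> real \<Rightarrow> real) \<Rightarrow> ereal" where
  "F_TV G u = (if gBV G u then TV G u else \<infinity>)"

definition subdifferential_L2 ::
  "('v, 'e) metric_graph \<Rightarrow> (('e \<times> real \<Rightarrow> real) \<Rightarrow> ereal) \<Rightarrow> ('e \<times> real \<Rightarrow> real) \<Rightarrow> ('e \<times> real \<Rightarrow> real) set"
  where
  "subdifferential_L2 G F u = {w. gL2 G u \<and> gL2 G w \<and>
     (\<forall>v. gL2 G v \<longrightarrow> F u + ereal (gint G (\<lambda>p. w p * (v p - u p))) \<le> F v)}"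

definition one_Laplacian ::
  "('v, 'e) metric_graph \<Rightarrow> ('e \<times> real \<Rightarrow> real) \<Rightarrow> ('e \<times> real \<Rightarrow> real) set" where
  "one_Laplacian G u = {v. (\<lambda>p. - v p) \<in> subdifferential_L2 G (F_TV G) u}"

definition multi_sign :: "real \<Rightarrow> real set" where
  "multi_sign r = (if r > 0 then {1} else if r < 0 then {-1} else {-1..1})"

definition eigenpair :: "('v, 'e) metric_graph \<Rightarrow> real \<Rightarrow> ('e \<times> real \<Rightarrow> real) \<Rightarrow> bool" where
  "eigenpair G \<mu> u \<longleftrightarrow> gBV G u \<and> L1_norm G u = 1 \<and>
     (\<exists>\<xi>. (\<forall>p\<in>points G. \<xi> p \<in> multi_sign (u p)) \<and> (\<lambda>p. - (\<mu> * \<xi> p)) \<in> one_Laplacian G u)"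

definition eigenvalue :: "('v, 'e) metric_graph \<Rightarrow> real \<Rightarrow> bool" where
  "eigenvalue G \<mu> \<longleftrightarrow> (\<exists>u. eigenpair G \<mu> u)"

definition cheeger_const :: "('v, 'e) metric_graph \<Rightarrow> ereal" where
  "cheeger_const G =
     (INF D\<in>{D. gmeasurable G D \<and> 0 < glength G D \<and> glength G D \<le> glength G (points G) / 2}.
        Per G D / ereal (glength G D))"

definition cheeger_cut :: "('v, 'e) metric_graph \<Rightarrow> ('e \<times> real) set \<Rightarrow> bool" where
  "cheeger_cut G D \<longleftrightarrow>
     gmeasurable G D \<and> 0 < glength G D \<and> glength G D \<le> glength G (points G) / 2 \<and>
     cheeger_const G = Per G D / ereal (glength G D)"

definition median :: "('v, 'e) metric_graph \<Rightarrow> ('e \<times> real \<Rightarrow> real) \<Rightarrow> real set" where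
  "median G u = {m. glength G {p \<in> points G. u p < m} \<le> glength G (points G) / 2 \<and>
                    glength G {p \<in> points G. u p > m} \<le> glength G (points G) / 2}"

definition Pi_BV :: "('v, 'e) metric_graph \<Rightarrow> ('e \<times> real \<Rightarrow> real) set" where
  "Pi_BV G = {w. gBV G w \<and> L1_norm G w = 1 \<and> 0 \<in> median G w}"

definition superlevel :: "('v, 'e) metric_graph \<Rightarrow> ('e \<times> real \<Rightarrow> real) \<Rightarrow> real \<Rightarrow> ('e \<times> real) set" where
  "superlevel G u t = {p \<in> points G. u p > t}"

end

theory Submission
  imports Defs "HOL-Real_Asymp.Real_Asymp"
begin

text \<open>
  Let \<open>h\<close> be the least quotient of perimeter and length. Everything follows from the inequality
  $h \int_\Gamma \xi u \le TV(u)$ for all $|\xi| \le 1$ with $\int_\Gamma \xi = 0$. Applied to \<open>u\<close> and the $\xi$ of an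
  eigenpair with nonzero eigenvalue (which has mean zero because TV is invariant under constants) it shows that the
  eigenvalue is at least \<open>h\<close>. If \<open>D\<close> is optimal, it says that $h \xi$ is a subgradient at the indicator function of
  \<open>D\<close> for every such $\xi$ equal to 1 on \<open>D\<close>.

  To prove it, replace \<open>u\<close> by its means over the cells of a mesh with \<open>N\<close> cells per edge. This does not increase TV,
  since a flow that is linear on cells does not distinguish \<open>u\<close> from its means. For a function that is constant on
  cells, one flow calibrates all superlevel sets simultaneously, so the inequality reduces to the isoperimetric one for
  unions of cells, where the perimeter is an integer: the sum over the nodes of the smaller one of the numbers of
  incident cells inside and outside the set.
\<close>

section \<open>Sobolev functions on an interval\<close>

text \<open>Meshes stand in for the coarea formula and for compactness in BV. For fixed
  \<open>N\<close> there are only finitely many unions of cells, but the constant must not depend on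
  \<open>N\<close>; hence sets are first enlarged, without raising the perimeter, to one of finitely
  many lengths determined by the graph alone. Median and multiplier express one condition: 0 is a
  median of \<open>u\<close> iff some section of the sign of \<open>u\<close> has mean zero.
  Therefore an inequality for mean-zero \<xi> serves constrained minimizers and eigenfunctions
  alike. Subgradients are not represented as derivatives of fields: for an optimal set the
  inequality, with equality at the normalized indicator, already is the subgradient inequality. The
  claim on superlevel sets is the equality case. The deficit is an integral over levels of
  nonnegative gaps and so vanishes at almost every level; the work lies in carrying this from the
  cell means back to \<open>u\<close>, as flows have derivatives in L^2 only. Connectedness enters
  once, to exclude \<open>h = 0\<close>.\<close>

abbreviation IV :: "real \<Rightarrow> real measure" where
  "IV l \<equiv> lebesgue_on {0<..<l}"

lemma finite_measure_IV: "finite_measure (IV l)"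
  by (intro finite_measure_lebesgue_on bounded_set_imp_lmeasurable) auto

lemma measurable_IV [measurable]: "(\<lambda>x. x) \<in> measurable (IV l) borel"
  by (metis borel_measurable_if_D id_apply id_borel_measurable_lebesgue_on eq_id_iff)

lemma integrable_const_IV [simp]: "integrable (IV l) (\<lambda>_. c :: real)"
  by (rule finite_measure.integrable_const[OF finite_measure_IV])

lemma AE_IV_neq: "AE x in IV l. x \<noteq> a"
proof -
  have "AE x in lebesgue. x \<noteq> a"
    using AE_lborel_singleton[of a] by (rule AE_completion)
  thus ?thesis by (auto simp: AE_restrict_space_iff elim!: eventually_mono)
qed

lemma integrable_IV_bounded:
  fixes f :: "real \<Rightarrow> real"
  assumes "f \<in> borel_measurable (IV l)" "\<And>x. x \<in> {0<..<l} \<Longrightarrow> \<bar>f x\<bar> \<le> B"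
  shows "integrable (IV l) f"
proof -
  interpret finite_measure "IV l" by (rule finite_measure_IV)
  show ?thesis using assms by (intro integrable_const_bound[of _ B]) (auto intro: AE_I2)
qed

lemma measure_IV: "0 \<le> a \<Longrightarrow> a \<le> b \<Longrightarrow> b \<le> l \<Longrightarrow> (LINT t|IV l. indicator {a..<b} t) = b - a"
proof -
  assume *: "0 \<le> a" "a \<le> b" "b \<le> l"
  have "(LINT t|IV l. indicator {a..<b} t :: real) = (LINT t|lebesgue. indicator ({0<..<l} \<inter> {a..<b}) t)"
  proof -
    have "(\<lambda>t. indicator {0<..<l} t *\<^sub>R (indicator {a..<b} t :: real)) = indicator ({0<..<l} \<inter> {a..<b})"
      by (auto simp: indicator_def fun_eq_iff)
    then show ?thesis by (subst integral_restrict_space) auto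
  qed
  also have "\<dots> = measure lebesgue ({0<..<l} \<inter> {a..<b})"
    by (subst Bochner_Integration.integral_indicator) auto
  also have "\<dots> = measure lborel ({0<..<l} \<inter> {a..<b})" by simp
  also have "\<dots> = b - a"
  proof (cases "a = 0")
    case True
    then have "{0<..<l} \<inter> {a..<b} = {0<..<b}" using * by auto
    then show ?thesis using * True by simp
  next
    case False
    then have "{0<..<l} \<inter> {a..<b} = {a..<b}" using * by auto
    then show ?thesis using * by simp
  qed
  finally show ?thesis .
qed

text \<open>Integrating over the whole edge against an indicator makes \<open>prim\<close> total: it
  is 0 left of the edge, constant right of it, and open to dominated convergence and Fubini.\<close>

definition prim :: "real \<Rightarrow> (real \<Rightarrow> real) \<Rightarrow> real \<Rightarrow> real" where
  "prim l g x = (LINT t|IV l. indicator {..<x} t * g t)"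

lemma integrable_indicator_IV:
  fixes g :: "real \<Rightarrow> real"
  assumes "integrable (IV l) g" "A \<in> sets borel"
  shows "integrable (IV l) (\<lambda>t. indicator A t * g t)"
proof -
  have [measurable]: "A \<in> sets borel" by fact
  have [measurable]: "g \<in> borel_measurable (IV l)" using assms by auto
  show ?thesis
    by (rule Bochner_Integration.integrable_bound[OF assms(1)]) (auto intro!: AE_I2 simp: indicator_def)
qed

lemma prim_nonpos: "x \<le> 0 \<Longrightarrow> prim l g x = 0"
proof -
  assume "x \<le> 0"
  then have "prim l g x = (LINT t|IV l. 0)" unfolding prim_def
    by (intro Bochner_Integration.integral_cong) auto
  thus ?thesis by simp
qed

lemma prim_zero: "prim l (\<lambda>_. 0) x = 0"
  by (simp add: prim_def)

lemma prim_minus: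
  assumes "integrable (IV l) f" "integrable (IV l) g"
  shows "prim l (\<lambda>x. f x - g x) b = prim l f b - prim l g b"
  unfolding prim_def right_diff_distrib
  by (rule Bochner_Integration.integral_diff) (auto intro!: integrable_indicator_IV assms)

lemma prim_diff:
  assumes "integrable (IV l) g" "a \<le> b"
  shows "prim l g b - prim l g a = (LINT t|IV l. indicator {a..<b} t * g t)"
proof -
  have "prim l g b - prim l g a = (LINT t|IV l. indicator {..<b} t * g t - indicator {..<a} t * g t)"
    unfolding prim_def
    by (rule Bochner_Integration.integral_diff[symmetric]) (auto intro!: integrable_indicator_IV assms)
  also have "\<dots> = (LINT t|IV l. indicator {a..<b} t * g t)"
    using assms(2) by (intro Bochner_Integration.integral_cong) (auto simp: indicator_def)
  finally show ?thesis .
qed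

lemma continuous_prim:
  assumes "integrable (IV l) g"
  shows "continuous_on UNIV (prim l g)"
proof (unfold continuous_on_eq_continuous_at[OF open_UNIV], intro ballI)
  have [measurable]: "g \<in> borel_measurable (IV l)" using assms by auto
  fix a :: real
  show "isCont (prim l g) a"
    unfolding continuous_at_sequentially comp_def
  proof (intro allI impI)
    fix X assume X: "X \<longlonglongrightarrow> a"
    show "(\<lambda>n. prim l g (X n)) \<longlonglongrightarrow> prim l g a"
      unfolding prim_def
    proof (rule integral_dominated_convergence[where w="\<lambda>t. \<bar>g t\<bar>"])
      show "AE t in IV l. (\<lambda>i. indicat_real {..<X i} t * g t) \<longlonglongrightarrow> indicat_real {..<a} t * g t"
        using AE_IV_neq[of a l]
      proof eventually_elim
        case (elim t)
        have "\<forall>\<^sub>F i in sequentially. indicat_real {..<X i} t = indicat_real {..<a} t"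
        proof (cases "t < a")
          case True
          have "\<forall>\<^sub>F i in sequentially. t < X i" by (rule order_tendstoD(1)[OF X True])
          then show ?thesis by eventually_elim (use True in auto)
        next
          case False
          then have "a < t" using elim by auto
          have "\<forall>\<^sub>F i in sequentially. X i < t" by (rule order_tendstoD(2)[OF X \<open>a < t\<close>])
          then show ?thesis by eventually_elim (use False in auto)
        qed
        then have "(\<lambda>i. indicat_real {..<X i} t) \<longlonglongrightarrow> indicat_real {..<a} t"
          by (rule tendsto_eventually)
        then show ?case by (intro tendsto_intros)
      qed
    qed (use assms in \<open>auto intro!: AE_I2 simp: indicator_def\<close>)
  qed
qed

text \<open>The sets over which \<open>f\<close> integrates to 0 form a Dynkin system that contains
  all half-lines, hence all Borel sets. A Lebesgue set differs from a Borel set by a null set, so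
  \<open>f\<close> and 0 have the same set integrals.\<close>

lemma prim_zero_imp_AE_zero:
  assumes int: "integrable (IV l) f" and zero: "\<And>x. x \<in> {0..l} \<Longrightarrow> prim l f x = 0"
  shows "AE x in IV l. f x = 0"
proof (cases "0 < l")
  case False
  then have "space (IV l) = {}" by auto
  then show ?thesis by (metis AE_I2 empty_iff)
next
  case l: True
  have [measurable]: "f \<in> borel_measurable (IV l)" using int by auto
  \<comment> \<open>The total integral is what closure under complements rests on.\<close>
  have tot: "(LINT x|IV l. f x) = 0"
  proof -
    have "(LINT x|IV l. f x) = prim l f l" unfolding prim_def
      by (intro Bochner_Integration.integral_cong) auto
    thus ?thesis using zero[of l] l by simp
  qed
  have zero': "prim l f x = 0" for x
  proof (cases "x \<le> l")
    case True
    then show ?thesis using zero prim_nonpos[of x l f] by force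
  next
    case False
    then have "prim l f x = (LINT x|IV l. f x)" unfolding prim_def
      by (intro Bochner_Integration.integral_cong) auto
    then show ?thesis using tot by simp
  qed
  have borel_eq: "sets (borel :: real measure) = sigma_sets UNIV (range lessThan)"
    by (subst borel_Iio) (simp add: sets_measure_of)
  have borel: "(LINT x|IV l. indicator A x * f x) = 0" if "A \<in> sets borel" for A
  proof -
    have A: "A \<in> sigma_sets UNIV (range (\<lambda>a::real. {..<a}))"
      using that borel_eq by simp
    have sb: "B \<in> sets borel" if "B \<in> sigma_sets UNIV (range (\<lambda>a::real. {..<a}))" for B
      using that borel_eq by simp
    show ?thesis
    proof (rule sigma_sets_induct_disjoint[OF _ _ A])
      show "Int_stable (range (\<lambda>a::real. {..<a}))"
      proof -
        have "{..<a} \<inter> {..<b} = {..<min a b}" for a b :: real by auto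
        then show ?thesis unfolding Int_stable_def by blast
      qed
    next
      fix B assume "B \<in> range (\<lambda>a::real. {..<a})"
      then show "(LINT x|IV l. indicator B x * f x) = 0" using zero' by (auto simp: prim_def)
    next
      fix B assume B: "B \<in> sigma_sets UNIV (range (\<lambda>a::real. {..<a}))"
        "(LINT x|IV l. indicator B x * f x) = 0"
      have "(LINT x|IV l. indicator (UNIV - B) x * f x) = (LINT x|IV l. f x - indicator B x * f x)"
        by (intro Bochner_Integration.integral_cong) (auto simp: indicator_def)
      also have "\<dots> = 0" using B tot int by (simp add: integrable_indicator_IV[OF int sb])
      finally show "(LINT x|IV l. indicator (UNIV - B) x * f x) = 0" .
    next
      fix B :: "nat \<Rightarrow> real set"
      assume B: "disjoint_family B" "range B \<subseteq> sigma_sets UNIV (range (\<lambda>a::real. {..<a}))"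
        "\<And>i. (LINT x|IV l. indicator (B i) x * f x) = 0"
      have Bm: "B i \<in> sets borel" for i using sb B(2) by auto
      have "(\<lambda>n. LINT x|IV l. indicator (\<Union>i<n. B i) x * f x) \<longlonglongrightarrow> (LINT x|IV l. indicator (\<Union>i. B i) x * f x)"
      proof (rule integral_dominated_convergence[where w="\<lambda>t. \<bar>f t\<bar>"])
        show "AE x in IV l. (\<lambda>n. indicat_real (\<Union>i<n. B i) x * f x) \<longlonglongrightarrow> indicat_real (\<Union>i. B i) x * f x"
        proof (intro AE_I2 tendsto_mult tendsto_const tendsto_eventually)
          fix x
          show "\<forall>\<^sub>F n in sequentially. indicat_real (\<Union>i<n. B i) x = indicat_real (\<Union>i. B i) x"
          proof (cases "\<exists>i. x \<in> B i")
            case True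
            then obtain i where i: "x \<in> B i" by auto
            show ?thesis using eventually_gt_at_top[of i] by eventually_elim (use i in \<open>auto simp: indicator_def\<close>)
          qed (auto simp: indicator_def)
        qed
        show "(\<lambda>t. indicator (\<Union>i. B i) t * f t) \<in> borel_measurable (IV l)"
          "\<And>n. (\<lambda>t. indicator (\<Union>i<n. B i) t * f t) \<in> borel_measurable (IV l)"
          using Bm int by (auto intro!: borel_measurable_integrable integrable_indicator_IV)
      qed (use int in \<open>auto intro!: AE_I2 simp: indicator_def\<close>)
      moreover have "(LINT x|IV l. indicator (\<Union>i<n. B i) x * f x) = 0" for n
      proof (induction n)
        case (Suc n)
        have "x \<notin> (\<Union>i<n. B i)" if "x \<in> B n" for x
          using B(1) that by (auto simp: disjoint_family_on_def) (metis disjoint_iff less_irrefl)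
        then have "(LINT x|IV l. indicator (\<Union>i<Suc n. B i) x * f x)
            = (LINT x|IV l. indicator (\<Union>i<n. B i) x * f x + indicator (B n) x * f x)"
          by (intro Bochner_Integration.integral_cong) (auto simp: indicator_def lessThan_Suc)
        also have "\<dots> = 0" using Suc B(3)[of n] Bm
          by (simp add: integrable_indicator_IV[OF int])
        finally show ?case .
      qed simp
      ultimately show "(LINT x|IV l. indicator (\<Union>i. B i) x * f x) = 0"
        by (simp add: LIMSEQ_const_iff)
    qed auto
  qed
  have "AE x in IV l. f x = (\<lambda>_. 0) x"
  proof (rule density_unique_real[OF int])
    fix A assume "A \<in> sets (IV l)"
    then have A: "A \<in> sets lebesgue" by (auto simp: sets_restrict_space_iff)
    then obtain S N N' where S: "A = S \<union> N" "N \<subseteq> N'" "N' \<in> null_sets lborel" "S \<in> sets lborel"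
      by (rule sets_completionE)
    have "AE x in lebesgue. x \<notin> N'" using S(3) by (intro AE_completion AE_not_in)
    then have "AE x in IV l. x \<notin> N'"
      by (auto simp: AE_restrict_space_iff elim!: eventually_mono)
    then have "AE x in IV l. indicator A x *\<^sub>R f x = indicator S x * f x"
      by eventually_elim (use S in \<open>auto simp: indicator_def\<close>)
    then have "(LINT x:A|IV l. f x) = (LINT x|IV l. indicator S x * f x)"
      unfolding set_lebesgue_integral_def
      by (intro integral_cong_AE) (use S \<open>A \<in> sets (IV l)\<close> in auto)
    then show "(LINT x:A|IV l. f x) = (LINT x:A|IV l. 0)" using borel[of S] S by (simp add: set_lebesgue_integral_def)
  qed auto
  thus ?thesis by simp
qed


section \<open>Integration by parts and test functions\<close>

lemma integrable_IV_continuous: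
  assumes "continuous_on UNIV (f :: real \<Rightarrow> real)"
  shows "integrable (IV l) f"
proof -
  have "compact (f ` {0..l})"
    by (intro compact_continuous_image continuous_on_subset[OF assms]) auto
  then have "bounded (f ` {0..l})" by (rule compact_imp_bounded)
  then obtain B where "\<forall>x\<in>{0..l}. \<bar>f x\<bar> \<le> B" by (auto simp: bounded_iff)
  moreover have "f \<in> borel_measurable (IV l)"
    using measurable_compose[OF measurable_IV borel_measurable_continuous_onI[OF assms]] .
  ultimately show ?thesis by (intro integrable_IV_bounded[of _ _ B]) auto
qed

text \<open>Integration by parts for a primitive, as Fubini over the triangle \<open>t < x\<close>.
  This avoids differentiating \<open>prim l g\<close>, whose derivative exists only almost
  everywhere.\<close>

lemma Fubini_prim:
  assumes g: "integrable (IV l) g" and \<psi>: "integrable (IV l) \<psi>"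
  shows "(LINT x|IV l. prim l g x * \<psi> x) = (LINT t|IV l. g t * (LINT x|IV l. indicator {t<..} x * \<psi> x))"
proof -
  interpret finite_measure "IV l" by (rule finite_measure_IV)
  interpret pair_sigma_finite "IV l" "IV l" ..
  have [measurable]: "g \<in> borel_measurable (IV l)" "\<psi> \<in> borel_measurable (IV l)" using g \<psi> by auto
  have 1: "integrable (IV l \<Otimes>\<^sub>M IV l) (\<lambda>p. \<psi> (fst p) * g (snd p))"
  proof (rule Fubini_integrable)
    show "integrable (IV l) (\<lambda>x. LINT y|IV l. norm (\<psi> (fst (x, y)) * g (snd (x, y))))"
      using \<psi> by (simp add: abs_mult)
    show "AE x in IV l. integrable (IV l) (\<lambda>y. \<psi> (fst (x, y)) * g (snd (x, y)))"
      using g by (intro AE_I2) auto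
  qed measurable
  have "integrable (IV l \<Otimes>\<^sub>M IV l) (\<lambda>p. if snd p < fst p then g (snd p) * \<psi> (fst p) else 0)"
    by (rule Bochner_Integration.integrable_bound[OF 1]) (auto intro!: AE_I2 simp: abs_mult mult.commute)
  then have 2: "integrable (IV l \<Otimes>\<^sub>M IV l) (case_prod (\<lambda>x t. if t < x then g t * \<psi> x else 0))"
    by (simp add: case_prod_unfold)
  have "(LINT x|IV l. prim l g x * \<psi> x) = (LINT x|IV l. LINT t|IV l. (if t < x then g t * \<psi> x else 0))"
    unfolding prim_def
    by (subst Bochner_Integration.integral_mult_left_zero[symmetric], intro Bochner_Integration.integral_cong refl)
      (auto simp: indicator_def intro!: Bochner_Integration.integral_cong)
  also have "\<dots> = (LINT t|IV l. LINT x|IV l. (if t < x then g t * \<psi> x else 0))"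
    by (rule Fubini_integral[OF 2, symmetric])
  also have "\<dots> = (LINT t|IV l. g t * (LINT x|IV l. indicator {t<..} x * \<psi> x))"
    by (subst Bochner_Integration.integral_mult_right_zero[symmetric], intro Bochner_Integration.integral_cong refl)
      (auto simp: indicator_def intro!: Bochner_Integration.integral_cong)
  finally show ?thesis .
qed

text \<open>The indicator of \<open>{t<..}\<close> is the form in which the inner integral of
  \<open>Fubini_prim\<close> arrives.\<close>

lemma FTC_IV:
  assumes F: "\<And>x. (F has_real_derivative f x) (at x)" and f: "continuous_on UNIV f"
    and t: "0 \<le> t" "t \<le> l"
  shows "(LINT x|IV l. indicator {t<..} x * f x) = F l - F t"
proof -
  have [measurable]: "f \<in> borel_measurable borel" by (rule borel_measurable_continuous_onI[OF f])
  have fl: "f \<in> borel_measurable lebesgue"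
    by (intro measurable_completion) simp
  have hi: "(f has_integral (F l - F t)) {t..l}"
    by (rule fundamental_theorem_of_calculus[OF t(2)])
      (use F in \<open>auto simp: has_real_derivative_iff_has_vector_derivative intro: has_vector_derivative_at_within\<close>)
  have ai: "f absolutely_integrable_on {t..l}"
    by (rule absolutely_integrable_continuous_real) (rule continuous_on_subset[OF f], auto)
  have ae: "AE x in lebesgue. x \<noteq> t \<and> x \<noteq> l"
    using AE_lborel_singleton[of t] AE_lborel_singleton[of l]
    by (intro AE_conjI AE_completion) auto
  have "(LINT x|IV l. indicator {t<..} x * f x) = (LINT x|lebesgue. indicator {0<..<l} x *\<^sub>R (indicator {t<..} x * f x))"
    by (subst integral_restrict_space) auto
  also have "\<dots> = (LINT x:{t..l}|lebesgue. f x)"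
    unfolding set_lebesgue_integral_def
  proof (rule integral_cong_AE)
    show "AE x in lebesgue. indicat_real {0<..<l} x *\<^sub>R (indicat_real {t<..} x * f x) = indicat_real {t..l} x *\<^sub>R f x"
      using ae by eventually_elim (use t in \<open>auto simp: indicator_def\<close>)
  qed (use fl in \<open>auto intro!: borel_measurable_times borel_measurable_scaleR borel_measurable_indicator\<close>)
  also have "\<dots> = integral {t..l} f" by (rule set_lebesgue_integral_eq_integral(2)[OF ai])
  also have "\<dots> = F l - F t" using hi by (rule integral_unique)
  finally show ?thesis .
qed

lemma FTC_IV0:
  assumes F: "\<And>x. (F has_real_derivative f x) (at x)" and f: "continuous_on UNIV f" and "0 \<le> l"
  shows "(LINT x|IV l. f x) = F l - F 0"
proof -
  have "(LINT x|IV l. f x) = (LINT x|IV l. indicator {0<..} x * f x)"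
    by (intro Bochner_Integration.integral_cong) auto
  then show ?thesis using FTC_IV[OF F f, of 0 l] assms(3) by simp
qed

lemma test_funD:
  assumes "test_fun l \<phi>"
  shows "(\<phi> has_real_derivative deriv \<phi> x) (at x)" "continuous_on UNIV (deriv \<phi>)"
    "x \<le> 0 \<or> l \<le> x \<Longrightarrow> \<phi> x = 0"
proof -
  obtain D where D: "\<And>x. (\<phi> has_vector_derivative D x) (at x)" "continuous_on UNIV D"
    using assms by (auto simp: test_fun_def C1_differentiable_on_def)
  then have D': "(\<phi> has_real_derivative D x) (at x)" for x
    by (simp add: has_real_derivative_iff_has_vector_derivative)
  then have eq: "deriv \<phi> = D" by (intro ext DERIV_imp_deriv)
  show "(\<phi> has_real_derivative deriv \<phi> x) (at x)" "continuous_on UNIV (deriv \<phi>)"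
    using D' D(2) unfolding eq by auto
  show "\<phi> x = 0" if "x \<le> 0 \<or> l \<le> x"
    using assms that unfolding test_fun_def by (auto simp: subset_iff not_le)
qed

lemma has_weak_deriv_prim:
  assumes g: "integrable (IV l) g" and l: "0 < l"
  shows "has_weak_deriv l (\<lambda>x. c + prim l g x) g"
  unfolding has_weak_deriv_def
proof (intro allI impI)
  fix \<phi> assume T: "test_fun l \<phi>"
  note D = test_funD[OF T]
  have cp: "continuous_on UNIV (prim l g)" by (rule continuous_prim[OF g])
  have "(LINT x|IV l. (c + prim l g x) * deriv \<phi> x) = (LINT x|IV l. c * deriv \<phi> x + prim l g x * deriv \<phi> x)"
    by (simp add: algebra_simps)
  also have "\<dots> = c * (LINT x|IV l. deriv \<phi> x) + (LINT x|IV l. prim l g x * deriv \<phi> x)"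
    by (subst Bochner_Integration.integral_add)
      (auto intro!: integrable_IV_continuous continuous_intros D cp)
  also have "(LINT x|IV l. deriv \<phi> x) = 0"
    using FTC_IV0[OF D(1,2), of l] l D(3)[of 0] D(3)[of l] by simp
  also have "(LINT x|IV l. prim l g x * deriv \<phi> x) = (LINT t|IV l. g t * (LINT x|IV l. indicator {t<..} x * deriv \<phi> x))"
    by (rule Fubini_prim[OF g integrable_IV_continuous[OF D(2)]])
  also have "\<dots> = (LINT t|IV l. - (g t * \<phi> t))"
  proof (intro Bochner_Integration.integral_cong refl)
    fix t assume "t \<in> space (IV l)"
    then show "g t * (LINT x|IV l. indicator {t<..} x * deriv \<phi> x) = - (g t * \<phi> t)"
      using FTC_IV[OF D(1,2), of t l] D(3)[of l] by simp
  qed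
  finally show "(LINT x|IV l. (c + prim l g x) * deriv \<phi> x) = - (LINT x|IV l. g x * \<phi> x)" by simp
qed

text \<open>Test functions are only required to be C1, so piecewise linear cut-offs, corrected to
  mean zero, can serve as their derivatives where mollifiers would be usual.\<close>

lemma zero_mean_is_test_deriv:
  assumes \<psi>: "continuous_on UNIV \<psi>" and e: "0 < e" "0 < l"
    and supp: "\<And>x. x < e \<or> l - e < x \<Longrightarrow> \<psi> x = 0" and mean: "(LINT x|IV l. \<psi> x) = 0"
  obtains \<phi> where "test_fun l \<phi>" "deriv \<phi> = \<psi>"
proof -
  obtain F where F: "\<And>x. (F has_vector_derivative \<psi> x) (at x)"
    using einterval_antiderivative[of "-\<infinity>" "\<infinity>" \<psi>] \<psi> by (auto simp: continuous_on_eq_continuous_at)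
  then have F': "(F has_real_derivative \<psi> x) (at x)" for x
    by (simp add: has_real_derivative_iff_has_vector_derivative)
  define \<phi> where "\<phi> x = F x - F 0" for x
  have D: "(\<phi> has_real_derivative \<psi> x) (at x)" for x
    unfolding \<phi>_def by (auto intro!: derivative_eq_intros F')
  have eq: "deriv \<phi> = \<psi>" using D by (intro ext DERIV_imp_deriv)
  have z: "\<phi> 0 = 0" by (simp add: \<phi>_def)
  have zl: "\<phi> l = 0" using FTC_IV0[OF D \<psi>, of l] mean e z by simp
  have left: "\<phi> x = 0" if "x < e" for x
  proof -
    have "\<exists>c. \<forall>x\<in>{..<e}. \<phi> x = c"
    proof (rule has_field_derivative_zero_constant)
      fix x assume "x \<in> {..<e}"
      then have "(\<phi> has_real_derivative 0) (at x)" using D[of x] supp[of x] by simp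
      then show "(\<phi> has_real_derivative 0) (at x within {..<e})" by (rule has_field_derivative_at_within)
    qed simp
    then obtain c where "\<And>x. x < e \<Longrightarrow> \<phi> x = c" by auto
    from this[of 0] this[of x] show ?thesis using z e that by simp
  qed
  have right: "\<phi> x = 0" if "l - e < x" for x
  proof -
    have "\<exists>c. \<forall>x\<in>{l-e<..}. \<phi> x = c"
    proof (rule has_field_derivative_zero_constant)
      fix x assume "x \<in> {l-e<..}"
      then have "(\<phi> has_real_derivative 0) (at x)" using D[of x] supp[of x] by simp
      then show "(\<phi> has_real_derivative 0) (at x within {l-e<..})" by (rule has_field_derivative_at_within)
    qed simp
    then obtain c where "\<And>x. l - e < x \<Longrightarrow> \<phi> x = c" by auto
    from this[of l] this[of x] show ?thesis using zl e that by simp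
  qed
  have "test_fun l \<phi>"
    unfolding test_fun_def C1_differentiable_on_def
  proof (intro conjI exI[of _ \<psi>] exI[of _ "{e..l-e}"] allI ballI impI)
    show "(\<phi> has_vector_derivative \<psi> x) (at x)" for x
      using D by (simp add: has_real_derivative_iff_has_vector_derivative)
    show "\<phi> x = 0" if "x \<notin> {e..l-e}" for x using that left right by (auto simp: not_le)
  qed (use \<psi> e in auto)
  then show ?thesis using that eq by blast
qed

text \<open>A continuous cut-off that vanishes outside \<open>[1/n, b - 1/n]\<close> and tends
  pointwise on the edge to the indicator of \<open>{..<b}\<close>. The margin at both ends is what
  \<open>zero_mean_is_test_deriv\<close> asks for.\<close>

definition trapezoid :: "real \<Rightarrow> nat \<Rightarrow> real \<Rightarrow> real" where
  "trapezoid b n x = min 1 (max 0 (min (real n * x - 1) (real n * (b - x) - 1)))"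

lemma tendsto_LINT_trapezoid:
  fixes w :: "real \<Rightarrow> real"
  assumes w: "integrable (IV l) w" and b: "0 < b" "b \<le> l"
  shows "(\<lambda>n. LINT x|IV l. w x * trapezoid b n x) \<longlonglongrightarrow> prim l w b"
  unfolding prim_def
proof (rule integral_dominated_convergence[where w="\<lambda>t. \<bar>w t\<bar>"])
  have [measurable]: "w \<in> borel_measurable (IV l)" using w by auto
  show "(\<lambda>x. w x * trapezoid b n x) \<in> borel_measurable (IV l)" for n
    unfolding trapezoid_def by measurable
  show "AE x in IV l. norm (w x * trapezoid b n x) \<le> \<bar>w x\<bar>" for n
    unfolding trapezoid_def by (intro AE_I2) (auto simp: abs_mult intro!: mult_left_le)
  show "AE x in IV l. (\<lambda>n. w x * trapezoid b n x) \<longlonglongrightarrow> indicat_real {..<b} x * w x"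
  proof (rule AE_I2)
    fix x assume "x \<in> space (IV l)"
    then have x: "0 < x" by auto
    have "\<forall>\<^sub>F n in sequentially. w x * trapezoid b n x = indicat_real {..<b} x * w x"
    proof (cases "x < b")
      case True
      have "\<forall>\<^sub>F n in sequentially. real n \<ge> max (2 / x) (2 / (b - x))"
        by real_asymp
      then show ?thesis
      proof eventually_elim
        case (elim n)
        then have "2 \<le> real n * x" "2 \<le> real n * (b - x)" using x True by (auto simp: field_simps)
        then show ?case using True by (auto simp: trapezoid_def)
      qed
    next
      case False
      have "real n * (b - x) \<le> 0" for n using False by (simp add: mult_nonneg_nonpos)
      then have "max 0 (min (real n * x - 1) (real n * (b - x) - 1)) = 0" for n
        by (smt (verit))
      then show ?thesis using False by (intro always_eventually) (auto simp: trapezoid_def)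
    qed
    then show "(\<lambda>n. w x * trapezoid b n x) \<longlonglongrightarrow> indicat_real {..<b} x * w x"
      by (rule tendsto_eventually)
  qed
qed (use w in \<open>auto intro: borel_measurable_integrable integrable_indicator_IV\<close>)

lemma prim_const: "0 \<le> b \<Longrightarrow> b \<le> l \<Longrightarrow> prim l (\<lambda>x. c) b = c * b"
proof -
  assume b: "0 \<le> b" "b \<le> l"
  have "prim l (\<lambda>x. c) b = (LINT t|IV l. c * indicator {0..<b} t)" unfolding prim_def
    by (intro Bochner_Integration.integral_cong) (auto simp: indicator_def)
  then show ?thesis using measure_IV[of 0 b l] b by simp
qed

text \<open>A trapezoid minus a suitable multiple of a fixed one has mean zero, hence is a test
  derivative. So \<open>w\<close> and one constant \<open>c\<close> have equal integrals against
  every trapezoid, and in the limit \<open>w - c\<close> has primitive 0.\<close>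

lemma du_Bois_Reymond:
  assumes w: "integrable (IV l) w" and l: "0 < l"
    and zero: "\<And>\<phi>. test_fun l \<phi> \<Longrightarrow> (LINT x|IV l. w x * deriv \<phi> x) = 0"
  obtains c where "AE x in IV l. w x = c"
proof -
  let ?T = trapezoid
  have contT: "continuous_on UNIV (?T b n)" for b n
    unfolding trapezoid_def by (intro continuous_intros)
  have intT: "integrable (IV l) (?T b n)" for b n by (rule integrable_IV_continuous[OF contT])
  have intwT: "integrable (IV l) (\<lambda>x. w x * ?T b n x)" for b n
  proof (rule Bochner_Integration.integrable_bound[OF w])
    show "AE x in IV l. norm (w x * ?T b n x) \<le> norm (w x)"
      unfolding trapezoid_def by (intro AE_I2) (auto simp: abs_mult intro!: mult_left_le)
  qed (use w intT[of b n] in auto)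
  have suppT: "?T b n x = 0" if "0 < n" "b \<le> l" "x < 1 / real n \<or> l - 1 / real n < x" for b n x
  proof -
    have "real n * x - 1 \<le> 0 \<or> real n * (b - x) - 1 \<le> 0"
    proof (cases "x < 1 / real n")
      case True
      then show ?thesis using that by (simp add: field_simps)
    next
      case False
      then have "b - x < 1 / real n" using that by auto
      then show ?thesis using that by (simp add: field_simps)
    qed
    then show ?thesis unfolding trapezoid_def by auto
  qed
  have I_lim: "(\<lambda>n. LINT x|IV l. ?T b n x) \<longlonglongrightarrow> b" if "0 < b" "b \<le> l" for b
    using tendsto_LINT_trapezoid[OF integrable_const_IV[of l "1::real"] that] that prim_const[of b l 1]
    by simp
  have "\<forall>\<^sub>F n in sequentially. 0 < n \<and> 0 < (LINT x|IV l. ?T l n x)"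
    by (rule eventually_conj[OF eventually_gt_at_top order_tendstoD(1)[OF I_lim l]]) (use l in auto)
  then have "\<exists>n. 0 < n \<and> 0 < (LINT x|IV l. ?T l n x)" by (rule eventually_happens'[OF sequentially_bot])
  then obtain n0 where n0: "0 < n0" "0 < (LINT x|IV l. ?T l n0 x)" by blast
  \<comment> \<open>The reference trapezoid needs positive mass, as it is divided by; for small
    \<open>n\<close> a trapezoid may vanish identically.\<close>
  define k where "k = (LINT x|IV l. ?T l n0 x)"
  define c where "c = (LINT x|IV l. w x * ?T l n0 x) / k"
  have main: "(LINT x|IV l. w x * ?T b n x) = c * (LINT x|IV l. ?T b n x)" if "0 < n" "b \<le> l" for b n
  proof -
    define a where "a = (LINT x|IV l. ?T b n x) / k"
    define \<psi> where "\<psi> x = ?T b n x - a * ?T l n0 x" for x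
    have "(LINT x|IV l. \<psi> x) = 0"
      unfolding \<psi>_def using n0(2) intT by (simp add: a_def k_def)
    moreover have "\<psi> x = 0" if x: "x < 1 / real (max n n0) \<or> l - 1 / real (max n n0) < x" for x
    proof -
      have "1 / real (max n n0) \<le> 1 / real n" "1 / real (max n n0) \<le> 1 / real n0"
        using n0 \<open>0 < n\<close> by (auto simp: field_simps)
      then show ?thesis using suppT[of n b x] suppT[of n0 l x] x n0 \<open>0 < n\<close> \<open>b \<le> l\<close>
        unfolding \<psi>_def by force
    qed
    moreover have "continuous_on UNIV \<psi>" unfolding \<psi>_def by (intro continuous_intros contT)
    ultimately obtain \<phi> where "test_fun l \<phi>" "deriv \<phi> = \<psi>"
      using zero_mean_is_test_deriv[of \<psi> "1 / real (max n n0)" l] n0 l by (metis divide_pos_pos max_less_iff_conj of_nat_0_less_iff zero_less_one less_max_iff_disj)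
    then have "(LINT x|IV l. w x * \<psi> x) = 0" using zero by metis
    moreover have "(LINT x|IV l. w x * \<psi> x) = (LINT x|IV l. w x * ?T b n x - a * (w x * ?T l n0 x))"
      unfolding \<psi>_def by (simp add: algebra_simps)
    ultimately have "(LINT x|IV l. w x * ?T b n x) = a * (LINT x|IV l. w x * ?T l n0 x)"
      using intwT by simp
    then show ?thesis using n0 by (simp add: a_def c_def)
  qed
  have "AE x in IV l. w x - c = 0"
  proof (rule prim_zero_imp_AE_zero)
    have fin: "integrable (IV l) (\<lambda>_. c)" by (rule integrable_const_IV)
    show "integrable (IV l) (\<lambda>x. w x - c)" using w fin by auto
    fix b assume b: "b \<in> {0..l}"
    show "prim l (\<lambda>x. w x - c) b = 0"
    proof (cases "b = 0")
      case True
      then show ?thesis by (simp add: prim_nonpos)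
    next
      case False
      have "(\<lambda>n. LINT x|IV l. w x * ?T b n x) \<longlonglongrightarrow> prim l w b"
        using tendsto_LINT_trapezoid[OF w, of b] b False by simp
      moreover have "(\<lambda>n. LINT x|IV l. w x * ?T b n x) \<longlonglongrightarrow> c * b"
      proof (rule Lim_transform_eventually)
        show "(\<lambda>n. c * (LINT x|IV l. ?T b n x)) \<longlonglongrightarrow> c * b"
          using I_lim[of b] b False by (intro tendsto_intros) auto
        show "\<forall>\<^sub>F n in sequentially. c * (LINT x|IV l. ?T b n x) = (LINT x|IV l. w x * ?T b n x)"
          using eventually_gt_at_top[of 0] by eventually_elim (use main b in auto)
      qed
      ultimately have "prim l w b = c * b" by (rule LIMSEQ_unique)
      moreover have "prim l (\<lambda>x. w x - c) b = prim l w b - prim l (\<lambda>x. c) b"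
        by (rule prim_minus[OF w fin])
      ultimately show ?thesis using b prim_const[of b l c] by simp
    qed
  qed
  then have "AE x in IV l. w x = c" by simp
  then show ?thesis using that by blast
qed

text \<open>An open set of measure zero is empty, which settles the interior; the endpoints follow
  by density.\<close>

lemma continuous_AE_zero:
  assumes f: "continuous_on {0..l} (f :: real \<Rightarrow> real)" and ae: "AE x in IV l. f x = 0" and l: "0 < l" and x: "x \<in> {0..l}"
  shows "f x = 0"
proof -
  define S where "S = {x \<in> {0<..<l}. f x \<noteq> 0}"
  have "S = {0<..<l} \<inter> f -` (- {0})" by (auto simp: S_def)
  then have op: "open S"
    using continuous_open_preimage[of "{0<..<l}" f "- {0}"] continuous_on_subset[OF f, of "{0<..<l}"] by (simp add: greaterThanLessThan_subseteq_atLeastAtMost_iff open_delete open_Compl)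
  have "AE x in lebesgue. x \<notin> S" using ae unfolding S_def
    by (auto simp: AE_restrict_space_iff elim!: eventually_mono)
  then have "S \<in> null_sets lebesgue" using op AE_iff_null_sets[of S lebesgue] by auto
  then have "negligible S" by (simp add: negligible_iff_null_sets)
  then have "S = {}" using open_not_negligible[OF op] by auto
  then have "\<And>x. x \<in> {0<..<l} \<Longrightarrow> f x = 0" by (auto simp: S_def)
  then show ?thesis
    using continuous_constant_on_closure[of "{0<..<l}" f 0 x] f l x by auto
qed

section \<open>Sobolev functions as primitives\<close>

lemma Lp2_imp_integrable:
  assumes "Lp 2 l f" shows "integrable (IV l) f"
proof (rule Bochner_Integration.integrable_bound)
  show "integrable (IV l) (\<lambda>x. 1 + \<bar>f x\<bar>\<^sup>2)"
    using assms integrable_const_IV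
    unfolding Lp_def by (intro Bochner_Integration.integrable_add) auto
  show "AE x in IV l. norm (f x) \<le> norm (1 + \<bar>f x\<bar>\<^sup>2)"
  proof (rule AE_I2)
    fix x
    have "2 * \<bar>f x\<bar> \<le> 1 + \<bar>f x\<bar>\<^sup>2" using sum_squares_bound[of 1 "\<bar>f x\<bar>"] by simp
    then show "norm (f x) \<le> norm (1 + \<bar>f x\<bar>\<^sup>2)" by simp
  qed
qed (use assms in \<open>auto simp: Lp_def\<close>)

lemma Lp2_bounded:
  assumes "f \<in> borel_measurable (IV l)" "\<And>x. x \<in> {0<..<l} \<Longrightarrow> \<bar>f x\<bar> \<le> B"
  shows "Lp 2 l f"
  unfolding Lp_def
proof
  show "integrable (IV l) (\<lambda>x. \<bar>f x\<bar>\<^sup>2)"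
    using assms by (intro integrable_IV_bounded[of _ _ "B\<^sup>2"]) (auto intro: power_mono[OF assms(2), of _ 2, simplified power2_abs])
qed (use assms in auto)

lemma Lp2_continuous:
  assumes "continuous_on UNIV f"
  shows "Lp 2 l f"
  unfolding Lp_def
  using integrable_IV_continuous[OF assms] assms
  by (auto intro!: integrable_IV_continuous continuous_intros)

lemma Lp2_mult_integrable:
  assumes "Lp 2 l f" "Lp 2 l g"
  shows "integrable (IV l) (\<lambda>x. f x * g x)"
proof (rule Bochner_Integration.integrable_bound)
  show "integrable (IV l) (\<lambda>x. \<bar>f x\<bar>\<^sup>2 + \<bar>g x\<bar>\<^sup>2)"
    using assms unfolding Lp_def by (intro Bochner_Integration.integrable_add) auto
  have [measurable]: "f \<in> borel_measurable (IV l)" "g \<in> borel_measurable (IV l)" using assms by (auto simp: Lp_def)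
  show "(\<lambda>x. f x * g x) \<in> borel_measurable (IV l)" by measurable
  show "AE x in IV l. norm (f x * g x) \<le> norm (\<bar>f x\<bar>\<^sup>2 + \<bar>g x\<bar>\<^sup>2)"
  proof (rule AE_I2)
    fix x
    have "2 * (\<bar>f x\<bar> * \<bar>g x\<bar>) \<le> \<bar>f x\<bar>\<^sup>2 + \<bar>g x\<bar>\<^sup>2"
      using sum_squares_bound[of "\<bar>f x\<bar>" "\<bar>g x\<bar>"] by simp
    moreover have "0 \<le> \<bar>f x\<bar> * \<bar>g x\<bar>" by simp
    ultimately have "\<bar>f x\<bar> * \<bar>g x\<bar> \<le> \<bar>f x\<bar>\<^sup>2 + \<bar>g x\<bar>\<^sup>2" by linarith
    then show "norm (f x * g x) \<le> norm (\<bar>f x\<bar>\<^sup>2 + \<bar>g x\<bar>\<^sup>2)" by (simp add: abs_mult)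
  qed
qed

text \<open>\<open>z\<close> minus the primitive of \<open>g\<close> has weak derivative 0, so it is
  constant by \<open>du_Bois_Reymond\<close>. This is what gives the fields in \<open>X_K\<close>
  continuous representatives.\<close>

lemma weak_deriv_primitive:
  assumes "has_weak_deriv l z g" "integrable (IV l) z" "integrable (IV l) g" "0 < l"
  obtains c where "AE x in IV l. z x = c + prim l g x"
proof -
  have ip: "integrable (IV l) (prim l g)"
    by (intro integrable_IV_continuous continuous_prim assms)
  have "(LINT x|IV l. (z x - prim l g x) * deriv \<phi> x) = 0" if T: "test_fun l \<phi>" for \<phi>
  proof -
    note D = test_funD[OF T]
    have "compact (deriv \<phi> ` {0..l})"
      by (intro compact_continuous_image continuous_on_subset[OF D(2)]) auto
    then have "bounded (deriv \<phi> ` {0..l})" by (rule compact_imp_bounded)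
    then obtain B where B: "\<forall>x\<in>{0..l}. \<bar>deriv \<phi> x\<bar> \<le> B" by (auto simp: bounded_iff)
    have *: "integrable (IV l) (\<lambda>x. f x * deriv \<phi> x)" if f: "integrable (IV l) f" for f
    proof (rule Bochner_Integration.integrable_bound)
      show "integrable (IV l) (\<lambda>x. B * f x)" using f by simp
      show "AE x in IV l. norm (f x * deriv \<phi> x) \<le> norm (B * f x)"
      proof (rule AE_I2)
        fix x assume "x \<in> space (IV l)"
        then have "\<bar>deriv \<phi> x\<bar> \<le> \<bar>B\<bar>" using bspec[OF B, of x] by auto
        then show "norm (f x * deriv \<phi> x) \<le> norm (B * f x)"
          by (auto simp: abs_mult mult.commute[of "\<bar>B\<bar>"] intro: mult_left_mono)
      qed
    qed (use f integrable_IV_continuous[OF D(2), of l] in auto)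
    have "(LINT x|IV l. z x * deriv \<phi> x) = (LINT x|IV l. prim l g x * deriv \<phi> x)"
      using assms(1) has_weak_deriv_prim[of l g 0] assms T by (simp add: has_weak_deriv_def)
    then show ?thesis using *[OF assms(2)] *[OF ip] by (simp add: left_diff_distrib)
  qed
  then obtain c where "AE x in IV l. z x - prim l g x = c"
    using du_Bois_Reymond[of l "\<lambda>x. z x - prim l g x"] assms ip by auto
  then have "AE x in IV l. z x = c + prim l g x" by eventually_elim auto
  then show ?thesis using that by blast
qed

text \<open>Two continuous representatives agree on the closed interval, so any of them can replace
  the one chosen by \<open>SOME\<close>.\<close>

lemma cont_rep_eqI:
  assumes "continuous_on {0..l} y" "AE x in IV l. y x = z x" "0 < l" "x \<in> {0..l}"
  shows "cont_rep l z x = y x"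
proof -
  have "continuous_on {0..l} (cont_rep l z) \<and> (AE x in IV l. cont_rep l z x = z x)"
    unfolding cont_rep_def by (rule someI[of _ y]) (use assms in auto)
  then have "continuous_on {0..l} (cont_rep l z)" "AE x in IV l. cont_rep l z x = z x" by auto
  moreover from this(2) assms(2) have "AE x in IV l. cont_rep l z x - y x = 0"
    by eventually_elim auto
  ultimately have "cont_rep l z x - y x = 0"
    using assms by (intro continuous_AE_zero[of l "\<lambda>x. cont_rep l z x - y x"]) (auto intro!: continuous_intros)
  then show ?thesis by simp
qed

lemma W12_cont_rep:
  assumes z: "W12 l z" and l: "0 < l"
  shows "Lp 2 l (weak_deriv l z)" "has_weak_deriv l z (weak_deriv l z)"
    "AE x in IV l. cont_rep l z x = z x"
    "x \<in> {0..l} \<Longrightarrow> cont_rep l z x = cont_rep l z 0 + prim l (weak_deriv l z) x"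
    "continuous_on {0..l} (cont_rep l z)"
proof -
  show 1: "Lp 2 l (weak_deriv l z)" and 2: "has_weak_deriv l z (weak_deriv l z)"
    using z someI_ex[of "\<lambda>g. Lp 2 l g \<and> has_weak_deriv l z g"]
    unfolding W12_def weak_deriv_def by auto
  have iz: "integrable (IV l) z" using z by (auto simp: W12_def intro: Lp2_imp_integrable)
  obtain c where c: "AE x in IV l. z x = c + prim l (weak_deriv l z) x"
    using weak_deriv_primitive[OF 2 iz Lp2_imp_integrable[OF 1] l] .
  define y where "y x = c + prim l (weak_deriv l z) x" for x
  have cy: "continuous_on {0..l} y" unfolding y_def
    by (intro continuous_intros continuous_on_subset[OF continuous_prim[OF Lp2_imp_integrable[OF 1]]]) auto
  have "AE x in IV l. y x = z x" using c by eventually_elim (auto simp: y_def)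
  note eq = cont_rep_eqI[OF cy this l]
  show "cont_rep l z x = cont_rep l z 0 + prim l (weak_deriv l z) x" if "x \<in> {0..l}"
    using eq[OF that] eq[of 0] l by (simp add: y_def prim_nonpos)
  have "AE x in IV l. cont_rep l z x = y x" using eq by (intro AE_I2) auto
  with c show "AE x in IV l. cont_rep l z x = z x" by eventually_elim (auto simp: y_def)
  show "continuous_on {0..l} (cont_rep l z)"
    using cy eq by (subst continuous_on_cong[OF refl eq]) auto
qed

text \<open>Converse of \<open>W12_cont_rep\<close>. The chosen weak derivative equals
  \<open>g\<close> only almost everywhere, because functions with the same primitive agree only up
  to a null set.\<close>

lemma W12_prim:
  assumes g: "Lp 2 l g" and l: "0 < l"
  shows "W12 l (\<lambda>x. c + prim l g x)"
    "AE x in IV l. weak_deriv l (\<lambda>x. c + prim l g x) x = g x"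
    "x \<in> {0..l} \<Longrightarrow> cont_rep l (\<lambda>x. c + prim l g x) x = c + prim l g x"
proof -
  let ?z = "\<lambda>x. c + prim l g x"
  have ig: "integrable (IV l) g" by (rule Lp2_imp_integrable[OF g])
  have cz: "continuous_on S ?z" for S
    by (intro continuous_intros continuous_on_subset[OF continuous_prim[OF ig]]) auto
  show W: "W12 l ?z"
    unfolding W12_def using g has_weak_deriv_prim[OF ig l, of c] Lp2_continuous[OF cz] by blast
  show eq: "cont_rep l ?z x = ?z x" if "x \<in> {0..l}" for x
    by (rule cont_rep_eqI[OF cz _ l that]) auto
  have iw: "integrable (IV l) (weak_deriv l ?z)" by (rule Lp2_imp_integrable[OF W12_cont_rep(1)[OF W l]])
  have "AE x in IV l. weak_deriv l ?z x - g x = 0"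
  proof (rule prim_zero_imp_AE_zero)
    fix x assume x: "x \<in> {0..l}"
    have "prim l (weak_deriv l ?z) x = prim l g x"
      using W12_cont_rep(4)[OF W l x] eq[OF x] eq[of 0] l by (simp add: prim_nonpos)
    moreover have "prim l (\<lambda>x. weak_deriv l ?z x - g x) x = prim l (weak_deriv l ?z) x - prim l g x"
      by (rule prim_minus[OF iw ig])
    ultimately show "prim l (\<lambda>x. weak_deriv l ?z x - g x) x = 0" by simp
  qed (use iw ig in auto)
  then show "AE x in IV l. weak_deriv l ?z x = g x" by simp
qed

section \<open>Uniform meshes on an interval\<close>

(* As a default rule, it would also be tried on arguments ranging over nat. *)
declare measurable_IV [measurable del]

lemma integrable_indicator_one_IV: "A \<in> sets borel \<Longrightarrow> integrable (IV l) (\<lambda>t. indicator A t :: real)"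
  using integrable_indicator_IV[OF integrable_const_IV, of A l 1] by simp

definition cell_index :: "real \<Rightarrow> nat \<Rightarrow> real \<Rightarrow> nat" where
  "cell_index l N x = nat \<lfloor>x * real N / l\<rfloor>"

definition cell_int :: "real \<Rightarrow> nat \<Rightarrow> (real \<Rightarrow> real) \<Rightarrow> nat \<Rightarrow> real" where
  "cell_int l N f i = (LINT x|IV l. (if cell_index l N x = i then f x else 0))"

definition cell_mean :: "real \<Rightarrow> nat \<Rightarrow> (real \<Rightarrow> real) \<Rightarrow> nat \<Rightarrow> real" where
  "cell_mean l N f i = cell_int l N f i * real N / l"

text \<open>\<open>clamp01 (x * real N / l - real i)\<close> is the fraction of the cell
  \<open>i\<close> that lies to the left of \<open>x\<close>.\<close>

definition clamp01 :: "real \<Rightarrow> real" where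
  "clamp01 x = max 0 (min 1 x)"

lemma cell_index_eq_iff:
  assumes "0 < l" "0 < N" "0 \<le> x"
  shows "cell_index l N x = i \<longleftrightarrow> l * real i / real N \<le> x \<and> x < l * real (Suc i) / real N"
proof -
  have "0 \<le> \<lfloor>x * real N / l\<rfloor>" using assms by simp
  then have "cell_index l N x = i \<longleftrightarrow> \<lfloor>x * real N / l\<rfloor> = int i"
    unfolding cell_index_def by auto
  also have "\<dots> \<longleftrightarrow> real i \<le> x * real N / l \<and> x * real N / l < real i + 1"
    by (simp add: floor_eq_iff)
  also have "\<dots> \<longleftrightarrow> l * real i / real N \<le> x \<and> x < l * real (Suc i) / real N"
    using assms by (simp add: field_simps)
  finally show ?thesis .
qed

lemma cell_index_less:
  assumes "0 < N" "x \<in> {0<..<l}"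
  shows "cell_index l N x < N"
proof -
  have "x * real N / l < real N" using assms by (simp add: field_simps)
  then have "\<lfloor>x * real N / l\<rfloor> < int N" by (simp add: floor_less_iff)
  then show ?thesis unfolding cell_index_def using assms by linarith
qed

lemma measurable_cell_index [measurable]: "cell_index l N \<in> measurable borel (count_space UNIV)"
  unfolding cell_index_def by measurable

lemma measurable_cell_index_IV [measurable]: "cell_index l N \<in> measurable (IV l) (count_space UNIV)"
  using measurable_compose[OF measurable_IV measurable_cell_index] by simp

lemma measurable_step [measurable]: "(\<lambda>x. c (cell_index l N x)) \<in> borel_measurable (IV l)"
  by (rule measurable_compose[OF measurable_cell_index_IV]) simp

lemma integrable_cell:
  fixes f :: "real \<Rightarrow> real"
  assumes "integrable (IV l) f"
  shows "integrable (IV l) (\<lambda>x. if cell_index l N x = i then f x else 0)"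
proof -
  have [measurable]: "f \<in> borel_measurable (IV l)" using assms by auto
  show ?thesis
    by (rule Bochner_Integration.integrable_bound[OF assms]) (auto intro!: AE_I2)
qed

lemma step_mult_eq_sum:
  assumes "0 < N" "x \<in> {0<..<l}"
  shows "c (cell_index l N x) * f x = (\<Sum>i<N. c i * (if cell_index l N x = i then f x else (0::real)))"
  using cell_index_less[OF assms] by (simp add: if_distrib[of "\<lambda>x. _ * x"] cong: if_cong)

lemma integrable_step_mult:
  fixes f :: "real \<Rightarrow> real"
  assumes "integrable (IV l) f" "0 < N"
  shows "integrable (IV l) (\<lambda>x. c (cell_index l N x) * f x)"
proof -
  have "integrable (IV l) (\<lambda>x. \<Sum>i<N. c i * (if cell_index l N x = i then f x else 0))"
    by (intro Bochner_Integration.integrable_sum Bochner_Integration.integrable_mult_right integrable_cell assms)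
  then show ?thesis
    by (rule Bochner_Integration.integrable_cong[THEN iffD2, rotated 2])
      (use step_mult_eq_sum[OF assms(2)] in auto)
qed

lemma LINT_step_mult:
  assumes "integrable (IV l) f" "0 < N"
  shows "(LINT x|IV l. c (cell_index l N x) * f x) = (\<Sum>i<N. c i * cell_int l N f i)"
proof -
  have "(LINT x|IV l. c (cell_index l N x) * f x) = (LINT x|IV l. (\<Sum>i<N. c i * (if cell_index l N x = i then f x else 0)))"
    by (rule Bochner_Integration.integral_cong) (use step_mult_eq_sum[OF assms(2)] in auto)
  also have "\<dots> = (\<Sum>i<N. LINT x|IV l. c i * (if cell_index l N x = i then f x else 0))"
    by (intro Bochner_Integration.integral_sum Bochner_Integration.integrable_mult_right integrable_cell assms)
  finally show ?thesis by (simp add: cell_int_def)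
qed

lemma LINT_eq_sum_cell_int:
  assumes "integrable (IV l) f" "0 < N"
  shows "(LINT x|IV l. f x) = (\<Sum>i<N. cell_int l N f i)"
  using LINT_step_mult[OF assms, of "\<lambda>_. 1"] by simp

lemma cell_int_eq_prim_diff:
  assumes "integrable (IV l) f" "0 < N" "0 < l"
  shows "cell_int l N f i = prim l f (l * real (Suc i) / real N) - prim l f (l * real i / real N)"
proof -
  have "l * real i / real N \<le> l * real (Suc i) / real N"
    using assms by (intro divide_right_mono mult_left_mono) auto
  from prim_diff[OF assms(1) this] show ?thesis
    unfolding cell_int_def
    by (auto intro!: Bochner_Integration.integral_cong simp: cell_index_eq_iff assms indicator_def simp del: of_nat_Suc)
qed

lemma cell_int_const:
  assumes "0 < N" "0 < l" "i < N"
  shows "cell_int l N (\<lambda>_. c) i = c * l / real N"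
proof -
  have le: "l * real i / real N \<le> l" "l * real (Suc i) / real N \<le> l"
    using assms by (auto simp: field_simps simp del: of_nat_Suc)
  have "cell_int l N (\<lambda>_. c) i = c * (l * real (Suc i) / real N) - c * (l * real i / real N)"
    using cell_int_eq_prim_diff[OF integrable_const_IV assms(1,2), of c i]
      prim_const[OF _ le(1)] prim_const[OF _ le(2)] assms by simp
  then show ?thesis using assms by (simp add: field_simps)
qed

section \<open>Piecewise linear functions as primitives of step functions\<close>

lemma prim_step:
  assumes N: "0 < N" and l: "0 < l" and x: "x \<in> {0..l}"
  shows "prim l (\<lambda>t. c (cell_index l N t)) x = (\<Sum>i<N. c i * (l / real N) * clamp01 (x * real N / l - real i))"
proof -
  have int: "integrable (IV l) (\<lambda>t. indicator {..<x} t :: real)"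
    by (rule integrable_indicator_one_IV) auto
  have "prim l (\<lambda>t. c (cell_index l N t)) x = (LINT t|IV l. c (cell_index l N t) * indicator {..<x} t)"
    unfolding prim_def by (simp add: mult.commute)
  also have "\<dots> = (\<Sum>i<N. c i * cell_int l N (indicator {..<x}) i)"
    by (rule LINT_step_mult[OF int N])
  also have "\<dots> = (\<Sum>i<N. c i * (l / real N) * clamp01 (x * real N / l - real i))"
  proof (intro sum.cong refl)
    fix i assume "i \<in> {..<N}"
    then have i: "i < N" by simp
    define a b where "a = l * real i / real N" and "b = l * real (Suc i) / real N"
    have "l * real (Suc i) \<le> l * real N" using i l by (intro mult_left_mono) auto
    then have "b \<le> l" unfolding b_def using N by (simp add: divide_le_eq)
    moreover have "a \<le> b" unfolding a_def b_def using l by (intro divide_right_mono mult_left_mono) auto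
    moreover have "0 \<le> a" unfolding a_def using l by simp
    ultimately have ab: "0 \<le> a" "a \<le> b" "b \<le> l" by auto
    have "cell_int l N (indicator {..<x}) i = (LINT t|IV l. indicator {a..<max a (min b x)} t)"
      unfolding cell_int_def
      by (rule Bochner_Integration.integral_cong)
        (auto simp: cell_index_eq_iff N l a_def[symmetric] b_def[symmetric] indicator_def simp del: of_nat_Suc)
    also have "\<dots> = max a (min b x) - a"
      using ab x by (intro measure_IV) auto
    also have "\<dots> = (l / real N) * clamp01 (x * real N / l - real i)"
    proof -
      have r: "l / real N > 0" using N l by simp
      have "b = a + l / real N" unfolding a_def b_def using N by (simp add: field_simps)
      moreover have "x = a + (l / real N) * (x * real N / l - real i)" (is "_ = a + _ * ?s")
        unfolding a_def using N l by (simp add: field_simps)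
      ultimately have "max a (min b x) - a = max 0 (min (l / real N) (l / real N * ?s))"
        by linarith
      also have "\<dots> = (l / real N) * clamp01 ?s"
        unfolding clamp01_def using r by (simp add: max_mult_distrib_left min_mult_distrib_left)
      finally show ?thesis .
    qed
    finally show "c i * cell_int l N (indicator {..<x}) i = c i * (l / real N) * clamp01 (x * real N / l - real i)"
      by simp
  qed
  finally show ?thesis .
qed

text \<open>Cells to the left of \<open>r\<close> contribute their full increments, which telescope,
  and those to the right nothing. What remains is a convex combination of two neighbouring values of
  \<open>Y\<close>.\<close>

lemma piecewise_linear_bound:
  assumes Y: "\<And>i. i \<le> N \<Longrightarrow> \<bar>Y i\<bar> \<le> (1::real)" and r: "0 \<le> r"
  shows "\<bar>Y 0 + (\<Sum>i<N. (Y (Suc i) - Y i) * clamp01 (r - real i))\<bar> \<le> 1"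
  using Y
proof (induction N)
  case (Suc N)
  show ?case
  proof (cases "r < real N")
    case True
    then have "clamp01 (r - real N) = 0" by (simp add: clamp01_def)
    then show ?thesis using Suc by simp
  next
    case False
    then have "(\<Sum>i<N. (Y (Suc i) - Y i) * clamp01 (r - real i)) = (\<Sum>i<N. Y (Suc i) - Y i)"
      by (intro sum.cong) (auto simp: clamp01_def)
    also have "\<dots> = Y N - Y 0" by (rule sum_lessThan_telescope)
    finally have *: "Y 0 + (\<Sum>i<Suc N. (Y (Suc i) - Y i) * clamp01 (r - real i))
        = (1 - clamp01 (r - real N)) * Y N + clamp01 (r - real N) * Y (Suc N)"
      by (simp add: algebra_simps)
    have c: "0 \<le> clamp01 (r - real N)" "clamp01 (r - real N) \<le> 1" by (auto simp: clamp01_def)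
    have "\<bar>(1 - clamp01 (r - real N)) * Y N + clamp01 (r - real N) * Y (Suc N)\<bar>
        \<le> (1 - clamp01 (r - real N)) * \<bar>Y N\<bar> + clamp01 (r - real N) * \<bar>Y (Suc N)\<bar>"
      using c by (intro order_trans[OF abs_triangle_ineq]) (simp add: abs_mult)
    also have "\<dots> \<le> (1 - clamp01 (r - real N)) * 1 + clamp01 (r - real N) * 1"
      using c Suc.prems by (intro add_mono mult_left_mono) auto
    finally show ?thesis unfolding * by simp
  qed
qed simp

text \<open>The slope is constant on cells, so \<open>f\<close> enters the pairing through its cell
  means alone; such a flow cannot see the averaging.\<close>

lemma piecewise_linear:
  fixes Y :: "nat \<Rightarrow> real"
  assumes N: "0 < N" and l: "0 < l" and Y: "\<And>i. i \<le> N \<Longrightarrow> \<bar>Y i\<bar> \<le> 1"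
  defines "g \<equiv> \<lambda>x. (Y (Suc (cell_index l N x)) - Y (cell_index l N x)) * real N / l"
  shows "Lp 2 l g" "prim l g l = Y N - Y 0" "x \<in> {0..l} \<Longrightarrow> \<bar>Y 0 + prim l g x\<bar> \<le> 1"
    "integrable (IV l) f \<Longrightarrow> (LINT x|IV l. f x * g x) = (\<Sum>i<N. (Y (Suc i) - Y i) * cell_mean l N f i)"
proof -
  define c where "c i = (Y (Suc i) - Y i) * real N / l" for i
  have g: "g = (\<lambda>x. c (cell_index l N x))" unfolding g_def c_def by simp
  have "\<bar>g x\<bar> \<le> (\<Sum>i<N. \<bar>c i\<bar>)" if "x \<in> {0<..<l}" for x
    unfolding g using cell_index_less[OF N that] by (intro member_le_sum) auto
  moreover have "g \<in> borel_measurable (IV l)" unfolding g by measurable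
  ultimately show "Lp 2 l g" by (intro Lp2_bounded)
  have p: "prim l g x = (\<Sum>i<N. (Y (Suc i) - Y i) * clamp01 (x * real N / l - real i))" if "x \<in> {0..l}" for x
    using prim_step[OF N l that, of c] N l unfolding g by (simp add: c_def)
  have "prim l g l = (\<Sum>i<N. (Y (Suc i) - Y i))"
    using l by (subst p) (auto simp: clamp01_def intro!: sum.cong)
  then show "prim l g l = Y N - Y 0" by (simp add: sum_lessThan_telescope)
  show "\<bar>Y 0 + prim l g x\<bar> \<le> 1" if "x \<in> {0..l}"
    unfolding p[OF that] using that l N by (intro piecewise_linear_bound Y) auto
  show "(LINT x|IV l. f x * g x) = (\<Sum>i<N. (Y (Suc i) - Y i) * cell_mean l N f i)" if f: "integrable (IV l) f"
    using LINT_step_mult[OF f N, of c] unfolding g by (simp add: mult.commute c_def cell_mean_def mult.left_commute mult.assoc)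
qed

text \<open>Averaging over cells is an orthogonal projection in L^2; this is its symmetry.\<close>

lemma LINT_mult_step_mean_commute:
  assumes "integrable (IV l) f" "integrable (IV l) g" "0 < N"
  shows "(LINT x|IV l. cell_mean l N g (cell_index l N x) * f x) = (LINT x|IV l. cell_mean l N f (cell_index l N x) * g x)"
  using LINT_step_mult[OF assms(1,3), of "cell_mean l N g"] LINT_step_mult[OF assms(2,3), of "cell_mean l N f"]
  by (simp add: cell_mean_def mult_ac)

lemma abs_cell_mean_le:
  assumes "\<And>x. x \<in> {0<..<l} \<Longrightarrow> \<bar>f x\<bar> \<le> B" "f \<in> borel_measurable (IV l)" "0 < N" "0 < l" "i < N"
  shows "\<bar>cell_mean l N f i\<bar> \<le> B"
proof -
  have f: "integrable (IV l) f" using assms by (intro integrable_IV_bounded)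
  have "0 < l / 2 \<and> l / 2 < l" using assms by auto
  then have B: "0 \<le> B" using assms(1)[of "l/2"] by fastforce
  have "\<bar>cell_int l N f i\<bar> \<le> (LINT x|IV l. \<bar>if cell_index l N x = i then f x else 0\<bar>)"
    unfolding cell_int_def by (rule integral_abs_bound)
  also have "\<dots> \<le> cell_int l N (\<lambda>_. B) i"
    unfolding cell_int_def
    by (intro integral_mono integrable_abs integrable_cell f integrable_const_IV)
      (use assms(1) B in auto)
  also have "\<dots> = B * l / real N" by (rule cell_int_const) (use assms in auto)
  finally show ?thesis
    using assms unfolding cell_mean_def by (simp add: abs_mult field_simps)
qed

text \<open>
  The primitive of \<open>\<phi>\<close> minus its cell means vanishes at all mesh points, hence is of size $1/N$. Testing
  the total variation of \<open>u\<close> against it bounds the $L^1$ distance of \<open>u\<close> from its cell means; this is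
  the only compactness used.
\<close>

lemma oscillation_flow:
  fixes \<phi> :: "real \<Rightarrow> real"
  assumes N: "0 < N" and l: "0 < l" and \<phi>: "\<phi> \<in> borel_measurable (IV l)" "\<And>x. x \<in> {0<..<l} \<Longrightarrow> \<bar>\<phi> x\<bar> \<le> 1"
  defines "g \<equiv> \<lambda>x. (\<phi> x - cell_mean l N \<phi> (cell_index l N x)) * (real N / (2 * l))"
  shows "Lp 2 l g" "prim l g l = 0" "x \<in> {0..l} \<Longrightarrow> \<bar>prim l g x\<bar> \<le> 1"
proof -
  have N1: "real N / (2 * l) > 0" using N l by simp
  have i\<phi>: "integrable (IV l) \<phi>" by (rule integrable_IV_bounded[OF \<phi>])
  have gm: "g \<in> borel_measurable (IV l)"
    unfolding g_def using \<phi>(1) by measurable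
  \<comment> \<open>The difference is at most 2 in size, so \<open>g\<close> is at most
    \<open>real N / l\<close>. A cell has length \<open>l / real N\<close>, whence the primitive,
    which is 0 at the mesh points, stays within 1.\<close>
  have gb: "\<bar>g x\<bar> \<le> real N / l" if x: "x \<in> {0<..<l}" for x
  proof -
    have "\<bar>\<phi> x - cell_mean l N \<phi> (cell_index l N x)\<bar> \<le> 2"
      using \<phi>(2)[OF x] abs_cell_mean_le[OF \<phi>(2,1) N l cell_index_less[OF N x]] by linarith
    then have "\<bar>g x\<bar> \<le> 2 * (real N / (2 * l))"
      unfolding g_def abs_mult using N1 by (intro mult_mono) auto
    then show ?thesis by simp
  qed
  show "Lp 2 l g" by (rule Lp2_bounded[OF gm gb])
  have ig: "integrable (IV l) g" by (rule integrable_IV_bounded[OF gm gb])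
  have zero: "cell_int l N g i = 0" if i: "i < N" for i
  proof -
    have "cell_int l N g i = (LINT x|IV l. ((if cell_index l N x = i then \<phi> x else 0)
        - (if cell_index l N x = i then cell_mean l N \<phi> i else 0)) * (real N / (2 * l)))"
      unfolding cell_int_def g_def by (intro Bochner_Integration.integral_cong) auto
    also have "\<dots> = (cell_int l N \<phi> i - cell_int l N (\<lambda>_. cell_mean l N \<phi> i) i) * (real N / (2 * l))"
      unfolding cell_int_def
      by (subst integral_mult_left_zero, subst Bochner_Integration.integral_diff)
        (auto intro!: integrable_cell i\<phi> integrable_const_IV)
    also have "\<dots> = 0" using cell_int_const[OF N l i] N l by (simp add: cell_mean_def)
    finally show ?thesis .
  qed
  have node: "prim l g (l * real j / real N) = 0" if "j \<le> N" for j
    using that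
  proof (induction j)
    case 0
    then show ?case by (simp add: prim_nonpos)
  next
    case (Suc j)
    then show ?case using cell_int_eq_prim_diff[OF ig N l, of j] zero[of j] by simp
  qed
  show "prim l g l = 0" using node[of N] N by simp
  show "\<bar>prim l g x\<bar> \<le> 1" if x: "x \<in> {0..l}"
  proof (cases "x = l")
    case True
    then show ?thesis using \<open>prim l g l = 0\<close> by simp
  next
    case False
    define j where "j = cell_index l N x"
    have j: "l * real j / real N \<le> x" "x < l * real (Suc j) / real N"
      using cell_index_eq_iff[OF l N, of x j] x by (auto simp: j_def)
    have jN: "j \<le> N"
    proof (rule ccontr)
      assume "\<not> j \<le> N"
      then have "l * 1 \<le> l * (real j / real N)" using l N by (intro mult_left_mono) auto
      then show False using j x False by simp
    qed
    have "prim l g x = (LINT t|IV l. indicator {l * real j / real N..<x} t * g t)"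
      using prim_diff[OF ig j(1)] node[OF jN] by simp
    then have "\<bar>prim l g x\<bar> \<le> (LINT t|IV l. \<bar>indicator {l * real j / real N..<x} t * g t\<bar>)"
      using integral_abs_bound by metis
    also have "\<dots> \<le> (LINT t|IV l. (real N / l) * indicator {l * real j / real N..<x} t)"
    proof (rule integral_mono)
      show "integrable (IV l) (\<lambda>t. \<bar>indicator {l * real j / real N..<x} t * g t\<bar>)"
        by (intro integrable_abs integrable_indicator_IV ig) auto
      show "integrable (IV l) (\<lambda>t. (real N / l) * indicator {l * real j / real N..<x} t)"
        by (intro Bochner_Integration.integrable_mult_right integrable_indicator_one_IV) auto
    qed (use gb in \<open>auto simp: indicator_def\<close>)
    also have "\<dots> = (real N / l) * (x - l * real j / real N)"
      using measure_IV[of "l * real j / real N" x l] j x l by simp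
    also have "\<dots> \<le> (real N / l) * (l / real N)"
    proof (rule mult_left_mono)
      have "l * real (Suc j) / real N = l * real j / real N + l / real N"
        by (simp add: distrib_left add_divide_distrib)
      then show "x - l * real j / real N \<le> l / real N" using j(2) by linarith
    qed (use l in simp)
    also have "\<dots> = 1" using N l by simp
    finally show ?thesis .
  qed
qed

text \<open>By symmetry of the averaging, \<open>f\<close> against \<phi> minus its means equals
  \<open>f\<close> minus its means against \<phi>, and \<phi> is the sign of that
  difference.\<close>

lemma LINT_oscillation:
  assumes N: "0 < N" and l: "0 < l" and f: "integrable (IV l) f"
  defines "\<phi> \<equiv> \<lambda>x. sgn (f x - cell_mean l N f (cell_index l N x))"
  shows "(LINT x|IV l. f x * ((\<phi> x - cell_mean l N \<phi> (cell_index l N x)) * (real N / (2 * l))))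
    = (real N / (2 * l)) * (LINT x|IV l. \<bar>f x - cell_mean l N f (cell_index l N x)\<bar>)"
proof -
  have [measurable]: "f \<in> borel_measurable (IV l)" using f by auto
  have m: "\<phi> \<in> borel_measurable (IV l)" unfolding \<phi>_def by measurable
  have b: "\<bar>\<phi> x\<bar> \<le> 1" for x unfolding \<phi>_def by (simp add: sgn_if)
  have i\<phi>: "integrable (IV l) \<phi>" by (rule integrable_IV_bounded[OF m b])
  have i1: "integrable (IV l) (\<lambda>x. f x * \<phi> x)"
    by (rule Bochner_Integration.integrable_bound[OF f])
      (use m b in \<open>auto intro!: AE_I2 mult_left_le simp: abs_mult\<close>)
  have i2: "integrable (IV l) (\<lambda>x. cell_mean l N \<phi> (cell_index l N x) * f x)"
    by (rule integrable_step_mult[OF f N])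
  have i3: "integrable (IV l) (\<lambda>x. cell_mean l N f (cell_index l N x) * \<phi> x)"
    by (rule integrable_step_mult[OF i\<phi> N])
  have "(LINT x|IV l. f x * ((\<phi> x - cell_mean l N \<phi> (cell_index l N x)) * (real N / (2 * l))))
     = (LINT x|IV l. (real N / (2 * l)) * (f x * \<phi> x - cell_mean l N \<phi> (cell_index l N x) * f x))"
    by (intro Bochner_Integration.integral_cong) (auto simp: algebra_simps)
  also have "\<dots> = (real N / (2 * l)) * ((LINT x|IV l. f x * \<phi> x) - (LINT x|IV l. cell_mean l N f (cell_index l N x) * \<phi> x))"
    using i1 i2 LINT_mult_step_mean_commute[OF f i\<phi> N] by simp
  also have "\<dots> = (real N / (2 * l)) * (LINT x|IV l. f x * \<phi> x - cell_mean l N f (cell_index l N x) * \<phi> x)"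
    using i1 i3 by simp
  also have "\<dots> = (real N / (2 * l)) * (LINT x|IV l. \<bar>f x - cell_mean l N f (cell_index l N x)\<bar>)"
    unfolding \<phi>_def left_diff_distrib[symmetric] by (simp only: abs_sgn[symmetric] mult.commute)
  finally show ?thesis .
qed

lemma prim_deriv_test_fun:
  assumes T: "test_fun l \<phi>" and x: "x \<in> {0..l}"
  shows "prim l (deriv \<phi>) x = \<phi> x"
proof -
  note D = test_funD[OF T]
  have i: "integrable (IV l) (deriv \<phi>)" by (rule integrable_IV_continuous[OF D(2)])
  have "prim l (deriv \<phi>) x = (LINT t|IV l. deriv \<phi> t) - (LINT t|IV l. indicator {x..} t * deriv \<phi> t)"
    unfolding prim_def
    by (subst Bochner_Integration.integral_diff[symmetric])
      (auto intro!: integrable_indicator_IV i Bochner_Integration.integral_cong split: split_indicator)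
  also have "(LINT t|IV l. indicator {x..} t * deriv \<phi> t) = (LINT t|IV l. indicator {x<..} t * deriv \<phi> t)"
  proof (rule integral_cong_AE)
    show "AE t in IV l. indicat_real {x..} t * deriv \<phi> t = indicat_real {x<..} t * deriv \<phi> t"
      using AE_IV_neq[of x l] by eventually_elim (auto simp: indicator_def)
  qed (auto intro!: borel_measurable_integrable integrable_indicator_IV i)
  finally show ?thesis
    using FTC_IV[OF D(1,2), of x l] FTC_IV0[OF D(1,2), of l] x D(3)[of l] D(3)[of 0] by simp
qed

lemma LINT_one: "0 < l \<Longrightarrow> (LINT x|IV l. 1) = l"
  using cell_int_const[of 1 l 0 1] LINT_eq_sum_cell_int[OF integrable_const_IV, of 1 l "1::real"] by simp

section \<open>Total variation in terms of flows\<close>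

definition kirchhoff :: "('v, 'e) metric_graph \<Rightarrow> ('e \<Rightarrow> real \<Rightarrow> real) \<Rightarrow> bool" where
  "kirchhoff G y \<longleftrightarrow> (\<forall>v\<in>verts G. (\<Sum>e\<in>incident_edges G v. if v = head G e then y e (len G e) else - y e 0) = 0)"

text \<open>The admissible fields of the dual problem, with the derivative \<open>g\<close> and the
  continuous representative \<open>y\<close> as explicit data. \<open>TV_ge\<close> and
  \<open>TV_le\<close> pass between flows and \<open>X_K\<close>, so that the choice operators can
  be left behind.\<close>

definition flow :: "('v, 'e) metric_graph \<Rightarrow> ('e \<Rightarrow> real \<Rightarrow> real) \<Rightarrow> ('e \<Rightarrow> real \<Rightarrow> real) \<Rightarrow> bool" where
  "flow G g y \<longleftrightarrow> kirchhoff G y \<and> (\<forall>e\<in>arcs G. Lp 2 (len G e) (g e) \<and>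
     (\<forall>x\<in>{0..len G e}. y e x = y e 0 + prim (len G e) (g e) x \<and> \<bar>y e x\<bar> \<le> 1))"

definition pairing :: "('v, 'e) metric_graph \<Rightarrow> ('e \<times> real \<Rightarrow> real) \<Rightarrow> ('e \<Rightarrow> real \<Rightarrow> real) \<Rightarrow> real" where
  "pairing G u g = (\<Sum>e\<in>arcs G. LINT x|IV (len G e). u (e, x) * g e x)"

definition gL1 :: "('v, 'e) metric_graph \<Rightarrow> ('e \<times> real \<Rightarrow> real) \<Rightarrow> bool" where
  "gL1 G u \<longleftrightarrow> (\<forall>e\<in>arcs G. integrable (IV (len G e)) (\<lambda>x. u (e, x)))"

lemma flowD:
  assumes "flow G g y" "e \<in> arcs G"
  shows "Lp 2 (len G e) (g e)"
    "x \<in> {0..len G e} \<Longrightarrow> y e x = y e 0 + prim (len G e) (g e) x"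
    "x \<in> {0..len G e} \<Longrightarrow> \<bar>y e x\<bar> \<le> 1"
  using assms unfolding flow_def by blast+

locale mgraph =
  fixes G :: "('v, 'e) metric_graph"
  assumes cmg: "connected_compact_metric_graph G"
begin

abbreviation EV :: "'e \<Rightarrow> real measure" where
  "EV e \<equiv> IV (len G e)"

lemma digraph_truncate: "digraph (pre_digraph.truncate G)"
  using cmg by (simp add: connected_compact_metric_graph_def)

lemma truncate_simps [simp]:
  "arcs (pre_digraph.truncate G) = arcs G" "verts (pre_digraph.truncate G) = verts G"
  "head (pre_digraph.truncate G) = head G" "tail (pre_digraph.truncate G) = tail G"
  by (simp_all add: pre_digraph.truncate_def)

lemma finite_arcs [simp]: "finite (arcs G)"
  using digraph_truncate fin_digraph.finite_arcs[of "pre_digraph.truncate G"]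
  by (simp add: digraph_def)

lemma finite_verts [simp]: "finite (verts G)"
  using digraph_truncate fin_digraph.finite_verts[of "pre_digraph.truncate G"]
  by (simp add: digraph_def)

lemma ends_in_verts: "e \<in> arcs G \<Longrightarrow> head G e \<in> verts G" "e \<in> arcs G \<Longrightarrow> tail G e \<in> verts G"
proof -
  interpret digraph "pre_digraph.truncate G" by (rule digraph_truncate)
  show "e \<in> arcs G \<Longrightarrow> head G e \<in> verts G" "e \<in> arcs G \<Longrightarrow> tail G e \<in> verts G"
    using head_in_verts[of e] tail_in_verts[of e] by auto
qed

lemma no_loop: "e \<in> arcs G \<Longrightarrow> tail G e \<noteq> head G e"
proof -
  interpret digraph "pre_digraph.truncate G" by (rule digraph_truncate)
  show "e \<in> arcs G \<Longrightarrow> tail G e \<noteq> head G e"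
    using no_loops[of e] by auto
qed

lemma len_pos: "e \<in> arcs G \<Longrightarrow> 0 < len G e"
  using cmg by (simp add: connected_compact_metric_graph_def)

lemma arcs_nonempty: "arcs G \<noteq> {}"
  using cmg by (simp add: connected_compact_metric_graph_def)

lemma pairing_eq_gint:
  "gint G (\<lambda>p. u p * gderiv G z p) = pairing G u (\<lambda>e. weak_deriv (len G e) (curry z e))"
  by (simp add: gint_def pairing_def gderiv_def)

lemma TV_ge:
  assumes f: "flow G g y" and u: "gL1 G u"
  shows "ereal \<bar>pairing G u g\<bar> \<le> TV G u"
proof -
  define z where "z = (\<lambda>(e, x). y e 0 + prim (len G e) (g e) x)"
  have z: "curry z e = (\<lambda>x. y e 0 + prim (len G e) (g e) x)" for e
    by (auto simp: z_def fun_eq_iff)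
  have g: "Lp 2 (len G e) (g e)" and y: "x \<in> {0..len G e} \<Longrightarrow> y e x = y e 0 + prim (len G e) (g e) x"
    and y1: "x \<in> {0..len G e} \<Longrightarrow> \<bar>y e x\<bar> \<le> 1" if "e \<in> arcs G" for e x
    using flowD[OF f that] by blast+
  have W: "W12 (len G e) (curry z e)" "AE x in EV e. weak_deriv (len G e) (curry z e) x = g e x"
    "x \<in> {0..len G e} \<Longrightarrow> cont_rep (len G e) (curry z e) x = y e x" if "e \<in> arcs G" for e x
  proof -
    note W = W12_prim[OF g[OF that] len_pos[OF that], where c="y e 0", folded z]
    show "W12 (len G e) (curry z e)" "AE x in EV e. weak_deriv (len G e) (curry z e) x = g e x"
      by (fact W(1), fact W(2))
    assume x: "x \<in> {0..len G e}"
    have "cont_rep (len G e) (curry z e) x = y e 0 + prim (len G e) (g e) x" by (rule W(3)[OF x])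
    also have "\<dots> = y e x" by (rule y[OF that x, symmetric])
    finally show "cont_rep (len G e) (curry z e) x = y e x" .
  qed
  have zX: "z \<in> X_K G"
    unfolding X_K_def gW12_def
  proof (intro CollectI conjI ballI)
    fix v assume v: "v \<in> verts G"
    have "(\<Sum>e\<in>incident_edges G v. vertex_value G z e v) = (\<Sum>e\<in>incident_edges G v. if v = head G e then y e (len G e) else - y e 0)"
      by (intro sum.cong refl)
        (use W(3) len_pos in \<open>auto simp: vertex_value_def incident_edges_def less_imp_le\<close>)
    then show "(\<Sum>e\<in>incident_edges G v. vertex_value G z e v) = 0"
      using f v by (simp add: flow_def kirchhoff_def)
  qed (use W in auto)
  have "Linf_le_1 G z"
    unfolding Linf_le_1_def
  proof (intro ballI AE_I2)
    fix e x assume "e \<in> arcs G" "x \<in> space (EV e)"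
    then show "\<bar>z (e, x)\<bar> \<le> 1" using y1[of e x] y[of e x] by (simp add: z_def)
  qed
  then have "ereal \<bar>gint G (\<lambda>p. u p * gderiv G z p)\<bar> \<le> TV G u"
    unfolding TV_def by (intro SUP_upper) (use zX in auto)
  also have "gint G (\<lambda>p. u p * gderiv G z p) = pairing G u g"
    unfolding pairing_eq_gint pairing_def
  \<comment> \<open>For \<open>u\<close> in L1 the product with \<open>g\<close> may fail to be
    integrable. Both integrals then have the default value 0, so measurability and equality almost
    everywhere suffice.\<close>
  proof (intro sum.cong refl integral_cong_AE)
    fix e assume e: "e \<in> arcs G"
    have [measurable]: "(\<lambda>x. u (e, x)) \<in> borel_measurable (EV e)"
      using u e by (auto simp: gL1_def)
    have "Lp 2 (len G e) (weak_deriv (len G e) (curry z e))"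
      by (rule W12_cont_rep(1)[OF W(1)[OF e] len_pos[OF e]])
    then have [measurable]: "weak_deriv (len G e) (curry z e) \<in> borel_measurable (EV e)"
      by (simp add: Lp_def)
    have [measurable]: "g e \<in> borel_measurable (EV e)" using g[OF e] by (simp add: Lp_def)
    show "(\<lambda>x. u (e, x) * weak_deriv (len G e) (curry z e) x) \<in> borel_measurable (EV e)"
      "(\<lambda>x. u (e, x) * g e x) \<in> borel_measurable (EV e)" by measurable
    show "AE x in EV e. u (e, x) * weak_deriv (len G e) (curry z e) x = u (e, x) * g e x"
      using W(2)[OF e] by eventually_elim auto
  qed
  finally show ?thesis .
qed

lemma X_K_flow:
  assumes z: "z \<in> X_K G" and z1: "Linf_le_1 G z"
  shows "flow G (\<lambda>e. weak_deriv (len G e) (curry z e)) (\<lambda>e. cont_rep (len G e) (curry z e))"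
  unfolding flow_def
proof (intro conjI ballI)
  show "kirchhoff G (\<lambda>e. cont_rep (len G e) (curry z e))"
    using z by (auto simp: kirchhoff_def X_K_def vertex_value_def)
next
  fix e assume e: "e \<in> arcs G"
  note l = len_pos[OF e]
  have W: "W12 (len G e) (curry z e)" using z e by (auto simp: X_K_def gW12_def)
  note R = W12_cont_rep[OF W l]
  show "Lp 2 (len G e) (weak_deriv (len G e) (curry z e))" by (rule R(1))
  fix x assume x: "x \<in> {0..len G e}"
  show "cont_rep (len G e) (curry z e) x = cont_rep (len G e) (curry z e) 0 +
         prim (len G e) (weak_deriv (len G e) (curry z e)) x" by (rule R(4)[OF x])
  \<comment> \<open>The bound on \<open>z\<close> holds almost everywhere only. The excess over 1 is
    continuous and vanishes almost everywhere, hence everywhere.\<close>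
  have "max 0 (\<bar>cont_rep (len G e) (curry z e) x\<bar> - 1) = 0"
  proof (rule continuous_AE_zero[OF _ _ l x])
    show "continuous_on {0..len G e} (\<lambda>x. max 0 (\<bar>cont_rep (len G e) (curry z e) x\<bar> - 1))"
      by (intro continuous_intros R(5))
    have "AE x in EV e. \<bar>z (e, x)\<bar> \<le> 1" using z1 e by (auto simp: Linf_le_1_def)
    with R(3) show "AE x in EV e. max 0 (\<bar>cont_rep (len G e) (curry z e) x\<bar> - 1) = 0"
      by eventually_elim auto
  qed
  then show "\<bar>cont_rep (len G e) (curry z e) x\<bar> \<le> 1" by linarith
qed

lemma flow_uminus:
  assumes "flow G g y"
  shows "flow G (\<lambda>e x. - g e x) (\<lambda>e x. - y e x)"
proof -
  have "kirchhoff G (\<lambda>e x. - y e x)"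
    unfolding kirchhoff_def
  proof
    fix v assume v: "v \<in> verts G"
    have "(\<Sum>e\<in>incident_edges G v. if v = head G e then - y e (len G e) else - (- y e 0))
      = - (\<Sum>e\<in>incident_edges G v. if v = head G e then y e (len G e) else - y e 0)"
      unfolding sum_negf[symmetric] by (intro sum.cong) auto
    then show "(\<Sum>e\<in>incident_edges G v. if v = head G e then - y e (len G e) else - (- y e 0)) = 0"
      using assms v by (simp add: flow_def kirchhoff_def)
  qed
  moreover have "Lp 2 (len G e) (\<lambda>x. - g e x)" if "e \<in> arcs G" for e
    using flowD(1)[OF assms that] by (simp add: Lp_def)
  moreover have "- y e x = - y e 0 + prim (len G e) (\<lambda>x. - g e x) x" "\<bar>- y e x\<bar> \<le> 1"
    if "e \<in> arcs G" "x \<in> {0..len G e}" for e x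
    using flowD(2,3)[OF assms that] by (simp_all add: prim_def)
  ultimately show ?thesis unfolding flow_def by blast
qed

lemma pairing_uminus: "pairing G u (\<lambda>e x. - g e x) = - pairing G u g"
  by (simp add: pairing_def sum_negf)

lemma TV_le:
  assumes "\<And>g y. flow G g y \<Longrightarrow> ereal (pairing G u g) \<le> K"
  shows "TV G u \<le> K"
  unfolding TV_def
proof (rule SUP_least)
  fix z assume "z \<in> {z \<in> X_K G. Linf_le_1 G z}"
  then have f: "flow G (\<lambda>e. weak_deriv (len G e) (curry z e)) (\<lambda>e. cont_rep (len G e) (curry z e))"
    by (auto intro: X_K_flow)
  show "ereal \<bar>gint G (\<lambda>p. u p * gderiv G z p)\<bar> \<le> K"
    unfolding pairing_eq_gint using assms[OF f] assms[OF flow_uminus[OF f]]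
    by (auto simp: abs_if pairing_uminus)
qed

text \<open>Vanishing at both ends of the edge makes Kirchhoff's law trivial. Such flows localize
  \<open>TV\<close> to a single edge.\<close>

lemma flow_edge:
  assumes e: "e \<in> arcs G" and g: "Lp 2 (len G e) g" "prim (len G e) g (len G e) = 0"
    "\<And>x. x \<in> {0..len G e} \<Longrightarrow> \<bar>prim (len G e) g x\<bar> \<le> 1"
  shows "flow G (\<lambda>e'. if e' = e then g else (\<lambda>_. 0)) (\<lambda>e'. if e' = e then prim (len G e) g else (\<lambda>_. 0))"
proof -
  have "kirchhoff G (\<lambda>e'. if e' = e then prim (len G e) g else (\<lambda>_. 0))"
    unfolding kirchhoff_def using g(2) by (intro ballI sum.neutral) (auto simp: prim_nonpos)
  then show ?thesis using g unfolding flow_def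
    by (auto simp: prim_nonpos prim_zero Lp_def)
qed

lemma pairing_edge:
  assumes e: "e \<in> arcs G"
  shows "pairing G u (\<lambda>e'. if e' = e then g else (\<lambda>_. 0)) = (LINT x|EV e. u (e, x) * g x)"
proof -
  have "pairing G u (\<lambda>e'. if e' = e then g else (\<lambda>_. 0))
      = (\<Sum>e'\<in>arcs G. if e' = e then LINT x|EV e. u (e, x) * g x else 0)"
    unfolding pairing_def by (intro sum.cong) auto
  then show ?thesis using e by simp
qed

lemma TV_nonneg: "gL1 G u \<Longrightarrow> 0 \<le> TV G u"
proof -
  assume u: "gL1 G u"
  obtain e where e: "e \<in> arcs G" using arcs_nonempty by auto
  have "flow G (\<lambda>e'. if e' = e then (\<lambda>_. 0) else (\<lambda>_. 0)) (\<lambda>e'. if e' = e then prim (len G e) (\<lambda>_. 0) else (\<lambda>_. 0))"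
    by (rule flow_edge[OF e]) (auto simp: prim_def Lp_def)
  from TV_ge[OF this u] show ?thesis by (metis abs_ge_zero ereal_less_eq(5) order_trans)
qed

text \<open>Test \<open>u\<close> with the flow of \<open>oscillation_flow\<close>, placed on one
  edge. For \<open>N = 1\<close> and \<open>K = 0\<close> the bound says that \<open>u\<close> is
  almost everywhere constant on the edge.\<close>

lemma cell_mean_error:
  assumes u: "gL1 G u" and K: "TV G u \<le> ereal K" and e: "e \<in> arcs G" and N: "0 < N"
  shows "(LINT x|EV e. \<bar>u (e, x) - cell_mean (len G e) N (\<lambda>x. u (e, x)) (cell_index (len G e) N x)\<bar>)
    \<le> 2 * len G e / real N * K"
proof -
  let ?f = "\<lambda>x. u (e, x)" and ?l = "len G e"
  note l = len_pos[OF e]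
  have i: "integrable (IV ?l) ?f" using u e by (auto simp: gL1_def)
  have [measurable]: "?f \<in> borel_measurable (IV ?l)" using i by auto
  define \<phi> where "\<phi> x = sgn (?f x - cell_mean ?l N ?f (cell_index ?l N x))" for x
  define g where "g x = (\<phi> x - cell_mean ?l N \<phi> (cell_index ?l N x)) * (real N / (2 * ?l))" for x
  have m: "\<phi> \<in> borel_measurable (IV ?l)" unfolding \<phi>_def by measurable
  have b: "\<bar>\<phi> x\<bar> \<le> 1" for x by (simp add: \<phi>_def sgn_if)
  have F: "flow G (\<lambda>e'. if e' = e then g else (\<lambda>_. 0)) (\<lambda>e'. if e' = e then prim ?l g else (\<lambda>_. 0))"
    using oscillation_flow[OF N l m b] unfolding g_def[symmetric] by (intro flow_edge e) auto
  have "ereal (LINT x|IV ?l. ?f x * g x) \<le> ereal K"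
    using TV_ge[OF F u] K unfolding pairing_edge[OF e]
    by (metis abs_ge_self ereal_less_eq(3) order_trans)
  then have "(real N / (2 * ?l)) * (LINT x|IV ?l. \<bar>?f x - cell_mean ?l N ?f (cell_index ?l N x)\<bar>) \<le> K"
    unfolding g_def LINT_oscillation[OF N l i, folded \<phi>_def] ereal_less_eq(3) .
  then show ?thesis using N l by (simp add: field_simps)
qed

text \<open>A test function bounded by 1 is a flow on one edge, so \<open>TV\<close> dominates the
  variation on every edge.\<close>

lemma gBV_if_TV_finite:
  assumes u: "gL1 G u" and K: "TV G u \<le> ereal K"
  shows "gBV G u"
  unfolding gBV_def BV_def
proof (intro ballI conjI)
  fix e assume e: "e \<in> arcs G"
  have i: "integrable (EV e) (\<lambda>x. u (e, x))" using u e by (auto simp: gL1_def)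
  then show "Lp 1 (len G e) (curry u e)" by (auto simp: Lp_def curry_def)
  show "bdd_above {LINT x|EV e. curry u e x * deriv \<phi> x |\<phi>. test_fun (len G e) \<phi> \<and> (\<forall>x. \<bar>\<phi> x\<bar> \<le> 1)}"
  proof (rule bdd_aboveI[of _ K], clarify)
    fix \<phi> assume T: "test_fun (len G e) \<phi>" and b: "\<forall>x. \<bar>\<phi> x\<bar> \<le> 1"
    have "flow G (\<lambda>e'. if e' = e then deriv \<phi> else (\<lambda>_. 0)) (\<lambda>e'. if e' = e then prim (len G e) (deriv \<phi>) else (\<lambda>_. 0))"
      using len_pos[OF e] b test_funD(3)[OF T, of "len G e"]
      by (intro flow_edge[OF e] Lp2_continuous test_funD(2)[OF T]) (auto simp: prim_deriv_test_fun[OF T])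
    from TV_ge[OF this u] show "(LINT x|EV e. curry u e x * deriv \<phi> x) \<le> K"
      using K unfolding pairing_edge[OF e] curry_def
      by (metis abs_ge_self ereal_less_eq(3) order_trans)
  qed
qed

section \<open>Kirchhoff's law summed over the graph\<close>

lemma sum_incident:
  "(\<Sum>v\<in>verts G. \<Sum>e\<in>incident_edges G v. F e v) = (\<Sum>e\<in>arcs G. F e (tail G e) + F e (head G e))"
proof -
  have "(\<Sum>v\<in>verts G. \<Sum>e\<in>incident_edges G v. F e v)
      = (\<Sum>v\<in>verts G. sum (\<lambda>e. F e v) {e \<in> arcs G. tail G e = v \<or> head G e = v})"
    by (simp add: incident_edges_def)
  also have "\<dots> = (\<Sum>e\<in>arcs G. sum (F e) {v \<in> verts G. tail G e = v \<or> head G e = v})"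
    by (rule sum.swap_restrict) auto
  also have "\<dots> = (\<Sum>e\<in>arcs G. F e (tail G e) + F e (head G e))"
  proof (intro sum.cong refl)
    fix e assume e: "e \<in> arcs G"
    then have "{v \<in> verts G. tail G e = v \<or> head G e = v} = {tail G e, head G e}"
      using ends_in_verts by auto
    then show "sum (F e) {v \<in> verts G. tail G e = v \<or> head G e = v} = F e (tail G e) + F e (head G e)"
      using no_loop[OF e] by simp
  qed
  finally show ?thesis .
qed

lemma flow_integral:
  assumes "flow G g y" "e \<in> arcs G"
  shows "integrable (EV e) (g e)" "(LINT x|EV e. g e x) = y e (len G e) - y e 0"
proof -
  show "integrable (EV e) (g e)" by (intro Lp2_imp_integrable flowD(1)[OF assms])
  have "(LINT x|EV e. g e x) = prim (len G e) (g e) (len G e)"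
    unfolding prim_def by (intro Bochner_Integration.integral_cong) auto
  then show "(LINT x|EV e. g e x) = y e (len G e) - y e 0"
    using flowD(2)[OF assms, of "len G e"] len_pos[OF assms(2)] by simp
qed

text \<open>Each edge enters the Kirchhoff sums at its two ends with opposite signs, so their sum
  over all vertices is the total of \<open>g\<close>. This is why \<open>TV\<close> ignores
  constants.\<close>

lemma flow_total_zero:
  assumes "flow G g y"
  shows "(\<Sum>e\<in>arcs G. LINT x|EV e. g e x) = 0"
proof -
  have "(\<Sum>e\<in>arcs G. LINT x|EV e. g e x) = (\<Sum>e\<in>arcs G. y e (len G e) - y e 0)"
    by (intro sum.cong refl flow_integral assms)
  also have "\<dots> = (\<Sum>v\<in>verts G. \<Sum>e\<in>incident_edges G v. if v = head G e then y e (len G e) else - y e 0)"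
    unfolding sum_incident using no_loop by (intro sum.cong) auto
  also have "\<dots> = 0" using assms by (simp add: flow_def kirchhoff_def)
  finally show ?thesis .
qed

end

text \<open>
  Pair a minimizer of \<open>w\<close> (weight \<open>-1\<close>) with a maximizer (weight \<open>1\<close>) and recurse on the other elements. The
  same weights are optimal for all thresholds \<open>t\<close>; this is the coarea formula at a single node.
\<close>

lemma extremal_pairing:
  fixes w :: "'a \<Rightarrow> real"
  assumes "finite A"
  shows "\<exists>s. (\<forall>a\<in>A. \<bar>s a\<bar> \<le> 1) \<and> sum s A = 0 \<and>
    (\<forall>t. sum s {a\<in>A. t < w a} = real (min (card {a\<in>A. t < w a}) (card {a\<in>A. \<not> t < w a})))"
  using assms
proof (induction "card A" arbitrary: A rule: less_induct)
  case less
  consider "A = {}" | a where "A = {a}" | "2 \<le> card A"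
  proof -
    have "card A = 0 \<or> card A = 1 \<or> 2 \<le> card A" by linarith
    then show ?thesis using that less.prems by (auto simp: card_1_singleton_iff)
  qed
  then show ?case
  proof cases
    case 1
    then show ?thesis by auto
  next
    case (2 a)
    have "{x \<in> {a}. t < w x} = (if t < w a then {a} else {})" "{x \<in> {a}. \<not> t < w x} = (if t < w a then {} else {a})" for t
      by auto
    then show ?thesis unfolding 2 by (intro exI[of _ "\<lambda>_. 0"]) auto
  next
    case 3
    then have ne: "A \<noteq> {}" by auto
    obtain a where a: "a \<in> A" "\<And>x. x \<in> A \<Longrightarrow> w a \<le> w x"
      using arg_min_if_finite(1)[OF less.prems ne, of w] arg_min_least[OF less.prems ne, of _ w] by blast
    have "A - {a} \<noteq> {}"
    proof
      assume "A - {a} = {}"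
      then have "A = {a}" using a by auto
      then show False using 3 by simp
    qed
    \<comment> \<open>Choosing \<open>b\<close> in \<open>A - {a}\<close> keeps the pair distinct
      even when \<open>w\<close> is constant; \<open>b\<close> is still a maximizer over
      \<open>A\<close>.\<close>
    then obtain b where b: "b \<in> A - {a}" "\<And>x. x \<in> A - {a} \<Longrightarrow> w x \<le> w b"
      using arg_min_if_finite(1)[of "A - {a}" "\<lambda>x. - w x"] arg_min_least[of "A - {a}" _ "\<lambda>x. - w x"] less.prems
      by (metis finite_Diff neg_le_iff_le)
    define A' where "A' = A - {a, b}"
    have A: "A = insert a (insert b A')" "a \<notin> insert b A'" "b \<notin> A'" using a b by (auto simp: A'_def)
    have fin: "finite A'" using less.prems by (simp add: A'_def)
    have "card A' < card A" using A fin by simp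
    from less.hyps[OF this fin] obtain s where s: "\<forall>x\<in>A'. \<bar>s x\<bar> \<le> 1" "sum s A' = 0"
      "\<And>t. sum s {x\<in>A'. t < w x} = real (min (card {x\<in>A'. t < w x}) (card {x\<in>A'. \<not> t < w x}))" by blast
    define s' where "s' = s(a := -1, b := 1)"
    have s'A: "sum s' B = sum s B" if "B \<subseteq> A'" for B
      using that A by (intro sum.cong) (auto simp: s'_def)
    have wab: "w a \<le> w b" using a b by auto
    have le: "w a \<le> w x" "w x \<le> w b" if "x \<in> A" for x
      using a(2)[OF that] b(2)[of x] that wab by (cases "x = a"; auto)+
    show ?thesis
    proof (intro exI[of _ s'] conjI allI)
      show "\<forall>x\<in>A. \<bar>s' x\<bar> \<le> 1" using s(1) A by (auto simp: s'_def)
      have total: "sum s' A = 0"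
        unfolding A(1) using A fin s'A[of A'] s(2) by (auto simp: s'_def)
      then show "sum s' A = 0" .
      fix t
      \<comment> \<open>If \<open>t\<close> separates \<open>a\<close> from \<open>b\<close>, both
        counts exceed those for \<open>A'\<close> by one, and so does the sum, since
        \<open>b\<close> has weight 1. Otherwise the level set is all of \<open>A\<close> or empty,
        and both sides are 0.\<close>
      consider "t < w a" | "w b \<le> t" | "w a \<le> t" "t < w b" by linarith
      then show "sum s' {x\<in>A. t < w x} = real (min (card {x\<in>A. t < w x}) (card {x\<in>A. \<not> t < w x}))"
      proof cases
        case 1
        then have sets: "{x\<in>A. t < w x} = A" "{x\<in>A. \<not> t < w x} = {}" using le by force+
        show ?thesis unfolding sets using total by simp
      next
        case 2
        then have sets: "{x\<in>A. t < w x} = {}" using le by force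
        show ?thesis unfolding sets by simp
      next
        case 3
        then have sets: "{x\<in>A. t < w x} = insert b {x\<in>A'. t < w x}" "{x\<in>A. \<not> t < w x} = insert a {x\<in>A'. \<not> t < w x}"
          using A by auto
        have nin: "b \<notin> {x\<in>A'. t < w x}" "a \<notin> {x\<in>A'. \<not> t < w x}" using A by auto
        show ?thesis unfolding sets using nin fin s(3)[of t] s'A[of "{x\<in>A'. t < w x}"]
          by (simp add: s'_def)
      qed
    qed
  qed
qed

text \<open>Distinct nodes share no element of \<open>B\<close>, so the weights can be chosen node
  by node.\<close>

lemma calibration:
  fixes w :: "'b \<Rightarrow> real" and \<nu> :: "'b \<Rightarrow> 'n"
  assumes "finite B"
  obtains s where "\<And>b. b \<in> B \<Longrightarrow> \<bar>s b\<bar> \<le> 1" "\<And>n. sum s {b\<in>B. \<nu> b = n} = 0"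
    "\<And>t. sum s {b\<in>B. t < w b} = real (\<Sum>n\<in>\<nu> ` B. min (card {b\<in>B. \<nu> b = n \<and> t < w b}) (card {b\<in>B. \<nu> b = n \<and> \<not> t < w b}))"
proof -
  have "\<forall>n. \<exists>s. (\<forall>a\<in>{b\<in>B. \<nu> b = n}. \<bar>s a\<bar> \<le> 1) \<and> sum s {b\<in>B. \<nu> b = n} = 0 \<and>
    (\<forall>t. sum s {a\<in>{b\<in>B. \<nu> b = n}. t < w a} = real (min (card {a\<in>{b\<in>B. \<nu> b = n}. t < w a}) (card {a\<in>{b\<in>B. \<nu> b = n}. \<not> t < w a})))"
    using assms by (intro allI extremal_pairing) auto
  then obtain S where S: "\<And>n. (\<forall>a\<in>{b\<in>B. \<nu> b = n}. \<bar>S n a\<bar> \<le> 1)" "\<And>n. sum (S n) {b\<in>B. \<nu> b = n} = 0"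
    "\<And>n t. sum (S n) {a\<in>{b\<in>B. \<nu> b = n}. t < w a} = real (min (card {a\<in>{b\<in>B. \<nu> b = n}. t < w a}) (card {a\<in>{b\<in>B. \<nu> b = n}. \<not> t < w a}))"
    by metis
  define s where "s b = S (\<nu> b) b" for b
  show ?thesis
  proof
    show "\<bar>s b\<bar> \<le> 1" if "b \<in> B" for b using S(1) that by (auto simp: s_def)
    show "sum s {b\<in>B. \<nu> b = n} = 0" for n
      using S(2)[of n] by (subst sum.cong[OF refl, of _ _ "S n"]) (auto simp: s_def)
    fix t
    have "sum s {b\<in>B. t < w b} = (\<Sum>n\<in>\<nu> ` B. sum s {b\<in>{b\<in>B. t < w b}. \<nu> b = n})"
      using assms by (intro sum.group[symmetric]) auto
    also have "\<dots> = (\<Sum>n\<in>\<nu> ` B. real (min (card {b\<in>B. \<nu> b = n \<and> t < w b}) (card {b\<in>B. \<nu> b = n \<and> \<not> t < w b})))"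
    proof (intro sum.cong refl)
      fix n
      have e1: "{b\<in>{b\<in>B. t < w b}. \<nu> b = n} = {a\<in>{b\<in>B. \<nu> b = n}. t < w a}" by auto
      have e2: "{b\<in>B. \<nu> b = n \<and> t < w b} = {a\<in>{b\<in>B. \<nu> b = n}. t < w a}"
        "{b\<in>B. \<nu> b = n \<and> \<not> t < w b} = {a\<in>{b\<in>B. \<nu> b = n}. \<not> t < w a}" by auto
      have e3: "sum s {a\<in>{b\<in>B. \<nu> b = n}. t < w a} = sum (S n) {a\<in>{b\<in>B. \<nu> b = n}. t < w a}"
        by (intro sum.cong) (auto simp: s_def)
      show "sum s {b\<in>{b\<in>B. t < w b}. \<nu> b = n} = real (min (card {b\<in>B. \<nu> b = n \<and> t < w b}) (card {b\<in>B. \<nu> b = n \<and> \<not> t < w b}))"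
        unfolding e1 e2 e3 by (rule S(3))
    qed
    finally show "sum s {b\<in>B. t < w b} = real (\<Sum>n\<in>\<nu> ` B. min (card {b\<in>B. \<nu> b = n \<and> t < w b}) (card {b\<in>B. \<nu> b = n \<and> \<not> t < w b}))"
      by simp
  qed
qed

context mgraph
begin

section \<open>Meshes on the graph and the discrete perimeter\<close>

definition cells :: "nat \<Rightarrow> ('e \<times> nat) set" where
  "cells N = arcs G \<times> {..<N}"

text \<open>
  A half \<open>(c, k)\<close> is the head end (\<open>k = True\<close>) or the tail end of the cell \<open>c\<close>. A node is a vertex of the graph,
  \<open>Inl v\<close>, or an interior mesh point \<open>Inr (e, j)\<close>, \<open>0 < j < N\<close>. With outward signs as in the definition of
  \<open>vertex_value\<close>, continuity at mesh points and the Kirchhoff law at vertices become the same condition.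
\<close>

definition halves :: "nat \<Rightarrow> (('e \<times> nat) \<times> bool) set" where
  "halves N = cells N \<times> UNIV"

fun node :: "nat \<Rightarrow> ('e \<times> nat) \<times> bool \<Rightarrow> 'v + 'e \<times> nat" where
  "node N ((e, i), True) = (if Suc i = N then Inl (head G e) else Inr (e, Suc i))"
| "node N ((e, i), False) = (if i = 0 then Inl (tail G e) else Inr (e, i))"

definition nodes :: "nat \<Rightarrow> ('v + 'e \<times> nat) set" where
  "nodes N = node N ` halves N"

text \<open>The largest flux out of \<open>S\<close> that values in [-1,1] with sum 0 at the node
  allow: at most one unit per half in \<open>S\<close> and, by balance, at most one per half
  outside.\<close>

definition node_per :: "nat \<Rightarrow> ('e \<times> nat) set \<Rightarrow> 'v + 'e \<times> nat \<Rightarrow> nat" where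
  "node_per N S n = min (card {b\<in>halves N. node N b = n \<and> fst b \<in> S}) (card {b\<in>halves N. node N b = n \<and> fst b \<notin> S})"

definition per :: "nat \<Rightarrow> ('e \<times> nat) set \<Rightarrow> nat" where
  "per N S = (\<Sum>n\<in>nodes N. node_per N S n)"

definition graph_mean :: "nat \<Rightarrow> ('e \<times> real \<Rightarrow> real) \<Rightarrow> 'e \<times> nat \<Rightarrow> real" where
  "graph_mean N u c = cell_mean (len G (fst c)) N (\<lambda>x. u (fst c, x)) (snd c)"

fun half_value :: "('e \<Rightarrow> real \<Rightarrow> real) \<Rightarrow> nat \<Rightarrow> ('e \<times> nat) \<times> bool \<Rightarrow> real" where
  "half_value y N ((e, i), True) = y e (len G e * real (Suc i) / real N)"
| "half_value y N ((e, i), False) = - y e (len G e * real i / real N)"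

definition mesh :: "nat \<Rightarrow> ('e \<times> nat) set \<Rightarrow> ('e \<times> real) set" where
  "mesh N S = {p \<in> points G. (fst p, cell_index (len G (fst p)) N (snd p)) \<in> S}"

definition cell_length :: "nat \<Rightarrow> ('e \<times> nat) set \<Rightarrow> real" where
  "cell_length N S = (\<Sum>c\<in>S. len G (fst c) / real N)"

lemma half_cases:
  obtains e i where "b = ((e, i), True)" | e i where "b = ((e, i), False)"
  by (metis (full_types) surj_pair)

abbreviation level_cells :: "nat \<Rightarrow> ('e \<times> real \<Rightarrow> real) \<Rightarrow> real \<Rightarrow> ('e \<times> nat) set" where
  "level_cells N u t \<equiv> {c\<in>cells N. t < graph_mean N u c}"

lemma finite_cells [simp]: "finite (cells N)" by (simp add: cells_def)

lemma finite_halves [simp]: "finite (halves N)" by (simp add: halves_def)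

lemma finite_nodes [simp]: "finite (nodes N)" by (simp add: nodes_def)

text \<open>Without loops an edge meets a vertex with one end only, so the halves at
  \<open>Inl v\<close> correspond to the incident edges.\<close>

lemma sum_halves_vertex:
  assumes N: "0 < N"
  shows "sum F {b\<in>halves N. node N b = Inl v}
    = (\<Sum>e\<in>incident_edges G v. if v = head G e then F ((e, N - 1), True) else F ((e, 0), False))"
proof (rule sum.reindex_bij_witness[where
    j = "\<lambda>b. fst (fst b)" and i = "\<lambda>e. if v = head G e then ((e, N - 1), True) else ((e, 0), False)"])
  fix b assume "b \<in> {b\<in>halves N. node N b = Inl v}"
  then show "(if v = head G (fst (fst b)) then ((fst (fst b), N - 1), True) else ((fst (fst b), 0), False)) = b"
    "fst (fst b) \<in> incident_edges G v"
    "(if v = head G (fst (fst b)) then F ((fst (fst b), N - 1), True) else F ((fst (fst b), 0), False)) = F b"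
    using no_loop
    by (cases b rule: half_cases; force simp: halves_def cells_def incident_edges_def split: if_splits)+
next
  fix e assume "e \<in> incident_edges G v"
  then show "fst (fst (if v = head G e then ((e, N - 1), True) else ((e, 0), False))) = e"
    "(if v = head G e then ((e, N - 1), True) else ((e, 0), False)) \<in> {b\<in>halves N. node N b = Inl v}"
    using N by (auto simp: halves_def cells_def incident_edges_def)
qed

lemma halves_interior:
  assumes "e \<in> arcs G" "0 < j" "j < N"
  shows "{b\<in>halves N. node N b = Inr (e, j)} = {((e, j - 1), True), ((e, j), False)}"
proof (intro set_eqI iffI)
  fix b assume "b \<in> {b\<in>halves N. node N b = Inr (e, j)}"
  then show "b \<in> {((e, j - 1), True), ((e, j), False)}"
    by (cases b rule: half_cases) (auto split: if_splits)
qed (use assms in \<open>auto simp: halves_def cells_def\<close>)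

lemma nodes_cases:
  assumes "n \<in> nodes N"
  obtains v where "n = Inl v" "v \<in> verts G"
  | e j where "n = Inr (e, j)" "e \<in> arcs G" "0 < j" "j < N"
proof -
  obtain b where b: "b \<in> halves N" "n = node N b" using assms by (auto simp: nodes_def)
  then show ?thesis using that ends_in_verts
    by (cases b rule: half_cases) (auto simp: halves_def cells_def split: if_splits)
qed

lemma sum_halves:
  "S \<subseteq> cells N \<Longrightarrow> sum F {b\<in>halves N. fst b \<in> S} = (\<Sum>c\<in>S. F (c, True) + F (c, False))"
proof -
  assume S: "S \<subseteq> cells N"
  then have "{b\<in>halves N. fst b \<in> S} = S \<times> UNIV" by (auto simp: halves_def)
  then have "sum F {b\<in>halves N. fst b \<in> S} = (\<Sum>c\<in>S. \<Sum>k\<in>UNIV. F (c, k))"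
    using S finite_subset[OF S] by (simp add: sum.cartesian_product)
  also have "\<dots> = (\<Sum>c\<in>S. F (c, True) + F (c, False))"
    by (simp add: UNIV_bool add.commute)
  finally show ?thesis .
qed

lemma flow_from_balanced:
  assumes N: "0 < N" and u: "gL1 G u"
    and s: "\<And>b. b \<in> halves N \<Longrightarrow> \<bar>s b\<bar> \<le> 1" and bal: "\<And>n. sum s {b\<in>halves N. node N b = n} = 0"
  obtains g y where "flow G g y" "pairing G u g = (\<Sum>c\<in>cells N. graph_mean N u c * (s (c, True) + s (c, False)))"
proof -
  \<comment> \<open>The value at the mesh point \<open>i\<close> is read from the half to its right,
    at the last mesh point from the half to its left. Balance at interior nodes makes both readings
    agree, which is \<open>sT\<close>.\<close>
  define Y where "Y e i = (if i = N then s ((e, N - 1), True) else - s ((e, i), False))" for e i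
  have sF: "s ((e, i), False) = - Y e i" if "i < N" for e i using that by (simp add: Y_def)
  have sT: "s ((e, i), True) = Y e (Suc i)" if "i < N" "e \<in> arcs G" for e i
  proof (cases "Suc i = N")
    case True
    then show ?thesis by (auto simp: Y_def)
  next
    case False
    then have "Suc i < N" using that by simp
    then show ?thesis using bal[of "Inr (e, Suc i)"] halves_interior[of e "Suc i" N] that
      by (simp add: Y_def)
  qed
  have Y1: "\<bar>Y e i\<bar> \<le> 1" if "i \<le> N" "e \<in> arcs G" for e i
    using that s N by (auto simp: Y_def halves_def cells_def)
  define g where "g e = (\<lambda>x. (Y e (Suc (cell_index (len G e) N x)) - Y e (cell_index (len G e) N x)) * real N / len G e)" for e
  define y where "y e x = Y e 0 + prim (len G e) (g e) x" for e x
  have pl: "Lp 2 (len G e) (g e)" "prim (len G e) (g e) (len G e) = Y e N - Y e 0"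
    "x \<in> {0..len G e} \<Longrightarrow> \<bar>y e x\<bar> \<le> 1"
    "integrable (EV e) f \<Longrightarrow> (LINT x|EV e. f x * g e x) = (\<Sum>i<N. (Y e (Suc i) - Y e i) * cell_mean (len G e) N f i)"
    if "e \<in> arcs G" for e x f
    using piecewise_linear[OF N len_pos[OF that], of "Y e"] Y1[OF _ that] unfolding g_def y_def by blast+
  have y0: "y e 0 = Y e 0" for e by (simp add: y_def prim_nonpos)
  have yl: "y e (len G e) = Y e N" if "e \<in> arcs G" for e using pl(2)[OF that] by (simp add: y_def)
  have "kirchhoff G y"
    unfolding kirchhoff_def
  proof
    fix v assume "v \<in> verts G"
    have "(\<Sum>e\<in>incident_edges G v. if v = head G e then y e (len G e) else - y e 0)
        = (\<Sum>e\<in>incident_edges G v. if v = head G e then s ((e, N - 1), True) else s ((e, 0), False))"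
      using N by (intro sum.cong refl) (auto simp: y0 yl incident_edges_def Y_def)
    also have "\<dots> = 0" using bal[of "Inl v"] sum_halves_vertex[OF N, of s v] by simp
    finally show "(\<Sum>e\<in>incident_edges G v. if v = head G e then y e (len G e) else - y e 0) = 0" .
  qed
  then have F: "flow G g y"
    unfolding flow_def using pl(1,3) y0 by (auto simp: y_def)
  have "pairing G u g = (\<Sum>e\<in>arcs G. \<Sum>i<N. (Y e (Suc i) - Y e i) * graph_mean N u (e, i))"
    unfolding pairing_def using u by (intro sum.cong refl) (simp add: pl(4) gL1_def graph_mean_def)
  also have "\<dots> = (\<Sum>c\<in>cells N. graph_mean N u c * (s (c, True) + s (c, False)))"
    unfolding cells_def sum.cartesian_product
    by (intro sum.cong refl) (auto simp: sT sF)
  finally show ?thesis using that F by blast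
qed

text \<open>\<open>\<zeta> c\<close> is the net outflow of the cell \<open>c\<close>. One flow
  attains the discrete perimeter of every level set at once; with the layer cake formula this is the
  coarea formula for the cell means.\<close>

lemma calibrated_flow:
  assumes N: "0 < N" and u: "gL1 G u"
  obtains \<zeta> where "ereal (\<Sum>c\<in>cells N. graph_mean N u c * \<zeta> c) \<le> TV G u"
    "\<And>t. sum \<zeta> (level_cells N u t) = real (per N (level_cells N u t))"
proof -
  obtain s where s: "\<And>b. b \<in> halves N \<Longrightarrow> \<bar>s b\<bar> \<le> 1" "\<And>n. sum s {b\<in>halves N. node N b = n} = 0"
    "\<And>t. sum s {b\<in>halves N. t < graph_mean N u (fst b)} = real (\<Sum>n\<in>node N ` halves N.
       min (card {b\<in>halves N. node N b = n \<and> t < graph_mean N u (fst b)}) (card {b\<in>halves N. node N b = n \<and> \<not> t < graph_mean N u (fst b)}))"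
  proof (rule calibration[OF finite_halves[of N], where \<nu>="node N" and w = "\<lambda>b. graph_mean N u (fst b)"], goal_cases)
    case (1 s)
    show ?case by (rule 1(1)[OF 1(2,3,4)])
  qed
  obtain g y where F: "flow G g y" "pairing G u g = (\<Sum>c\<in>cells N. graph_mean N u c * (s (c, True) + s (c, False)))"
    using flow_from_balanced[OF N u s(1,2)] by blast
  define \<zeta> where "\<zeta> c = s (c, True) + s (c, False)" for c
  show ?thesis
  proof
    show "ereal (\<Sum>c\<in>cells N. graph_mean N u c * \<zeta> c) \<le> TV G u"
      using TV_ge[OF F(1) u] F(2) unfolding \<zeta>_def by (metis abs_ge_self ereal_less_eq(3) order_trans)
    fix t
    have *: "{b\<in>halves N. t < graph_mean N u (fst b)} = {b\<in>halves N. fst b \<in> (level_cells N u t)}"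
      "{b\<in>halves N. node N b = n \<and> t < graph_mean N u (fst b)} = {b\<in>halves N. node N b = n \<and> fst b \<in> (level_cells N u t)}"
      "{b\<in>halves N. node N b = n \<and> \<not> t < graph_mean N u (fst b)} = {b\<in>halves N. node N b = n \<and> fst b \<notin> (level_cells N u t)}" for n
      by (auto simp: halves_def)
    have "sum \<zeta> (level_cells N u t) = sum s {b\<in>halves N. fst b \<in> (level_cells N u t)}"
      unfolding \<zeta>_def by (rule sum_halves[symmetric]) auto
    also have "\<dots> = real (per N (level_cells N u t))"
      using s(3)[of t] unfolding * per_def node_per_def nodes_def .
    finally show "sum \<zeta> (level_cells N u t) = real (per N (level_cells N u t))" .
  qed
qed

section \<open>Flux of arbitrary flows through unions of cells\<close>

lemma mesh_point_in_edge:
  assumes "i \<le> N" "0 < N" "e \<in> arcs G"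
  shows "len G e * real i / real N \<in> {0..len G e}"
proof -
  have "len G e * real i \<le> len G e * real N" using assms len_pos[OF assms(3)] by (intro mult_left_mono) auto
  then show ?thesis using assms len_pos[OF assms(3)] by (simp add: divide_le_eq)
qed

lemma half_value_bound:
  assumes "flow G g y" "0 < N" "b \<in> halves N"
  shows "\<bar>half_value y N b\<bar> \<le> 1"
  using assms mesh_point_in_edge flowD(3)[OF assms(1)]
  by (cases b rule: half_cases) (auto simp: halves_def cells_def simp del: of_nat_Suc)

lemma half_value_balanced:
  assumes F: "flow G g y" and N: "0 < N" and n: "n \<in> nodes N"
  shows "sum (half_value y N) {b\<in>halves N. node N b = n} = 0"
  using n
proof (cases rule: nodes_cases)
  case (1 v)
  have "(\<Sum>e\<in>incident_edges G v. if v = head G e then half_value y N ((e, N - 1), True) else half_value y N ((e, 0), False))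
    = (\<Sum>e\<in>incident_edges G v. if v = head G e then y e (len G e) else - y e 0)"
    using N by (intro sum.cong refl) auto
  then show ?thesis using F 1 sum_halves_vertex[OF N, of "half_value y N" v]
    by (simp add: flow_def kirchhoff_def)
next
  case (2 e j)
  then show ?thesis using halves_interior[of e j N] by simp
qed

text \<open>The sum is at most the number of halves in \<open>S\<close>; being the negative of the
  sum over the other halves, it is also at most their number.\<close>

lemma sum_node_le:
  assumes "\<And>b. b \<in> halves N \<Longrightarrow> \<bar>s b\<bar> \<le> 1" and bal: "sum s {b\<in>halves N. node N b = n} = 0"
  shows "sum s {b\<in>halves N. node N b = n \<and> fst b \<in> S} \<le> real (node_per N S n)"
proof -
  let ?A = "{b\<in>halves N. node N b = n \<and> fst b \<in> S}" and ?B = "{b\<in>halves N. node N b = n \<and> fst b \<notin> S}"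
  have 1: "sum s ?A \<le> real (card ?A) * 1"
    using assms(1) by (intro sum_bounded_above) force
  have 2: "- real (card ?B) \<le> sum s ?B"
    using sum_bounded_below[of ?B "-1" s] assms(1) by force
  have "{b\<in>halves N. node N b = n} = ?A \<union> ?B" by auto
  moreover have "sum s (?A \<union> ?B) = sum s ?A + sum s ?B" by (rule sum.union_disjoint) auto
  ultimately have "sum s ?A + sum s ?B = 0" using bal by simp
  then show ?thesis using 1 2 unfolding node_per_def by linarith
qed

lemma sum_halves_nodes:
  "sum s {b\<in>halves N. fst b \<in> S} = (\<Sum>n\<in>nodes N. sum s {b\<in>halves N. node N b = n \<and> fst b \<in> S})"
proof -
  have "sum s {b\<in>halves N. fst b \<in> S} = (\<Sum>n\<in>nodes N. sum s {b\<in>{b\<in>halves N. fst b \<in> S}. node N b = n})"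
    unfolding nodes_def by (intro sum.group[symmetric]) auto
  also have "\<dots> = (\<Sum>n\<in>nodes N. sum s {b\<in>halves N. node N b = n \<and> fst b \<in> S})"
    by (intro sum.cong arg_cong[of _ _ "sum s"]) auto
  finally show ?thesis .
qed

lemma flux_le_per:
  assumes "flow G g y" "0 < N"
  shows "sum (half_value y N) {b\<in>halves N. fst b \<in> S} \<le> real (per N S)"
  unfolding sum_halves_nodes per_def of_nat_sum
  by (intro sum_mono sum_node_le half_value_balanced[OF assms] half_value_bound[OF assms])

lemma per_compl: "per N (cells N - S) = per N S"
proof -
  have "{b\<in>halves N. node N b = n \<and> fst b \<in> cells N - S} = {b\<in>halves N. node N b = n \<and> fst b \<notin> S}"
    "{b\<in>halves N. node N b = n \<and> fst b \<notin> cells N - S} = {b\<in>halves N. node N b = n \<and> fst b \<in> S}" for n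
    by (auto simp: halves_def)
  then show ?thesis unfolding per_def node_per_def by (simp add: min.commute)
qed

lemma indicator_mesh:
  assumes "e \<in> arcs G" "x \<in> {0<..<len G e}"
  shows "indicator (mesh N S) (e, x) = (if (e, cell_index (len G e) N x) \<in> S then 1 else (0::real))"
  using assms by (auto simp: mesh_def points_def)

lemma pairing_mesh:
  assumes f: "\<And>e. e \<in> arcs G \<Longrightarrow> integrable (EV e) (f e)" and N: "0 < N" and S: "S \<subseteq> cells N"
  shows "pairing G (indicator (mesh N S)) f = (\<Sum>c\<in>S. cell_int (len G (fst c)) N (f (fst c)) (snd c))"
proof -
  have "pairing G (indicator (mesh N S)) f = (\<Sum>e\<in>arcs G. LINT x|EV e. (\<lambda>i. if (e, i) \<in> S then 1 else 0) (cell_index (len G e) N x) * f e x)"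
    unfolding pairing_def by (intro sum.cong refl Bochner_Integration.integral_cong) (simp_all add: indicator_mesh)
  also have "\<dots> = (\<Sum>e\<in>arcs G. \<Sum>i<N. (if (e, i) \<in> S then 1 else 0) * cell_int (len G e) N (f e) i)"
    by (intro sum.cong refl LINT_step_mult f N)
  also have "\<dots> = (\<Sum>c\<in>cells N. if c \<in> S then cell_int (len G (fst c)) N (f (fst c)) (snd c) else 0)"
    unfolding sum.cartesian_product cells_def by (intro sum.cong) auto
  also have "\<dots> = (\<Sum>c\<in>S. cell_int (len G (fst c)) N (f (fst c)) (snd c))"
    using S by (subst sum.inter_restrict[symmetric]) (auto simp: Int_absorb1)
  finally show ?thesis .
qed

lemma flow_cell_int:
  assumes F: "flow G g y" and N: "0 < N" and c: "c \<in> cells N"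
  shows "cell_int (len G (fst c)) N (g (fst c)) (snd c) = half_value y N (c, True) + half_value y N (c, False)"
proof -
  obtain e i where ei: "c = (e, i)" "e \<in> arcs G" "i < N" using c by (auto simp: cells_def)
  note l = len_pos[OF ei(2)]
  show ?thesis
    using cell_int_eq_prim_diff[OF flow_integral(1)[OF F ei(2)] N l, of i]
      flowD(2)[OF F ei(2) mesh_point_in_edge[of "Suc i" N e]] flowD(2)[OF F ei(2) mesh_point_in_edge[of i N e]] ei N
    by simp
qed

text \<open>The divergence theorem for a union of cells. Nodes interior to it still occur on the
  right and contribute 0 by balance.\<close>

lemma flux_mesh:
  assumes F: "flow G g y" and N: "0 < N" and S: "S \<subseteq> cells N"
  shows "pairing G (indicator (mesh N S)) g = sum (half_value y N) {b\<in>halves N. fst b \<in> S}"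
proof -
  have "pairing G (indicator (mesh N S)) g = (\<Sum>c\<in>S. cell_int (len G (fst c)) N (g (fst c)) (snd c))"
    by (rule pairing_mesh[OF flow_integral(1)[OF F] N S])
  also have "\<dots> = (\<Sum>c\<in>S. half_value y N (c, True) + half_value y N (c, False))"
    using S by (intro sum.cong refl flow_cell_int[OF F N]) auto
  finally show ?thesis unfolding sum_halves[OF S] .
qed

lemma glength_eq_pairing: "glength G D = pairing G (indicator D) (\<lambda>_ _. 1)"
  by (simp add: glength_def gint_def pairing_def)

lemma glength_mesh:
  assumes N: "0 < N" and S: "S \<subseteq> cells N"
  shows "glength G (mesh N S) = cell_length N S"
  unfolding glength_eq_pairing cell_length_def
  by (subst pairing_mesh[OF _ N S])
    (use S in \<open>auto intro!: sum.cong integrable_const_IV simp: cell_int_const N len_pos cells_def\<close>)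

lemma gmeasurable_mesh: "gmeasurable G (mesh N S)"
  unfolding gmeasurable_def
proof (intro conjI ballI)
  fix e assume e: "e \<in> arcs G"
  have "{x. (e, x) \<in> mesh N S} = {0<..<len G e} \<inter> (cell_index (len G e) N -` {i. (e, i) \<in> S})"
    using e by (auto simp: mesh_def points_def)
  moreover have "cell_index (len G e) N -` {i. (e, i) \<in> S} \<in> sets borel"
    using measurable_sets[OF measurable_cell_index, of "{i. (e, i) \<in> S}"] by simp
  ultimately show "{x. (e, x) \<in> mesh N S} \<in> sets lebesgue" by auto
qed (auto simp: mesh_def)

lemma Per_mesh_le:
  assumes N: "0 < N" and S: "S \<subseteq> cells N"
  shows "Per G (mesh N S) \<le> ereal (real (per N S))"
  unfolding Per_def
  by (rule TV_le) (simp add: flux_mesh[OF _ N S] flux_le_per[OF _ N])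


section \<open>An optimal set\<close>

definition total_length :: real where
  "total_length = (\<Sum>e\<in>arcs G. len G e)"

lemma total_length_pos: "0 < total_length"
  unfolding total_length_def using arcs_nonempty len_pos by (intro sum_pos) auto

lemma glength_points: "glength G (points G) = total_length"
proof -
  have "(LINT x|EV e. indicat_real (points G) (e, x)) = len G e" if "e \<in> arcs G" for e
  proof -
    have "(LINT x|EV e. indicat_real (points G) (e, x)) = (LINT x|EV e. 1)"
      by (rule Bochner_Integration.integral_cong) (use that in \<open>auto simp: points_def\<close>)
    then show ?thesis using LINT_one[OF len_pos[OF that]] by simp
  qed
  then show ?thesis by (simp add: glength_def gint_def total_length_def)
qed

text \<open>A node with exactly two halves, one of them in \<open>S\<close>, is an interior mesh
  point or a vertex of degree two. Such a boundary point has perimeter 1 and can be moved along the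
  graph.\<close>

definition interface :: "nat \<Rightarrow> ('e \<times> nat) set \<Rightarrow> ('e \<times> nat) \<times> bool \<Rightarrow> ('e \<times> nat) \<times> bool \<Rightarrow> bool" where
  "interface N S b1 b2 \<longleftrightarrow> b1 \<in> halves N \<and> b2 \<in> halves N \<and> fst b1 \<in> S \<and> fst b2 \<notin> S \<and>
     {b\<in>halves N. node N b = node N b1} = {b1, b2} \<and> node N b2 = node N b1"

lemma interfaceD:
  assumes "interface N S b1 b2"
  shows "b1 \<in> halves N" "b2 \<in> halves N" "fst b1 \<in> S" "fst b2 \<notin> S" "b1 \<noteq> b2" "fst b2 \<in> cells N"
    "{b\<in>halves N. node N b = node N b1} = {b1, b2}" "node N b2 = node N b1" "node N b1 \<in> nodes N"
proof -
  show *: "b1 \<in> halves N" "b2 \<in> halves N" "fst b1 \<in> S" "fst b2 \<notin> S"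
    "{b\<in>halves N. node N b = node N b1} = {b1, b2}" "node N b2 = node N b1"
    using assms unfolding interface_def by blast+
  show "b1 \<noteq> b2" using *(3,4) by auto
  show "fst b2 \<in> cells N" using *(2) by (auto simp: halves_def)
  show "node N b1 \<in> nodes N" using *(1) by (simp add: nodes_def)
qed

lemma interface_node_per:
  assumes "interface N S b1 b2"
  shows "node_per N S (node N b1) = 1"
    "{b\<in>halves N. node N b = node N b1 \<and> fst b \<in> S} = {b1}"
proof -
  have *: "{b\<in>halves N. node N b = node N b1} = {b1, b2}" "fst b1 \<in> S" "fst b2 \<notin> S"
    by (fact interfaceD[OF assms])+
  have "{b\<in>halves N. node N b = node N b1 \<and> fst b \<in> T} = {b\<in>{b1, b2}. fst b \<in> T}"
    "{b\<in>halves N. node N b = node N b1 \<and> fst b \<notin> T} = {b\<in>{b1, b2}. fst b \<notin> T}" for T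
    unfolding *(1)[symmetric] by auto
  moreover have "{b\<in>{b1, b2}. fst b \<in> S} = {b1}" "{b\<in>{b1, b2}. fst b \<notin> S} = {b2}" using * by auto
  ultimately show "node_per N S (node N b1) = 1"
    "{b\<in>halves N. node N b = node N b1 \<and> fst b \<in> S} = {b1}" by (simp_all add: node_per_def)
qed

lemma node_other_neq: "c \<in> cells N \<Longrightarrow> node N (c, k) \<noteq> node N (c, \<not> k)"
  using no_loop[of "fst c"] by (cases c; cases k) (auto simp: cells_def)

text \<open>
  Moving an interface across the cell \<open>fst b2\<close> saves 1 at the node of \<open>b2\<close> and costs at most 1 at the other end.
\<close>

lemma per_insert_le:
  assumes I: "interface N S b1 b2"
  shows "per N (insert (fst b2) S) \<le> per N S"
proof -
  define c k where "c = fst b2" and "k = snd b2"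
  have b2: "b2 = (c, k)" by (simp add: c_def k_def)
  define b3 where "b3 = (c, \<not> k)"
  have c: "c \<in> cells N" "c \<notin> S" using interfaceD(4,6)[OF I] by (simp_all add: b2)
  have n2: "node N b2 = node N b1" by (rule interfaceD[OF I])
  have n3: "node N b3 \<noteq> node N b1" using node_other_neq[OF c(1), of k] n2 by (auto simp: b2 b3_def)
  have in_c: "b = b2 \<or> b = b3" if "fst b = c" for b using that unfolding b2 b3_def by (cases b) auto
  \<comment> \<open>Saving and cost are added on opposite sides because subtraction on
    \<open>nat\<close> truncates.\<close>
  have pw: "node_per N (insert c S) n + (if n = node N b1 then 1 else 0) \<le> node_per N S n + (if n = node N b3 then 1 else 0)" for n
  proof -
    consider "n = node N b1" | "n = node N b3" "n \<noteq> node N b1" | "n \<noteq> node N b1" "n \<noteq> node N b3" by blast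
    then show ?thesis
    proof cases
      case 1
      have "b = b1 \<or> b = b2" if "b \<in> halves N" "node N b = n" for b
        using interfaceD(7)[OF I] that 1 by blast
      then have "{b\<in>halves N. node N b = n \<and> fst b \<notin> insert c S} = {}"
        using interfaceD(3)[OF I] unfolding b2 by fastforce
      then have "node_per N (insert c S) n = 0" unfolding node_per_def by (metis card.empty min_0R)
      then show ?thesis using interface_node_per(1)[OF I] 1 by simp
    next
      case 2
      have "card {b\<in>halves N. node N b = n \<and> fst b \<in> insert c S} \<le> card (insert b3 {b\<in>halves N. node N b = n \<and> fst b \<in> S})"
      proof (intro card_mono subsetI)
        fix b assume b: "b \<in> {b\<in>halves N. node N b = n \<and> fst b \<in> insert c S}"
        show "b \<in> insert b3 {b\<in>halves N. node N b = n \<and> fst b \<in> S}"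
        proof (cases "fst b = c")
          case True
          then have "b = b2 \<or> b = b3" by (rule in_c)
          then show ?thesis using b n2 2 by auto
        qed (use b in auto)
      qed auto
      also have "\<dots> \<le> Suc (card {b\<in>halves N. node N b = n \<and> fst b \<in> S})" by (rule card_insert_le_m1) auto
      finally have "card {b\<in>halves N. node N b = n \<and> fst b \<in> insert c S} \<le> Suc (card {b\<in>halves N. node N b = n \<and> fst b \<in> S})" .
      moreover have "card {b\<in>halves N. node N b = n \<and> fst b \<notin> insert c S} \<le> card {b\<in>halves N. node N b = n \<and> fst b \<notin> S}"
        by (intro card_mono) auto
      ultimately show ?thesis using 2 unfolding node_per_def by simp
    next
      case 3
      then have "{b\<in>halves N. node N b = n \<and> fst b \<in> insert c S} = {b\<in>halves N. node N b = n \<and> fst b \<in> S}"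
        "{b\<in>halves N. node N b = n \<and> fst b \<notin> insert c S} = {b\<in>halves N. node N b = n \<and> fst b \<notin> S}"
        using in_c n2 by auto
      then show ?thesis using 3 unfolding node_per_def by simp
    qed
  qed
  have mem: "node N b1 \<in> nodes N" "node N b3 \<in> nodes N"
    using interfaceD[OF I] c by (auto simp: nodes_def b3_def halves_def)
  have "(\<Sum>n\<in>nodes N. node_per N (insert c S) n + (if n = node N b1 then 1 else 0))
      \<le> (\<Sum>n\<in>nodes N. node_per N S n + (if n = node N b3 then 1 else 0))"
    by (intro sum_mono pw)
  then show ?thesis using mem by (simp add: sum.distrib per_def c_def)
qed

text \<open>Leaving out the half \<open>b1\<close> removes the whole contribution of its node, so
  one unit of perimeter becomes available for a boundary point elsewhere.\<close>

lemma flux_minus_interface_le: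
  assumes F: "flow G g y" and N: "0 < N" and I: "interface N S b1 b2"
  shows "sum (half_value y N) {b\<in>halves N. fst b \<in> S} - half_value y N b1 \<le> real (per N S) - 1"
proof -
  let ?n = "node N b1"
  have mem: "?n \<in> nodes N" by (rule interfaceD[OF I])
  have "sum (half_value y N) {b\<in>halves N. fst b \<in> S} - half_value y N b1
      = (\<Sum>n\<in>nodes N - {?n}. sum (half_value y N) {b\<in>halves N. node N b = n \<and> fst b \<in> S})"
    unfolding sum_halves_nodes sum.remove[OF finite_nodes mem] interface_node_per(2)[OF I] by simp
  also have "\<dots> \<le> (\<Sum>n\<in>nodes N - {?n}. real (node_per N S n))"
    by (intro sum_mono sum_node_le half_value_balanced[OF F N] half_value_bound[OF F N]) auto
  also have "\<dots> = real (per N S) - 1"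
    unfolding per_def sum.remove[OF finite_nodes mem] interface_node_per(1)[OF I] by simp
  finally show ?thesis .
qed

text \<open>\<open>D\<close> grows from the interface into the cell beyond it. The interface
  disappears, and the new boundary point inside the cell takes over its unit of perimeter.\<close>

lemma partial_cell:
  assumes N: "0 < N" and S: "S \<subseteq> cells N" and I: "interface N S b1 b2"
    and \<theta>: "0 \<le> \<theta>" "\<theta> \<le> len G (fst (fst b2)) / real N"
  obtains D where "gmeasurable G D" "glength G D = cell_length N S + \<theta>" "Per G D \<le> ereal (real (per N S))"
proof -
  obtain e i k where b2: "b2 = ((e, i), k)" by (metis surj_pair)
  have e: "e \<in> arcs G" and i: "i < N" and nS: "(e, i) \<notin> S"
    using interfaceD(4,6)[OF I] by (auto simp: b2 cells_def)
  let ?l = "len G e"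
  note l = len_pos[OF e]
  define a b where "a = ?l * real i / real N" and "b = ?l * real (Suc i) / real N"
  have ab: "a \<in> {0..?l}" "b \<in> {0..?l}" unfolding a_def b_def
    using mesh_point_in_edge[of i N e] mesh_point_in_edge[of "Suc i" N e] i N e by auto
  have b_eq: "b = a + ?l / real N" unfolding a_def b_def by (simp add: distrib_left add_divide_distrib)
  \<comment> \<open>\<open>{p..<q}\<close> has length \<theta> and touches the interface:
    \<open>b2\<close> is the head end of its cell if \<open>k\<close> holds, the tail end
    otherwise.\<close>
  define p q where "p = (if k then b - \<theta> else a)" and "q = (if k then b else a + \<theta>)"
  have pq: "a \<le> p" "p \<le> q" "q \<le> b" "q - p = \<theta>" "p \<in> {0..?l}" "q \<in> {0..?l}"
    using \<theta> ab b_eq by (auto simp: p_def q_def b2)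
  define D where "D = mesh N S \<union> {z \<in> points G. fst z = e \<and> p \<le> snd z \<and> snd z < q}"
  have ind: "indicat_real D (e', x) = indicator (mesh N S) (e', x) + (if e' = e then indicator {p..<q} x else 0)"
    if "e' \<in> arcs G" "x \<in> {0<..<len G e'}" for e' x
  proof -
    have "(e', x) \<notin> mesh N S" if "e' = e" "p \<le> x" "x < q"
      using cell_index_eq_iff[OF l N, of x i] that \<open>x \<in> {0<..<len G e'}\<close> pq nS
      by (auto simp: mesh_def a_def b_def)
    then show ?thesis using that by (auto simp: D_def points_def indicator_def)
  qed
  have pair: "pairing G (indicator D) f = pairing G (indicator (mesh N S)) f + (prim ?l (f e) q - prim ?l (f e) p)"
    if f: "\<And>e. e \<in> arcs G \<Longrightarrow> integrable (EV e) (f e)" for f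
  proof -
    have "(LINT x|EV e'. indicator D (e', x) * f e' x) = (LINT x|EV e'. indicator (mesh N S) (e', x) * f e' x)
        + (if e' = e then prim ?l (f e) q - prim ?l (f e) p else 0)" if e': "e' \<in> arcs G" for e'
    proof -
      have "(LINT x|EV e'. indicator D (e', x) * f e' x)
        = (LINT x|EV e'. indicator (mesh N S) (e', x) * f e' x + (if e' = e then indicator {p..<q} x * f e x else 0))"
        by (rule Bochner_Integration.integral_cong) (auto simp: ind e' algebra_simps)
      also have "\<dots> = (LINT x|EV e'. indicator (mesh N S) (e', x) * f e' x)
          + (LINT x|EV e'. (if e' = e then indicator {p..<q} x * f e x else 0))"
      proof (rule Bochner_Integration.integral_add)
        have "integrable (EV e') (\<lambda>x. (\<lambda>i. if (e', i) \<in> S then 1 else 0) (cell_index (len G e') N x) * f e' x)"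
          by (rule integrable_step_mult[OF f[OF e'] N])
        then show "integrable (EV e') (\<lambda>x. indicator (mesh N S) (e', x) * f e' x)"
          by (rule Bochner_Integration.integrable_cong[THEN iffD1, rotated 2]) (use e' in \<open>auto simp: indicator_mesh\<close>)
        show "integrable (EV e') (\<lambda>x. if e' = e then indicator {p..<q} x * f e x else 0)"
          using integrable_indicator_IV[OF f[OF e], of "{p..<q}"] by (cases "e' = e") auto
      qed
      also have "(LINT x|EV e'. (if e' = e then indicator {p..<q} x * f e x else 0)) = (if e' = e then prim ?l (f e) q - prim ?l (f e) p else 0)"
        using prim_diff[OF f[OF e] pq(2)] by simp
      finally show ?thesis .
    qed
    then have "pairing G (indicator D) f = (\<Sum>e'\<in>arcs G. (LINT x|EV e'. indicator (mesh N S) (e', x) * f e' x)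
        + (if e' = e then prim ?l (f e) q - prim ?l (f e) p else 0))"
      unfolding pairing_def by (intro sum.cong) auto
    then show ?thesis using e by (simp add: sum.distrib pairing_def)
  qed
  show ?thesis
  proof
    show "gmeasurable G D"
      unfolding gmeasurable_def
    proof (intro conjI ballI)
      show "D \<subseteq> points G" by (auto simp: D_def mesh_def)
      fix e' assume e': "e' \<in> arcs G"
      have "{x. (e', x) \<in> D} = {x. (e', x) \<in> mesh N S} \<union> (if e' = e then {0<..<?l} \<inter> {p..<q} else {})"
        using e' by (auto simp: D_def points_def)
      then show "{x. (e', x) \<in> D} \<in> sets lebesgue"
        using gmeasurable_mesh[of N S] e' by (auto simp: gmeasurable_def)
    qed
    have int1: "integrable (IV l) (\<lambda>_. 1::real)" for l by (rule integrable_const_IV)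
    show "glength G D = cell_length N S + \<theta>"
      using pair[of "\<lambda>_ _. 1", OF int1] glength_mesh[OF N S] pq
      by (simp add: glength_eq_pairing prim_const)
    show "Per G D \<le> ereal (real (per N S))"
      unfolding Per_def
    proof (rule TV_le)
      fix g y assume F: "flow G g y"
      have "pairing G (indicator D) g = sum (half_value y N) {b\<in>halves N. fst b \<in> S} + (y e q - y e p)"
        using pair[of g, OF flow_integral(1)[OF F]] flux_mesh[OF F N S]
          flowD(2)[OF F e pq(5)] flowD(2)[OF F e pq(6)] by simp
      \<comment> \<open>One of the two terms is the half value at the interface, the other is
        bounded by 1.\<close>
      also have "y e q - y e p \<le> half_value y N b2 + 1"
      proof (cases k)
        case True
        then show ?thesis using flowD(3)[OF F e pq(5)] unfolding b2 by (simp add: q_def b_def del: of_nat_Suc)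
      next
        case False
        then show ?thesis using flowD(3)[OF F e pq(6)] unfolding b2 by (simp add: p_def a_def)
      qed
      \<comment> \<open>Balance at a node with two halves: what leaves one cell enters the
        other.\<close>
      also have "half_value y N b2 = - half_value y N b1"
      proof -
        have "node N b1 \<in> nodes N" "{b\<in>halves N. node N b = node N b1} = {b1, b2}" "b1 \<noteq> b2"
          by (fact interfaceD[OF I])+
        then show ?thesis using half_value_balanced[OF F N, of "node N b1"] by simp
      qed
      finally show "ereal (pairing G (indicator D) g) \<le> ereal (real (per N S))"
        using flux_minus_interface_le[OF F N I] by simp
    qed
  qed
qed

section \<open>Reduction to finitely many lengths\<close>

definition admissible_lengths :: "real set" where
  "admissible_lengths = insert (total_length / 2) (sum (len G) ` Pow (arcs G))"

lemma finite_admissible_lengths: "finite admissible_lengths"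
  by (simp add: admissible_lengths_def)

text \<open>If no interior mesh point separates a cell in \<open>S\<close> from one outside,
  membership is constant along every edge.\<close>

lemma exists_interface_or_edges:
  assumes N: "0 < N" and S: "S \<subseteq> cells N"
  shows "(\<exists>b1 b2. interface N S b1 b2) \<or> cell_length N S \<in> sum (len G) ` Pow (arcs G)"
proof (cases "\<exists>e\<in>arcs G. \<exists>j. 0 < j \<and> j < N \<and> ((e, j - 1) \<in> S \<longleftrightarrow> (e, j) \<notin> S)")
  case True
  then obtain e j where ej: "e \<in> arcs G" "0 < j" "j < N" "(e, j - 1) \<in> S \<longleftrightarrow> (e, j) \<notin> S" by auto
  let ?a = "((e, j - 1), True)" and ?b = "((e, j), False)"
  have n: "node N ?a = Inr (e, j)" "node N ?b = Inr (e, j)" using ej by auto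
  have m: "?a \<in> halves N" "?b \<in> halves N" using ej by (auto simp: halves_def cells_def)
  note H = halves_interior[OF ej(1-3)]
  have "interface N S ?a ?b \<or> interface N S ?b ?a"
    using ej(4) n m H unfolding interface_def by (cases "(e, j) \<in> S") (auto simp: insert_commute)
  then show ?thesis by blast
next
  case False
  define T where "T = {e\<in>arcs G. (e, 0) \<in> S}"
  have "(e, i) \<in> S \<longleftrightarrow> (e, 0) \<in> S" if "e \<in> arcs G" "i < N" for e i
    using that(2)
  proof (induction i)
    case (Suc i)
    have "(e, Suc i - 1) \<in> S \<longleftrightarrow> (e, Suc i) \<in> S" using False that(1) Suc(2) by blast
    then show ?case using Suc by simp
  qed simp
  then have "S = T \<times> {..<N}" using S by (auto simp: T_def cells_def)
  then have "cell_length N S = (\<Sum>e\<in>T. \<Sum>i<N. len G e / real N)"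
    by (simp only: cell_length_def sum.cartesian_product case_prod_unfold)
  also have "\<dots> = sum (len G) T" using N by simp
  finally show ?thesis by (auto simp: T_def)
qed

text \<open>
  Interfaces are pushed outwards, cell by cell, until none is left (and the set is a union of edges) or half of
  the total length would be exceeded; then a part of the last cell gives exactly one half. Since \<open>per\<close> is an integer
  and there are finitely many admissible lengths, a minimal quotient is attained.
\<close>

lemma enlarge_to_admissible_length:
  assumes N: "0 < N" and S: "S \<subseteq> cells N" and le: "cell_length N S \<le> total_length / 2"
  shows "\<exists>D. gmeasurable G D \<and> Per G D \<le> ereal (real (per N S)) \<and> cell_length N S \<le> glength G D \<and>
    glength G D \<le> total_length / 2 \<and> glength G D \<in> admissible_lengths"
  using S le
proof (induction "card (cells N - S)" arbitrary: S rule: less_induct)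
  case less
  show ?case
  proof (cases "\<exists>b1 b2. interface N S b1 b2")
    case False
    then have "cell_length N S \<in> admissible_lengths"
      using exists_interface_or_edges[OF N less.prems(1)] by (simp add: admissible_lengths_def)
    then show ?thesis
      using gmeasurable_mesh[of N S] Per_mesh_le[OF N less.prems(1)] glength_mesh[OF N less.prems(1)] less.prems
      by (intro exI[of _ "mesh N S"]) auto
  next
    case True
    then obtain b1 b2 where I: "interface N S b1 b2" by blast
    define c where "c = fst b2"
    have c: "c \<in> cells N" "c \<notin> S" using interfaceD(4,6)[OF I] by (simp_all add: c_def)
    have fin: "finite S" by (rule finite_subset[OF less.prems(1) finite_cells])
    have len_c: "cell_length N (insert c S) = cell_length N S + len G (fst c) / real N"
      using c fin by (simp add: cell_length_def)
    have len_c0: "0 \<le> len G (fst c) / real N" using c len_pos[of "fst c"] by (auto simp: cells_def)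
    show ?thesis
    proof (cases "cell_length N (insert c S) \<le> total_length / 2")
      case True
      have "card (cells N - insert c S) < card (cells N - S)" using c by (intro psubset_card_mono) auto
      then obtain D where "gmeasurable G D" "Per G D \<le> ereal (real (per N (insert c S)))"
        "cell_length N (insert c S) \<le> glength G D" "glength G D \<le> total_length / 2" "glength G D \<in> admissible_lengths"
        using less.hyps[of "insert c S"] True c less.prems by blast
      moreover have "ereal (real (per N (insert c S))) \<le> ereal (real (per N S))"
        using per_insert_le[OF I] by (simp add: c_def)
      ultimately show ?thesis using len_c len_c0 by (intro exI[of _ D]) (auto intro: order_trans)
    next
      case False
      obtain D where "gmeasurable G D" "glength G D = cell_length N S + (total_length / 2 - cell_length N S)"
        "Per G D \<le> ereal (real (per N S))"
        using partial_cell[OF N less.prems(1) I, of "total_length / 2 - cell_length N S"] less.prems(2) False len_c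
        by (auto simp: c_def)
      then show ?thesis using less.prems(2) by (intro exI[of _ D]) (auto simp: admissible_lengths_def)
    qed
  qed
qed

text \<open>All \<open>N\<close> are included, so that the constant survives refinement of the
  mesh.\<close>

definition isoperimetric :: "real \<Rightarrow> bool" where
  "isoperimetric h \<longleftrightarrow> 0 \<le> h \<and> (\<forall>N S. 0 < N \<longrightarrow> S \<subseteq> cells N \<longrightarrow> S \<noteq> {} \<longrightarrow>
     cell_length N S \<le> total_length / 2 \<longrightarrow> h * cell_length N S \<le> real (per N S))"

lemma exists_optimal_set:
  obtains h D where "isoperimetric h" "gmeasurable G D" "0 < glength G D" "glength G D \<le> total_length / 2"
    "Per G D \<le> ereal (h * glength G D)"
proof -
  define Q where "Q m k \<longleftrightarrow> (\<exists>D. gmeasurable G D \<and> glength G D = m \<and> Per G D \<le> ereal (real k))" for m and k :: nat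
  define \<Lambda> where "\<Lambda> = {m \<in> admissible_lengths. 0 < m \<and> m \<le> total_length / 2 \<and> (\<exists>k. Q m k)}"
  \<comment> \<open>Bounds on the perimeter are taken in \<open>nat\<close>, so that each length in
    \<open>\<Lambda>\<close> has a least one and some set attains it.\<close>
  define r where "r m = real (LEAST k. Q m k) / m" for m
  have fin: "finite \<Lambda>" using finite_admissible_lengths by (simp add: \<Lambda>_def)
  have key: "\<exists>m\<in>\<Lambda>. r m * cell_length N S \<le> real (per N S)"
    if N: "0 < N" and S: "S \<subseteq> cells N" "S \<noteq> {}" and le: "cell_length N S \<le> total_length / 2" for N S
  proof -
    obtain D where D: "gmeasurable G D" "Per G D \<le> ereal (real (per N S))" "cell_length N S \<le> glength G D"
      "glength G D \<le> total_length / 2" "glength G D \<in> admissible_lengths"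
      using enlarge_to_admissible_length[OF N S(1) le] by blast
    have pos: "0 < cell_length N S"
      unfolding cell_length_def using S N len_pos finite_subset[OF S(1)] by (intro sum_pos) (auto simp: cells_def)
    have Q: "Q (glength G D) (per N S)" using D by (auto simp: Q_def)
    then have "glength G D \<in> \<Lambda>" using D pos by (auto simp: \<Lambda>_def)
    \<comment> \<open>Enlarging raises the length but not the perimeter, so it can only lower the
      quotient.\<close>
    moreover have "r (glength G D) * cell_length N S \<le> real (per N S)"
    proof -
      have "(LEAST k. Q (glength G D) k) \<le> per N S" using Q by (rule Least_le)
      then have "r (glength G D) * glength G D \<le> real (per N S)" using D pos by (simp add: r_def)
      moreover have "r (glength G D) * cell_length N S \<le> r (glength G D) * glength G D"
        using D pos by (intro mult_left_mono) (auto simp: r_def)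
      ultimately show ?thesis by linarith
    qed
    ultimately show ?thesis by blast
  qed
  have "\<Lambda> \<noteq> {}"
  proof -
    obtain e where e: "e \<in> arcs G" using arcs_nonempty by auto
    have "len G e \<le> total_length" unfolding total_length_def
      using e len_pos by (intro member_le_sum) (auto simp: less_imp_le)
    \<comment> \<open>Half of any edge is a competitor: one of its two cells for
      \<open>N = 2\<close>.\<close>
    then have "cell_length 2 {(e, 0)} \<le> total_length / 2" by (simp add: cell_length_def)
    then show ?thesis using key[of 2 "{(e, 0)}"] e by (auto simp: cells_def)
  qed
  then obtain m where m: "m \<in> \<Lambda>" "\<And>\<mu>. \<mu> \<in> \<Lambda> \<Longrightarrow> r m \<le> r \<mu>"
    using arg_min_if_finite(1)[OF fin, of r] arg_min_least[OF fin, of _ r] by blast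
  then obtain D where D: "gmeasurable G D" "glength G D = m" "Per G D \<le> ereal (real (LEAST k. Q m k))"
    using LeastI_ex[of "Q m"] unfolding \<Lambda>_def Q_def by blast
  have pos: "0 < m" "m \<le> total_length / 2" using m by (auto simp: \<Lambda>_def)
  show ?thesis
  proof
    show "gmeasurable G D" "0 < glength G D" "glength G D \<le> total_length / 2" using D pos by auto
    show "Per G D \<le> ereal (r m * glength G D)" using D pos by (simp add: r_def)
    show "isoperimetric (r m)"
      unfolding isoperimetric_def
    proof (intro conjI allI impI)
      show "0 \<le> r m" using pos by (simp add: r_def)
      fix N S assume S: "0 < N" "S \<subseteq> cells N" "S \<noteq> {}" "cell_length N S \<le> total_length / 2"
      obtain \<mu> where "\<mu> \<in> \<Lambda>" "r \<mu> * cell_length N S \<le> real (per N S)" using key[OF S] by blast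
      moreover have "0 \<le> cell_length N S" unfolding cell_length_def
        using S len_pos by (intro sum_nonneg) (auto simp: cells_def less_imp_le)
      ultimately show "r m * cell_length N S \<le> real (per N S)"
        using mult_right_mono[OF m(2), of \<mu> "cell_length N S"] by linarith
    qed
  qed
qed

section \<open>Sets of perimeter zero\<close>

lemma gL1_indicator:
  assumes "gmeasurable G D"
  shows "gL1 G (indicator D)"
  unfolding gL1_def
proof
  fix e assume e: "e \<in> arcs G"
  have "{x. (e, x) \<in> D} \<in> sets lebesgue" using assms e by (simp add: gmeasurable_def)
  then have "(\<lambda>x. indicat_real {x. (e, x) \<in> D} x) \<in> borel_measurable (EV e)"
    by (intro measurable_restrict_space1 borel_measurable_indicator)
  then have "(\<lambda>x. indicat_real D (e, x)) \<in> borel_measurable (EV e)"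
    by (simp add: indicator_def)
  then show "integrable (EV e) (\<lambda>x. indicat_real D (e, x))"
    by (rule integrable_IV_bounded[where B=1]) (simp add: indicator_def)
qed

text \<open>Induction along a path in the symmetrized digraph, with the invariant that all edges at
  the current vertex carry the value \<open>f e0\<close>.\<close>

lemma connected_constant:
  assumes "\<And>v e e'. v \<in> verts G \<Longrightarrow> e \<in> incident_edges G v \<Longrightarrow> e' \<in> incident_edges G v \<Longrightarrow> f e = f e'"
    and e0: "e0 \<in> arcs G" and e: "e \<in> arcs G"
  shows "f e = f e0"
proof -
  have sc: "strongly_connected (with_proj (mk_symmetric (pre_digraph.truncate G)))"
    using cmg by (simp add: connected_compact_metric_graph_def Digraph_Component.connected_def)
  have "reachable (with_proj (mk_symmetric (pre_digraph.truncate G))) (head G e0) (head G e)"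
    using sc ends_in_verts e0 e by (auto simp: strongly_connected_def)
  then have "(head G e0, head G e) \<in> (parcs (mk_symmetric (pre_digraph.truncate G)))\<^sup>*"
    using reachable_rtranclI by fastforce
  then have "head G e \<in> verts G \<and> (\<forall>e'\<in>incident_edges G (head G e). f e' = f e0)"
  proof (induction rule: rtrancl_induct)
    case base
    have "e0 \<in> incident_edges G (head G e0)" "head G e0 \<in> verts G"
      using e0 ends_in_verts by (auto simp: incident_edges_def)
    then show ?case using assms(1) by blast
  next
    case (step v w)
    obtain a where a: "a \<in> arcs G" "(v = tail G a \<and> w = head G a) \<or> (v = head G a \<and> w = tail G a)"
      using step.hyps(2) by (auto simp: parcs_mk_symmetric)
    then have inc: "a \<in> incident_edges G v" "a \<in> incident_edges G w" "w \<in> verts G"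
      using ends_in_verts by (auto simp: incident_edges_def)
    have "f e' = f e0" if "e' \<in> incident_edges G w" for e'
    proof -
      have "f e' = f a" by (rule assms(1)[OF inc(3) that inc(2)])
      also have "f a = f e0" using step.IH inc(1) by blast
      finally show ?thesis .
    qed
    then show ?case using inc(3) by blast
  qed
  then show ?thesis using e by (auto simp: incident_edges_def)
qed

text \<open>Zero perimeter makes the indicator constant on each edge by
  \<open>cell_mean_error\<close>, hence 0 or 1 there, and equal on edges that share a vertex.
  Connectedness then leaves only length 0 or the full length.\<close>

lemma TV_indicator_pos:
  assumes D: "gmeasurable G D" and len: "0 < glength G D" "glength G D < total_length"
  shows "\<not> Per G D \<le> 0"
proof
  assume "Per G D \<le> 0"
  then have P0: "TV G (indicator D) \<le> ereal 0" by (simp add: Per_def zero_ereal_def)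
  note int = gL1_indicator[OF D]
  define w where "w e = graph_mean 1 (indicator D) (e, 0)" for e
  have idx: "cell_index (len G e) 1 x = 0" if "e \<in> arcs G" "x \<in> {0<..<len G e}" for e x
    using cell_index_less[of 1 x "len G e"] that by simp
  have ae: "AE x in EV e. indicat_real D (e, x) = w e" if e: "e \<in> arcs G" for e
  proof -
    let ?d = "\<lambda>x. \<bar>indicat_real D (e, x) - cell_mean (len G e) 1 (\<lambda>x. indicat_real D (e, x)) (cell_index (len G e) 1 x)\<bar>"
    have "integrable (EV e) (\<lambda>x. cell_mean (len G e) 1 (\<lambda>x. indicat_real D (e, x)) (cell_index (len G e) 1 x) * 1)"
      by (rule integrable_step_mult) (auto intro: integrable_const_IV)
    then have "integrable (EV e) ?d"
      using int e by (auto simp: gL1_def)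
    moreover have "(LINT x|EV e. ?d x) = 0"
      using cell_mean_error[OF int P0 e, of 1] by (intro antisym) auto
    ultimately have "AE x in EV e. ?d x = 0"
      by (subst (asm) integral_nonneg_eq_0_iff_AE) auto
    then have "AE x in EV e. x \<in> space (EV e) \<longrightarrow> indicat_real D (e, x) = w e"
      by eventually_elim (use idx[OF e] in \<open>auto simp: w_def graph_mean_def\<close>)
    then show ?thesis by (rule AE_mp) auto
  qed
  have w01: "w e = 0 \<or> w e = 1" if e: "e \<in> arcs G" for e
  proof (rule ccontr)
    assume neg: "\<not> (w e = 0 \<or> w e = 1)"
    have "AE x in EV e. (1::real) = 0"
      using ae[OF e]
    proof eventually_elim
      case (elim x)
      then show ?case using neg by (cases "(e, x) \<in> D") auto
    qed
    then have "(LINT x|EV e. (1::real)) = (LINT x|EV e. 0)" by (intro integral_cong_AE) auto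
    then show False using LINT_one[OF len_pos[OF e]] len_pos[OF e] by simp
  qed
  have length: "glength G D = (\<Sum>e\<in>arcs G. w e * len G e)"
    unfolding glength_def gint_def
  proof (intro sum.cong refl)
    fix e assume e: "e \<in> arcs G"
    have "(LINT x|EV e. indicat_real D (e, x)) = (LINT x|EV e. w e * 1)"
      using ae[OF e] int e by (intro integral_cong_AE) (auto simp: gL1_def)
    also have "\<dots> = w e * (LINT x|EV e. 1)" by (rule Bochner_Integration.integral_mult_right_zero)
    finally show "(LINT x|EV e. indicat_real D (e, x)) = w e * len G e"
      using LINT_one[OF len_pos[OF e]] by simp
  qed
  define S where "S = {c\<in>cells 1. 0 < graph_mean 1 (indicator D) c}"
  have S: "c \<in> S \<longleftrightarrow> w (fst c) = 1" if "c \<in> cells 1" for c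
    using that w01[of "fst c"] by (auto simp: S_def w_def cells_def)
  obtain \<zeta> where \<zeta>: "ereal (\<Sum>c\<in>cells 1. graph_mean 1 (indicator D) c * \<zeta> c) \<le> TV G (indicator D)"
    "\<And>t. sum \<zeta> {c\<in>cells 1. t < graph_mean 1 (indicator D) c} = real (per 1 {c\<in>cells 1. t < graph_mean 1 (indicator D) c})"
    using calibrated_flow[OF _ int, of 1] by auto
  have "(\<Sum>c\<in>cells 1. graph_mean 1 (indicator D) c * \<zeta> c) = sum \<zeta> S"
  proof -
    have "graph_mean 1 (indicator D) c = (if c \<in> S then 1 else 0)" if "c \<in> cells 1" for c
      using S[OF that] w01[of "fst c"] that by (auto simp: w_def cells_def)
    then have "(\<Sum>c\<in>cells 1. graph_mean 1 (indicator D) c * \<zeta> c) = (\<Sum>c\<in>cells 1. if c \<in> S then \<zeta> c else 0)"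
      by (intro sum.cong) auto
    also have "\<dots> = sum \<zeta> S" by (subst sum.inter_restrict[symmetric]) (auto simp: S_def intro!: sum.cong)
    finally show ?thesis .
  qed
  then have "real (per 1 S) \<le> 0"
    using \<zeta>(1) \<zeta>(2)[of 0] P0 unfolding S_def[symmetric] by (metis ereal_less_eq(3) order_trans)
  then have "per 1 S = 0" by simp
  then have per0: "node_per 1 S n = 0" if "n \<in> nodes 1" for n
    using that finite_nodes[of 1] unfolding per_def by simp
  have "w e = w e'" if v: "v \<in> verts G" and inc: "e \<in> incident_edges G v" "e' \<in> incident_edges G v" for v e e'
  proof -
    have half: "\<exists>k. ((e, 0), k) \<in> halves 1 \<and> node 1 ((e, 0), k) = Inl v" if "e \<in> incident_edges G v" for e
    proof (cases "v = head G e")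
      case True
      then show ?thesis using that by (intro exI[of _ True]) (auto simp: incident_edges_def halves_def cells_def)
    next
      case False
      then show ?thesis using that by (intro exI[of _ False]) (auto simp: incident_edges_def halves_def cells_def)
    qed
    obtain k k' where k: "((e, 0), k) \<in> halves 1" "node 1 ((e, 0), k) = Inl v"
      "((e', 0), k') \<in> halves 1" "node 1 ((e', 0), k') = Inl v" using half inc by blast
    have "Inl v \<in> nodes 1" using k unfolding nodes_def by (metis imageI)
    then have "node_per 1 S (Inl v) = 0" by (rule per0)
    then have "{b\<in>halves 1. node 1 b = Inl v \<and> fst b \<in> S} = {} \<or> {b\<in>halves 1. node 1 b = Inl v \<and> fst b \<notin> S} = {}"
      unfolding node_per_def by (auto simp: min_def split: if_splits)
    then have "(e, 0) \<in> S \<longleftrightarrow> (e', 0) \<in> S" using k by force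
    moreover have "(e, 0) \<in> cells 1" "(e', 0) \<in> cells 1" using inc by (auto simp: incident_edges_def cells_def)
    ultimately show ?thesis using S w01[of e] w01[of e'] by (auto simp: cells_def)
  qed
  note const = connected_constant[of w, OF this]
  obtain e0 where e0: "e0 \<in> arcs G" using arcs_nonempty by auto
  have "glength G D = w e0 * total_length"
    unfolding length total_length_def sum_distrib_left by (intro sum.cong refl) (use const[OF _ _ _ e0] in auto)
  then show False using w01[OF e0] len by auto
qed

end

section \<open>The isoperimetric inequality for functions\<close>

text \<open>The indicator of \<open>{..<w}\<close> alone is not integrable; subtracting that of the
  negative half-line repairs this for either sign of \<open>w\<close>.\<close>

lemma has_integral_indicator_shift:
  "has_bochner_integral lborel (\<lambda>t. indicator {..<w} t - indicator {..<0} t :: real) (w :: real)"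
proof (cases "0 \<le> w")
  case True
  have "has_bochner_integral lborel (indicator {0..<w} :: real \<Rightarrow> real) (measure lborel {0..<w})"
    by (rule has_bochner_integral_real_indicator) (use True in auto)
  moreover have "(\<lambda>t. indicator {..<w} t - indicator {..<0} t :: real) = indicator {0..<w}"
    using True by (auto simp: indicator_def fun_eq_iff)
  ultimately show ?thesis using True by simp
next
  case False
  have "has_bochner_integral lborel (\<lambda>t. - (indicator {w..<0} t :: real)) (- measure lborel {w..<0})"
    by (intro has_bochner_integral_minus has_bochner_integral_real_indicator) (use False in auto)
  moreover have "(\<lambda>t. indicator {..<w} t - indicator {..<0} t :: real) = (\<lambda>t. - indicator {w..<0} t)"
    using False by (auto simp: indicator_def fun_eq_iff)
  ultimately show ?thesis using False by simp
qed

text \<open>The zero total removes the correction on the negative half-line; otherwise the integrand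
  would not vanish as \<open>t\<close> tends to minus infinity.\<close>

lemma layer_cake_sum:
  fixes w D :: "'a \<Rightarrow> real"
  assumes C: "finite C" and D: "sum D C = 0"
  shows "has_bochner_integral lborel (\<lambda>t. sum D {c\<in>C. t < w c}) (\<Sum>c\<in>C. w c * D c)"
proof -
  have "has_bochner_integral lborel (\<lambda>t. \<Sum>c\<in>C. (indicator {..<w c} t - indicator {..<0} t) * D c) (\<Sum>c\<in>C. w c * D c)"
    by (intro has_bochner_integral_sum has_bochner_integral_mult_left has_integral_indicator_shift)
  moreover have "(\<Sum>c\<in>C. (indicator {..<w c} t - indicator {..<0} t) * D c) = sum D {c\<in>C. t < w c}" for t
  proof -
    have "(\<Sum>c\<in>C. (indicator {..<w c} t - indicator {..<0} t) * D c)
        = (\<Sum>c\<in>C. if t < w c then D c else 0) - indicator {..<0} t * sum D C"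
      unfolding sum_distrib_left sum_subtractf[symmetric] by (intro sum.cong) (auto simp: indicator_def)
    then show ?thesis using C D by (simp add: sum.inter_filter)
  qed
  ultimately show ?thesis by simp
qed

text \<open>For fixed \<open>x\<close> the levels that tell \<open>a x\<close> from
  \<open>b x\<close> fill an interval of length \<open>\<bar>a x - b x\<bar>\<close>; Fubini does
  the rest.\<close>

lemma level_set_distance:
  fixes a b :: "real \<Rightarrow> real"
  assumes a: "integrable (IV l) a" and b: "integrable (IV l) b"
  shows "integrable lborel (\<lambda>t. LINT x|IV l. \<bar>indicat_real {..<a x} t - indicat_real {..<b x} t\<bar>)"
    "(LINT t|lborel. LINT x|IV l. \<bar>indicat_real {..<a x} t - indicat_real {..<b x} t\<bar>) = (LINT x|IV l. \<bar>a x - b x\<bar>)"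
proof -
  interpret finite_measure "IV l" by (rule finite_measure_IV)
  interpret pair_sigma_finite "IV l" lborel ..
  have [measurable]: "a \<in> borel_measurable (IV l)" "b \<in> borel_measurable (IV l)" using a b by auto
  have inner: "has_bochner_integral lborel (\<lambda>t. \<bar>indicator {..<p} t - indicator {..<q} t\<bar> :: real) \<bar>p - q\<bar>" for p q :: real
  proof -
    have "has_bochner_integral lborel (indicator {min p q..<max p q} :: real \<Rightarrow> real) (measure lborel {min p q..<max p q})"
      by (rule has_bochner_integral_real_indicator) auto
    moreover have "(\<lambda>t. \<bar>indicator {..<p} t - indicator {..<q} t\<bar> :: real) = indicator {min p q..<max p q}"
      by (auto simp: indicator_def fun_eq_iff)
    moreover have "measure lborel {min p q..<max p q} = \<bar>p - q\<bar>" by (cases "p \<le> q") auto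
    ultimately show ?thesis by (simp only:)
  qed
  define F where "F x t = (\<bar>indicator {..<a x} t - indicator {..<b x} t\<bar> :: real)" for x t
  have inner': "has_bochner_integral lborel (F x) \<bar>a x - b x\<bar>" for x
    unfolding F_def by (rule inner)
  have int: "integrable (IV l \<Otimes>\<^sub>M lborel) (case_prod F)"
  proof (rule Fubini_integrable)
    have "case_prod F = (\<lambda>p. \<bar>(if snd p < a (fst p) then 1 else 0) - (if snd p < b (fst p) then 1 else 0)\<bar>)"
      by (auto simp: F_def indicator_def fun_eq_iff)
    moreover have "(\<lambda>p. \<bar>(if snd p < a (fst p) then 1 else 0) - (if snd p < b (fst p) then 1 else 0)\<bar> :: real)
        \<in> borel_measurable (IV l \<Otimes>\<^sub>M lborel)" by measurable
    ultimately show "case_prod F \<in> borel_measurable (IV l \<Otimes>\<^sub>M lborel)" by simp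
    have "norm (F x t) = F x t" for x t by (simp add: F_def)
    then show "integrable (IV l) (\<lambda>x. LINT t|lborel. norm (case_prod F (x, t)))"
      using a b by (simp add: has_bochner_integral_integral_eq[OF inner'])
    show "AE x in IV l. integrable lborel (\<lambda>t. case_prod F (x, t))"
      by (intro AE_I2) (simp add: integrable.intros[OF inner'])
  qed
  have int': "integrable (IV l \<Otimes>\<^sub>M lborel) (case_prod (\<lambda>x t. \<bar>indicator {..<a x} t - indicator {..<b x} t\<bar> :: real))"
    using int unfolding F_def .
  show "integrable lborel (\<lambda>t. LINT x|IV l. \<bar>indicat_real {..<a x} t - indicat_real {..<b x} t\<bar>)"
    by (rule integrable_snd[OF int'])
  have "(LINT t|lborel. LINT x|IV l. \<bar>indicat_real {..<a x} t - indicat_real {..<b x} t\<bar>) = (LINT x|IV l. LINT t|lborel. \<bar>indicat_real {..<a x} t - indicat_real {..<b x} t\<bar>)"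
    by (rule Fubini_integral[OF int'])
  then show "(LINT t|lborel. LINT x|IV l. \<bar>indicat_real {..<a x} t - indicat_real {..<b x} t\<bar>) = (LINT x|IV l. \<bar>a x - b x\<bar>)"
    by (simp add: has_bochner_integral_integral_eq[OF inner])
qed

lemma AE_lborel_meets_interval:
  assumes "AE t in lborel. P (t :: real)" "a < b"
  obtains t where "a < t" "t < b" "P t"
proof (rule ccontr)
  assume "\<not> thesis"
  then have "\<And>t. P t \<Longrightarrow> t \<notin> {a<..<b}" using that by auto
  then have "AE t in lborel. t \<notin> {a<..<b}" using assms(1) by (auto elim: eventually_mono)
  then have "{a<..<b} \<in> null_sets lborel" by (simp add: AE_iff_null_sets)
  then show False using assms(2) by (simp add: null_sets_def)
qed

context mgraph
begin

text \<open>The bound is pointwise because eigenpairs prescribe \<xi> as a pointwise section of the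
  sign.\<close>

definition balanced :: "('e \<times> real \<Rightarrow> real) \<Rightarrow> bool" where
  "balanced \<xi> \<longleftrightarrow> (\<forall>e\<in>arcs G. (\<lambda>x. \<xi> (e, x)) \<in> borel_measurable (EV e) \<and>
     (\<forall>x\<in>{0<..<len G e}. \<bar>\<xi> (e, x)\<bar> \<le> 1)) \<and> gint G \<xi> = 0"

definition graph_cell_int :: "nat \<Rightarrow> ('e \<times> real \<Rightarrow> real) \<Rightarrow> 'e \<times> nat \<Rightarrow> real" where
  "graph_cell_int N \<xi> c = cell_int (len G (fst c)) N (\<lambda>x. \<xi> (fst c, x)) (snd c)"

definition mean_error :: "nat \<Rightarrow> ('e \<times> real \<Rightarrow> real) \<Rightarrow> real" where
  "mean_error N u = (\<Sum>e\<in>arcs G. LINT x|EV e.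
     \<bar>u (e, x) - graph_mean N u (e, cell_index (len G e) N x)\<bar>)"

lemma balancedD:
  assumes "balanced \<xi>" "e \<in> arcs G"
  shows "(\<lambda>x. \<xi> (e, x)) \<in> borel_measurable (EV e)" "x \<in> {0<..<len G e} \<Longrightarrow> \<bar>\<xi> (e, x)\<bar> \<le> 1"
    "integrable (EV e) (\<lambda>x. \<xi> (e, x))"
    "integrable (EV e) f \<Longrightarrow> integrable (EV e) (\<lambda>x. \<xi> (e, x) * f x)"
proof -
  show m: "(\<lambda>x. \<xi> (e, x)) \<in> borel_measurable (EV e)"
    using assms by (simp add: balanced_def)
  have b: "\<bar>\<xi> (e, x)\<bar> \<le> 1" if "x \<in> {0<..<len G e}" for x
    using assms that unfolding balanced_def by blast
  then show "x \<in> {0<..<len G e} \<Longrightarrow> \<bar>\<xi> (e, x)\<bar> \<le> 1" .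
  show "integrable (EV e) (\<lambda>x. \<xi> (e, x))" by (rule integrable_IV_bounded[OF m b])
  assume f: "integrable (EV e) f"
  then have [measurable]: "f \<in> borel_measurable (EV e)" by auto
  show "integrable (EV e) (\<lambda>x. \<xi> (e, x) * f x)"
  proof (rule Bochner_Integration.integrable_bound[OF f])
    show "AE x in EV e. norm (\<xi> (e, x) * f x) \<le> norm (f x)"
      using b by (intro AE_I2) (auto simp: abs_mult intro!: mult_left_le_one_le)
  qed (use m in measurable)
qed

lemma graph_cell_int_mesh:
  assumes \<xi>: "balanced \<xi>" and N: "0 < N" and S: "S \<subseteq> cells N"
  shows "sum (graph_cell_int N \<xi>) S = pairing G (indicator (mesh N S)) (\<lambda>e x. \<xi> (e, x))"
  using pairing_mesh[OF balancedD(3)[OF \<xi>] N S] by (simp add: graph_cell_int_def)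

lemma sum_graph_cell_int_cells:
  assumes \<xi>: "balanced \<xi>" and N: "0 < N"
  shows "sum (graph_cell_int N \<xi>) (cells N) = 0"
proof -
  have "sum (graph_cell_int N \<xi>) (cells N) = (\<Sum>e\<in>arcs G. \<Sum>i<N. cell_int (len G e) N (\<lambda>x. \<xi> (e, x)) i)"
    by (simp add: cells_def sum.cartesian_product graph_cell_int_def case_prod_unfold)
  also have "\<dots> = gint G \<xi>"
    unfolding gint_def by (intro sum.cong refl LINT_eq_sum_cell_int[symmetric] balancedD(3)[OF \<xi>] N)
  finally show ?thesis using \<xi> by (simp add: balanced_def)
qed

lemma abs_graph_cell_int_le:
  assumes \<xi>: "balanced \<xi>" and N: "0 < N" and c: "c \<in> cells N"
  shows "\<bar>graph_cell_int N \<xi> c\<bar> \<le> len G (fst c) / real N"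
proof -
  obtain e i where ei: "c = (e, i)" "e \<in> arcs G" "i < N" using c by (auto simp: cells_def)
  have "\<bar>cell_mean (len G e) N (\<lambda>x. \<xi> (e, x)) i\<bar> \<le> 1"
    using abs_cell_mean_le[OF balancedD(2,1)[OF \<xi> ei(2)] N len_pos[OF ei(2)] ei(3)] .
  then show ?thesis using N len_pos[OF ei(2)] unfolding ei cell_mean_def graph_cell_int_def
    by (simp add: abs_mult field_simps)
qed

lemma abs_sum_graph_cell_int_le:
  assumes \<xi>: "balanced \<xi>" and N: "0 < N" and S: "S \<subseteq> cells N"
  shows "\<bar>sum (graph_cell_int N \<xi>) S\<bar> \<le> cell_length N S"
  unfolding cell_length_def
  by (rule order_trans[OF sum_abs]) (use S in \<open>auto intro!: sum_mono abs_graph_cell_int_le[OF \<xi> N]\<close>)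

lemma cell_length_compl:
  assumes N: "0 < N" and S: "S \<subseteq> cells N"
  shows "cell_length N (cells N - S) = total_length - cell_length N S"
proof -
  have "cell_length N (cells N) = (\<Sum>e\<in>arcs G. \<Sum>i<N. len G e / real N)"
    by (simp only: cell_length_def cells_def sum.cartesian_product case_prod_unfold)
  then have "cell_length N (cells N) = total_length" using N by (simp add: total_length_def)
  moreover have "cell_length N (cells N - S) = cell_length N (cells N) - cell_length N S"
    unfolding cell_length_def using S by (intro sum_diff) auto
  ultimately show ?thesis by simp
qed

text \<open>A set and its complement have the same perimeter and, as \<xi> has mean zero, opposite
  integrals of \<xi>; so the shorter of the two can be used.\<close>

lemma flux_le_discrete_per:
  assumes h: "isoperimetric h" and \<xi>: "balanced \<xi>" and N: "0 < N" and S: "S \<subseteq> cells N"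
  shows "h * sum (graph_cell_int N \<xi>) S \<le> real (per N S)"
proof -
  have h0: "0 \<le> h" using h by (simp add: isoperimetric_def)
  have small: "h * \<bar>sum (graph_cell_int N \<xi>) T\<bar> \<le> real (per N T)"
    if T: "T \<subseteq> cells N" "cell_length N T \<le> total_length / 2" for T
  proof (cases "T = {}")
    case False
    have "h * \<bar>sum (graph_cell_int N \<xi>) T\<bar> \<le> h * cell_length N T"
      by (intro mult_left_mono abs_sum_graph_cell_int_le[OF \<xi> N T(1)] h0)
    also have "\<dots> \<le> real (per N T)" using h N T False unfolding isoperimetric_def by blast
    finally show ?thesis .
  qed simp
  have le_abs: "h * sum (graph_cell_int N \<xi>) S \<le> h * \<bar>sum (graph_cell_int N \<xi>) S\<bar>"
    using h0 by (intro mult_left_mono) auto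
  show ?thesis
  proof (cases "cell_length N S \<le> total_length / 2")
    case True
    then show ?thesis using small[OF S] le_abs by linarith
  next
    case False
    then have "cell_length N (cells N - S) \<le> total_length / 2"
      using cell_length_compl[OF N S] by linarith
    then have "h * \<bar>sum (graph_cell_int N \<xi>) (cells N - S)\<bar> \<le> real (per N S)"
      using small[of "cells N - S"] per_compl[of N S] by auto
    moreover have "sum (graph_cell_int N \<xi>) (cells N - S) = - sum (graph_cell_int N \<xi>) S"
      using sum_diff[of "cells N" S "graph_cell_int N \<xi>"] S sum_graph_cell_int_cells[OF \<xi> N] by simp
    ultimately show ?thesis using le_abs by simp
  qed
qed

text \<open>
  The gap \<open>q t\<close> in the isoperimetric inequality for the level \<open>t\<close>; by the layer cake formula its integral is the
  gap for the cell means of \<open>u\<close>.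
\<close>

lemma calibrated_gap:
  assumes h: "isoperimetric h" and \<xi>: "balanced \<xi>" and N: "0 < N" and u: "gL1 G u"
  obtains q where "\<And>t. 0 \<le> q t"
    "\<And>t. real (per N (level_cells N u t)) = q t + h * sum (graph_cell_int N \<xi>) (level_cells N u t)"
    "integrable lborel q"
    "ereal (h * (\<Sum>c\<in>cells N. graph_mean N u c * graph_cell_int N \<xi> c) + (LINT t|lborel. q t)) \<le> TV G u"
proof -
  obtain \<zeta> where \<zeta>: "ereal (\<Sum>c\<in>cells N. graph_mean N u c * \<zeta> c) \<le> TV G u"
    "\<And>t. sum \<zeta> (level_cells N u t) = real (per N (level_cells N u t))"
    using calibrated_flow[OF N u] by blast
  define D where "D c = \<zeta> c - h * graph_cell_int N \<xi> c" for c
  define q where "q t = sum D (level_cells N u t)" for t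
  have q: "q t = real (per N (level_cells N u t)) - h * sum (graph_cell_int N \<xi>) (level_cells N u t)" for t
    unfolding q_def D_def sum_subtractf \<zeta>(2) sum_distrib_left ..
  have "sum D (cells N) = 0"
  proof -
    \<comment> \<open>Below all cell means the level set is the whole graph, with perimeter 0 and
      integral of \<xi> equal to 0. This yields the zero total that \<open>layer_cake_sum\<close>
      requires.\<close>
    define t0 where "t0 = Min (graph_mean N u ` cells N) - 1"
    have "t0 < graph_mean N u c" if "c \<in> cells N" for c
    proof -
      have "Min (graph_mean N u ` cells N) \<le> graph_mean N u c" using that by (intro Min_le) auto
      then show ?thesis by (simp add: t0_def)
    qed
    then have all: "{c\<in>cells N. t0 < graph_mean N u c} = cells N" by auto
    have "per N (cells N) = per N {}" using per_compl[of N "{}"] by simp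
    also have "\<dots> = 0" by (simp add: per_def node_per_def)
    finally show ?thesis
      using q[of t0] sum_graph_cell_int_cells[OF \<xi> N] unfolding all q_def by simp
  qed
  then have hb: "has_bochner_integral lborel q (\<Sum>c\<in>cells N. graph_mean N u c * D c)"
    unfolding q_def by (intro layer_cake_sum) auto
  show ?thesis
  proof
    show "0 \<le> q t" for t
      unfolding q using flux_le_discrete_per[OF h \<xi> N, of "(level_cells N u t)"] by auto
    show "real (per N (level_cells N u t)) = q t + h * sum (graph_cell_int N \<xi>) (level_cells N u t)" for t
      unfolding q by simp
    show "integrable lborel q" using hb by (rule integrable.intros)
    have "h * (\<Sum>c\<in>cells N. graph_mean N u c * graph_cell_int N \<xi> c) + (LINT t|lborel. q t) = (\<Sum>c\<in>cells N. graph_mean N u c * \<zeta> c)"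
      unfolding has_bochner_integral_integral_eq[OF hb] D_def sum_distrib_left sum.distrib[symmetric]
      by (intro sum.cong) (auto simp: algebra_simps)
    then show "ereal (h * (\<Sum>c\<in>cells N. graph_mean N u c * graph_cell_int N \<xi> c) + (LINT t|lborel. q t)) \<le> TV G u"
      using \<zeta>(1) by simp
  qed
qed

lemma integrable_graph_mean:
  assumes "0 < N"
  shows "integrable (EV e) (\<lambda>x. graph_mean N u (e, cell_index (len G e) N x))"
proof -
  have "integrable (EV e) (\<lambda>x. 1 :: real)"
    by (rule integrable_const_IV)
  from integrable_step_mult[OF this assms, where c = "\<lambda>i. graph_mean N u (e, i)"] show ?thesis by simp
qed

text \<open>As \<xi> is bounded by 1, replacing \<open>u\<close> by its cell means costs at most
  their L1 distance.\<close>

lemma sum_graph_mean_approx: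
  assumes \<xi>: "balanced \<xi>" and N: "0 < N" and u: "gL1 G u"
  shows "gint G (\<lambda>p. \<xi> p * u p) - mean_error N u \<le> (\<Sum>c\<in>cells N. graph_mean N u c * graph_cell_int N \<xi> c)"
proof -
  have "(\<Sum>c\<in>cells N. graph_mean N u c * graph_cell_int N \<xi> c)
      = (\<Sum>e\<in>arcs G. \<Sum>i<N. graph_mean N u (e, i) * cell_int (len G e) N (\<lambda>x. \<xi> (e, x)) i)"
    unfolding cells_def sum.cartesian_product by (intro sum.cong) (auto simp: graph_cell_int_def)
  also have "\<dots> = (\<Sum>e\<in>arcs G. LINT x|EV e. graph_mean N u (e, cell_index (len G e) N x) * \<xi> (e, x))"
    by (intro sum.cong refl LINT_step_mult[symmetric] balancedD(3)[OF \<xi>] N)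
  finally have eq: "(\<Sum>c\<in>cells N. graph_mean N u c * graph_cell_int N \<xi> c)
      = (\<Sum>e\<in>arcs G. LINT x|EV e. graph_mean N u (e, cell_index (len G e) N x) * \<xi> (e, x))" .
  show ?thesis
    unfolding eq gint_def mean_error_def sum_subtractf[symmetric]
  proof (rule sum_mono)
    fix e assume e: "e \<in> arcs G"
    have iu: "integrable (EV e) (\<lambda>x. u (e, x))" using u e by (simp add: gL1_def)
    note im = integrable_graph_mean[OF N, of e u]
    have "(LINT x|EV e. \<xi> (e, x) * u (e, x)) - (LINT x|EV e. \<bar>u (e, x) - graph_mean N u (e, cell_index (len G e) N x)\<bar>)
      = (LINT x|EV e. \<xi> (e, x) * u (e, x) - \<bar>u (e, x) - graph_mean N u (e, cell_index (len G e) N x)\<bar>)"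
      by (rule Bochner_Integration.integral_diff[symmetric]) (auto intro!: balancedD(4)[OF \<xi> e] iu im)
    also have "\<dots> \<le> (LINT x|EV e. \<xi> (e, x) * graph_mean N u (e, cell_index (len G e) N x))"
    proof (rule integral_mono)
      fix x assume x: "x \<in> space (EV e)"
      let ?d = "u (e, x) - graph_mean N u (e, cell_index (len G e) N x)"
      have "\<xi> (e, x) * ?d \<le> \<bar>\<xi> (e, x) * ?d\<bar>" by simp
      also have "\<dots> \<le> 1 * \<bar>?d\<bar>" unfolding abs_mult using balancedD(2)[OF \<xi> e, of x] x by (intro mult_right_mono) auto
      finally show "\<xi> (e, x) * u (e, x) - \<bar>?d\<bar> \<le> \<xi> (e, x) * graph_mean N u (e, cell_index (len G e) N x)"
        by (simp add: algebra_simps)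
    qed (auto intro!: Bochner_Integration.integrable_diff integrable_abs balancedD(4)[OF \<xi> e] iu im)
    finally show "(LINT x|EV e. \<xi> (e, x) * u (e, x)) - (LINT x|EV e. \<bar>u (e, x) - graph_mean N u (e, cell_index (len G e) N x)\<bar>)
      \<le> (LINT x|EV e. graph_mean N u (e, cell_index (len G e) N x) * \<xi> (e, x))"
      by (simp add: mult.commute)
  qed
qed

lemma mean_error_le:
  assumes u: "gL1 G u" and K: "TV G u \<le> ereal K" and N: "0 < N"
  shows "mean_error N u \<le> 2 * total_length * K / real N"
proof -
  have "mean_error N u \<le> (\<Sum>e\<in>arcs G. 2 * len G e / real N * K)"
    unfolding mean_error_def graph_mean_def using cell_mean_error[OF u K _ N] by (intro sum_mono) auto
  also have "\<dots> = 2 * total_length * K / real N"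
    by (simp add: total_length_def sum_distrib_left sum_distrib_right sum_divide_distrib algebra_simps)
  finally show ?thesis .
qed

lemma mean_error_nonneg: "0 \<le> mean_error N u"
  unfolding mean_error_def by (intro sum_nonneg) simp

lemma mean_error_tendsto:
  assumes u: "gL1 G u" and K: "TV G u \<le> ereal K"
  shows "(\<lambda>n. mean_error (Suc n) u) \<longlonglongrightarrow> 0"
proof (rule tendsto_sandwich[OF _ _ tendsto_const])
  show "\<forall>\<^sub>F n in sequentially. mean_error (Suc n) u \<le> 2 * total_length * K / real (Suc n)"
    by (intro always_eventually allI mean_error_le[OF u K]) simp
  show "(\<lambda>n. 2 * total_length * K / real (Suc n)) \<longlonglongrightarrow> 0"
    using LIMSEQ_Suc[OF lim_const_over_n[of "2 * total_length * K"]] by simp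
qed (simp add: mean_error_nonneg)

text \<open>Drop the integral of the nonnegative gap and refine the mesh: when \<open>TV G u\<close>
  is finite, the mean error is of order \<open>1 / N\<close>.\<close>

lemma isoperimetric_TV:
  assumes h: "isoperimetric h" and \<xi>: "balanced \<xi>" and u: "gL1 G u"
  shows "ereal (h * gint G (\<lambda>p. \<xi> p * u p)) \<le> TV G u"
proof (cases "TV G u")
  case (real K)
  have h0: "0 \<le> h" using h by (simp add: isoperimetric_def)
  have "h * (gint G (\<lambda>p. \<xi> p * u p) - mean_error (Suc n) u) \<le> K" for n
  proof -
    obtain q where q: "\<And>t::real. 0 \<le> q t"
      "ereal (h * (\<Sum>c\<in>cells (Suc n). graph_mean (Suc n) u c * graph_cell_int (Suc n) \<xi> c) + (LINT t|lborel. q t)) \<le> TV G u"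
    proof (rule calibrated_gap[OF h \<xi> zero_less_Suc u, of n], goal_cases)
      case (1 q)
      show ?case by (rule 1(1)[of q, OF 1(2) 1(5)])
    qed
    have "0 \<le> (LINT t|lborel. q t)" using q(1) by simp
    then have "h * (\<Sum>c\<in>cells (Suc n). graph_mean (Suc n) u c * graph_cell_int (Suc n) \<xi> c) \<le> K"
      using q(2) real by simp
    moreover have "h * (gint G (\<lambda>p. \<xi> p * u p) - mean_error (Suc n) u)
        \<le> h * (\<Sum>c\<in>cells (Suc n). graph_mean (Suc n) u c * graph_cell_int (Suc n) \<xi> c)"
      by (intro mult_left_mono sum_graph_mean_approx[OF \<xi> _ u] h0) simp
    ultimately show ?thesis by linarith
  qed
  moreover have "(\<lambda>n. h * (gint G (\<lambda>p. \<xi> p * u p) - mean_error (Suc n) u)) \<longlonglongrightarrow> h * (gint G (\<lambda>p. \<xi> p * u p) - 0)"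
    by (intro tendsto_intros mean_error_tendsto[OF u, of K]) (simp add: real)
  ultimately have "h * (gint G (\<lambda>p. \<xi> p * u p) - 0) \<le> K"
    by (intro LIMSEQ_le_const2) auto
  then show ?thesis using real by simp
next
  case MInf
  then show ?thesis using TV_nonneg[OF u] by simp
qed simp


section \<open>Eigenpairs\<close>

lemma isoperimetric_0: "isoperimetric h \<Longrightarrow> 0 \<le> h"
  by (simp add: isoperimetric_def)

lemma gint_cong:
  assumes "\<And>e x. e \<in> arcs G \<Longrightarrow> x \<in> {0<..<len G e} \<Longrightarrow> f (e, x) = g (e, x)"
  shows "gint G f = gint G g"
  unfolding gint_def by (intro sum.cong refl Bochner_Integration.integral_cong) (use assms in auto)

lemma gint_mult_left: "gint G (\<lambda>p. c * f p) = c * gint G f"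
  by (simp add: gint_def sum_distrib_left)

lemma gint_add:
  assumes "gL1 G f" "gL1 G g"
  shows "gint G (\<lambda>p. f p + g p) = gint G f + gint G g"
  unfolding gint_def sum.distrib[symmetric]
  using assms by (intro sum.cong refl Bochner_Integration.integral_add) (auto simp: gL1_def)

lemma gint_diff:
  assumes "gL1 G f" "gL1 G g"
  shows "gint G (\<lambda>p. f p - g p) = gint G f - gint G g"
  unfolding gint_def sum_subtractf[symmetric]
  using assms by (intro sum.cong refl Bochner_Integration.integral_diff) (auto simp: gL1_def)

lemma gint_const: "gint G (\<lambda>_. c) = c * total_length"
proof -
  have "(LINT x|EV e. c) = c * len G e" if "e \<in> arcs G" for e
    using LINT_one[OF len_pos[OF that]] Bochner_Integration.integral_mult_right_zero[of "EV e" c "\<lambda>_. 1"] by simp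
  then show ?thesis unfolding gint_def total_length_def sum_distrib_left by (intro sum.cong refl)
qed

lemma gint_mono:
  assumes "gL1 G f" "gL1 G g"
    "\<And>e x. e \<in> arcs G \<Longrightarrow> x \<in> {0<..<len G e} \<Longrightarrow> f (e, x) \<le> g (e, x)"
  shows "gint G f \<le> gint G g"
  unfolding gint_def
  using assms by (intro sum_mono integral_mono) (auto simp: gL1_def)

lemma gL1_const: "gL1 G (\<lambda>_. c)"
  unfolding gL1_def by (intro ballI integrable_const_IV)

lemma gL1_mult_left: "gL1 G f \<Longrightarrow> gL1 G (\<lambda>p. c * f p)"
  by (simp add: gL1_def)

lemma gL1_add: "gL1 G f \<Longrightarrow> gL1 G g \<Longrightarrow> gL1 G (\<lambda>p. f p + g p)"
  by (simp add: gL1_def)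

lemma gL1_balanced_mult:
  "balanced \<xi> \<Longrightarrow> gL1 G u \<Longrightarrow> gL1 G (\<lambda>p. \<xi> p * u p)"
  unfolding gL1_def using balancedD(4) by blast

lemma gL1_gBV: "gBV G u \<Longrightarrow> gL1 G u"
  unfolding gL1_def gBV_def BV_def Lp_def curry_def
  by (auto simp: integrable_abs_iff)

lemma gL1_gL2: "gL2 G u \<Longrightarrow> gL1 G u"
  unfolding gL1_def gL2_def using Lp2_imp_integrable by (auto simp: curry_def)

lemma F_TV_ge: "TV G v \<le> F_TV G v"
  by (simp add: F_TV_def)

lemma TV_le_real:
  assumes u: "gL1 G u" and K: "TV G u \<le> ereal K" and F: "flow G g y"
  shows "\<bar>pairing G u g\<bar> \<le> K"
  using order_trans[OF TV_ge[OF F u] K] by simp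

lemma TV_scale_le:
  assumes u: "gL1 G u" and K: "TV G u \<le> ereal K"
  shows "TV G (\<lambda>p. c * u p) \<le> ereal (\<bar>c\<bar> * K)"
proof (rule TV_le)
  fix g y assume F: "flow G g y"
  have "pairing G (\<lambda>p. c * u p) g = c * pairing G u g"
    by (simp add: pairing_def sum_distrib_left mult.assoc)
  also have "\<dots> \<le> \<bar>c\<bar> * \<bar>pairing G u g\<bar>" by (metis abs_ge_self abs_mult)
  also have "\<dots> \<le> \<bar>c\<bar> * K" by (intro mult_left_mono TV_le_real[OF u K F]) auto
  finally show "ereal (pairing G (\<lambda>p. c * u p) g) \<le> ereal (\<bar>c\<bar> * K)" by simp
qed

text \<open>Constants pair to 0 with flows. As \<open>u\<close> and the derivative of the flow are
  in L2, their product is integrable and the integral of the sum splits.\<close>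

lemma TV_add_const_le:
  assumes u: "gL2 G u" and K: "TV G u \<le> ereal K"
  shows "TV G (\<lambda>p. u p + c) \<le> ereal K"
proof (rule TV_le)
  fix g y assume F: "flow G g y"
  have "pairing G (\<lambda>p. u p + c) g = (\<Sum>e\<in>arcs G. (LINT x|EV e. u (e, x) * g e x) + c * (LINT x|EV e. g e x))"
    unfolding pairing_def
  proof (intro sum.cong refl)
    fix e assume e: "e \<in> arcs G"
    have "integrable (EV e) (\<lambda>x. u (e, x) * g e x)"
      using u e flowD(1)[OF F e] by (intro Lp2_mult_integrable) (auto simp: gL2_def curry_def)
    then show "(LINT x|EV e. (u (e, x) + c) * g e x) = (LINT x|EV e. u (e, x) * g e x) + c * (LINT x|EV e. g e x)"
      using flow_integral(1)[OF F e] by (simp add: distrib_right)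
  qed
  also have "\<dots> = pairing G u g"
    using flow_total_zero[OF F] by (simp add: sum.distrib sum_distrib_left[symmetric] pairing_def)
  also have "\<dots> \<le> K" using TV_le_real[OF gL1_gL2[OF u] K F] by simp
  finally show "ereal (pairing G (\<lambda>p. u p + c) g) \<le> ereal K" by simp
qed

text \<open>
  The section of the sign that turns the indicator function of an optimal set into an eigenfunction: 1 on \<open>D\<close> and
  the constant of mean zero outside.
\<close>

definition cut_sign :: "('e \<times> real) set \<Rightarrow> 'e \<times> real \<Rightarrow> real" where
  "cut_sign D p = (if p \<in> D then 1 else - glength G D / (total_length - glength G D))"

lemma cut_sign_bound:
  assumes "0 < glength G D" "glength G D \<le> total_length / 2"
  shows "cut_sign D p \<in> {-1..1}"
  using assms total_length_pos by (auto simp: cut_sign_def field_simps)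

lemma balanced_cut_sign:
  assumes D: "gmeasurable G D" and len: "0 < glength G D" "glength G D \<le> total_length / 2"
  shows "balanced (cut_sign D)"
proof -
  define k where "k = glength G D / (total_length - glength G D)"
  have eq: "cut_sign D = (\<lambda>p. (1 + k) * indicator D p + - k)"
    by (auto simp: cut_sign_def k_def indicator_def)
  note i = gL1_indicator[OF D]
  have ic: "gL1 G (cut_sign D)"
    unfolding eq by (intro gL1_add gL1_mult_left i gL1_const)
  have "gint G (cut_sign D) = (1 + k) * glength G D + - k * total_length"
    unfolding eq glength_def
    by (subst gint_add[OF gL1_mult_left[OF i] gL1_const]) (simp only: gint_mult_left gint_const)
  also have "\<dots> = 0" using len total_length_pos by (simp add: k_def field_simps)
  finally have "gint G (cut_sign D) = 0" .
  moreover have "\<bar>cut_sign D p\<bar> \<le> 1" for p using cut_sign_bound[OF len, of p] by auto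
  ultimately show ?thesis using ic unfolding balanced_def gL1_def by auto
qed

text \<open>\<open>cut_sign D\<close> integrates over \<open>D\<close> to its length, so the
  inequality for functions carries the isoperimetric one from unions of cells to all measurable
  sets.\<close>

lemma isoperimetric_Per:
  assumes h: "isoperimetric h" and D: "gmeasurable G D" "0 < glength G D" "glength G D \<le> total_length / 2"
  shows "ereal (h * glength G D) \<le> Per G D"
proof -
  have "gint G (\<lambda>p. cut_sign D p * indicator D p) = glength G D"
    unfolding glength_def by (rule gint_cong) (simp add: cut_sign_def indicator_def)
  then show ?thesis
    using isoperimetric_TV[OF h balanced_cut_sign[OF D] gL1_indicator[OF D(1)]] by (simp add: Per_def)
qed

lemma Lp2_edge_bounded:
  assumes "gL1 G f" "e \<in> arcs G" "\<And>p. \<bar>f p\<bar> \<le> B"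
  shows "Lp 2 (len G e) (curry f e)"
  using assms by (intro Lp2_bounded[where B=B]) (auto simp: gL1_def curry_def)

lemma normalized_indicator:
  assumes h: "isoperimetric h" and D: "gmeasurable G D" "0 < glength G D" "glength G D \<le> total_length / 2"
    and P: "Per G D \<le> ereal (h * glength G D)"
  defines "u \<equiv> \<lambda>p. indicator D p / glength G D"
  shows "gL1 G u" "TV G u \<le> ereal h" "gBV G u" "L1_norm G u = 1"
proof -
  note i = gL1_indicator[OF D(1)]
  have u: "u = (\<lambda>p. (1 / glength G D) * indicator D p)" by (simp add: u_def)
  show iu: "gL1 G u" unfolding u by (rule gL1_mult_left[OF i])
  show TV: "TV G u \<le> ereal h"
    using TV_scale_le[OF i, of "h * glength G D" "1 / glength G D"] P D unfolding u Per_def by simp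
  show "gBV G u" by (rule gBV_if_TV_finite[OF iu TV])
  have "L1_norm G u = gint G u" unfolding L1_norm_def u using D by (simp add: abs_mult)
  also have "\<dots> = 1 / glength G D * glength G D" unfolding u gint_mult_left glength_def ..
  finally show "L1_norm G u = 1" using D by simp
qed

text \<open>The normalized indicator \<open>u\<close> has total variation at most \<open>h\<close>
  and pairs with \<open>cut_sign D\<close> to 1. Hence the terms with \<open>u\<close> cancel in the
  subgradient inequality, and \<open>isoperimetric_TV\<close> for \<open>v\<close> is left.\<close>

lemma eigenpair_normalized_indicator:
  assumes h: "isoperimetric h" and D: "gmeasurable G D" "0 < glength G D" "glength G D \<le> total_length / 2"
    and P: "Per G D \<le> ereal (h * glength G D)"
  shows "eigenpair G h (\<lambda>p. indicator D p / glength G D)"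
proof -
  define u where "u = (\<lambda>p. indicat_real D p / glength G D)"
  note N = normalized_indicator[OF h D P, folded u_def]
  note bal = balanced_cut_sign[OF D]
  note i = gL1_indicator[OF D(1)]
  have u0: "0 \<le> u p" for p using D by (simp add: u_def)
  have "gint G (\<lambda>p. cut_sign D p * u p) = gint G (\<lambda>p. \<bar>u p\<bar>)"
    by (rule gint_cong) (use D in \<open>auto simp: u_def cut_sign_def indicator_def\<close>)
  then have xi_u: "gint G (\<lambda>p. cut_sign D p * u p) = 1" using N(4) by (simp add: L1_norm_def)
  have TV: "F_TV G u \<le> ereal h" using N(2,3) by (simp add: F_TV_def)
  have ixi: "gL1 G (cut_sign D)" using balancedD(3)[OF bal] by (simp add: gL1_def)
  have gL2u: "gL2 G u"
    unfolding gL2_def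
  proof
    fix e assume e: "e \<in> arcs G"
    show "Lp 2 (len G e) (curry u e)"
      by (rule Lp2_edge_bounded[OF N(1) e, where B="1 / glength G D"]) (use D in \<open>auto simp: u_def indicator_def\<close>)
  qed
  have b: "\<bar>cut_sign D p\<bar> \<le> 1" for p using cut_sign_bound[OF D(2,3), of p] by auto
  have gL2w: "gL2 G (\<lambda>p. h * cut_sign D p)"
    unfolding gL2_def
  proof
    fix e assume e: "e \<in> arcs G"
    show "Lp 2 (len G e) (curry (\<lambda>p. h * cut_sign D p) e)"
      by (rule Lp2_edge_bounded[OF gL1_mult_left[OF ixi] e, where B=h])
        (use b isoperimetric_0[OF h] in \<open>auto simp: abs_mult intro!: mult_left_le\<close>)
  qed
  have "(\<lambda>p. h * cut_sign D p) \<in> subdifferential_L2 G (F_TV G) u"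
    unfolding subdifferential_L2_def
  proof (intro CollectI conjI allI impI gL2u gL2w)
    fix v assume v: "gL2 G v"
    have iv: "gL1 G v" by (rule gL1_gL2[OF v])
    have "gint G (\<lambda>p. h * cut_sign D p * (v p - u p)) = h * gint G (\<lambda>p. cut_sign D p * v p - cut_sign D p * u p)"
      unfolding gint_mult_left[symmetric] by (rule gint_cong) (simp add: algebra_simps)
    also have "\<dots> = h * (gint G (\<lambda>p. cut_sign D p * v p) - 1)"
      using gint_diff[OF gL1_balanced_mult[OF bal iv] gL1_balanced_mult[OF bal N(1)]] xi_u by simp
    finally have "F_TV G u + ereal (gint G (\<lambda>p. h * cut_sign D p * (v p - u p)))
        \<le> ereal h + ereal (h * (gint G (\<lambda>p. cut_sign D p * v p) - 1))"
      by (simp only: add_right_mono[OF TV])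
    also have "\<dots> = ereal (h * gint G (\<lambda>p. cut_sign D p * v p))" by (simp add: algebra_simps)
    also have "\<dots> \<le> TV G v" by (rule isoperimetric_TV[OF h bal iv])
    also have "\<dots> \<le> F_TV G v" by (rule F_TV_ge)
    finally show "F_TV G u + ereal (gint G (\<lambda>p. h * cut_sign D p * (v p - u p))) \<le> F_TV G v" .
  qed
  then have lap: "(\<lambda>p. - (h * cut_sign D p)) \<in> one_Laplacian G u" by (simp add: one_Laplacian_def)
  have sgn: "cut_sign D p \<in> multi_sign (u p)" for p
    using cut_sign_bound[OF D(2,3), of p] D(2) by (cases "p \<in> D") (auto simp: multi_sign_def u_def cut_sign_def)
  have "\<exists>\<xi>. (\<forall>p\<in>points G. \<xi> p \<in> multi_sign (u p)) \<and> (\<lambda>p. - (h * \<xi> p)) \<in> one_Laplacian G u"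
    by (rule exI[of _ "cut_sign D"], rule conjI[OF ballI[OF sgn] lap])
  then have "eigenpair G h u"
    unfolding eigenpair_def using N(3,4) by (intro conjI)
  then show ?thesis by (simp only: u_def)
qed

lemma eigenvalue_ge:
  assumes h: "isoperimetric h" and l: "l \<noteq> 0" "eigenvalue G l"
  shows "h \<le> l"
proof -
  obtain u \<xi> where BV: "gBV G u" and L1: "L1_norm G u = 1" and \<xi>: "\<And>p. p \<in> points G \<Longrightarrow> \<xi> p \<in> multi_sign (u p)"
    and lap: "(\<lambda>p. - (l * \<xi> p)) \<in> one_Laplacian G u"
    using l by (auto simp: eigenvalue_def eigenpair_def)
  have L2: "gL2 G u" "gL2 G (\<lambda>p. l * \<xi> p)"
    and sub: "\<And>v. gL2 G v \<Longrightarrow> F_TV G u + ereal (gint G (\<lambda>p. l * \<xi> p * (v p - u p))) \<le> F_TV G v"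
    using lap by (auto simp: one_Laplacian_def subdifferential_L2_def)
  have iu: "gL1 G u" by (rule gL1_gL2[OF L2(1)])
  have pts: "(e, x) \<in> points G" if "e \<in> arcs G" "x \<in> {0<..<len G e}" for e x using that by (simp add: points_def)
  have b: "\<bar>\<xi> (e, x)\<bar> \<le> 1" "\<xi> (e, x) * u (e, x) = \<bar>u (e, x)\<bar>" if "e \<in> arcs G" "x \<in> {0<..<len G e}" for e x
    using \<xi>[OF pts[OF that]] by (auto simp: multi_sign_def split: if_splits)
  \<comment> \<open>Measurability of \<xi> is recovered from \<open>l * \<xi>\<close>, dividing by
    the nonzero \<open>l\<close>.\<close>
  have m: "(\<lambda>x. \<xi> (e, x)) \<in> borel_measurable (EV e)" if "e \<in> arcs G" for e
  proof -
    have "(\<lambda>x. l * \<xi> (e, x)) \<in> borel_measurable (EV e)"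
      using L2(2) that unfolding gL2_def Lp_def curry_def by blast
    then have "(\<lambda>x. (1 / l) * (l * \<xi> (e, x))) \<in> borel_measurable (EV e)"
      by (rule borel_measurable_times[OF borel_measurable_const])
    moreover have "(\<lambda>x. (1 / l) * (l * \<xi> (e, x))) = (\<lambda>x. \<xi> (e, x))" using l by simp
    ultimately show ?thesis by (simp only:)
  qed
  have i\<xi>: "gL1 G \<xi>"
    unfolding gL1_def by (intro ballI integrable_IV_bounded[OF m b(1)])
  have \<xi>u: "gint G (\<lambda>p. \<xi> p * u p) = 1"
    using gint_cong[of "\<lambda>p. \<xi> p * u p" "\<lambda>p. \<bar>u p\<bar>"] b(2) L1 by (simp add: L1_norm_def)
  have F0: "F_TV G (\<lambda>_. 0) \<le> 0"
  proof -
    have "TV G (\<lambda>_. 0) \<le> ereal 0" by (rule TV_le) (simp add: pairing_def)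
    then show ?thesis using gBV_if_TV_finite[OF gL1_const, of 0 0] by (simp add: F_TV_def zero_ereal_def)
  qed
  have Fu: "F_TV G u = TV G u" using BV by (simp add: F_TV_def)
  \<comment> \<open>Testing the subgradient with \<open>v = 0\<close> bounds \<open>TV G u\<close>
    by \<open>l\<close>.\<close>
  have "gint G (\<lambda>p. l * \<xi> p * (0 - u p)) = - l * gint G (\<lambda>p. \<xi> p * u p)"
    unfolding gint_mult_left[symmetric] by (rule gint_cong) (simp add: algebra_simps)
  then have "gint G (\<lambda>p. l * \<xi> p * (0 - u p)) = - l" using \<xi>u by simp
  moreover have "gL2 G (\<lambda>_. 0)" by (simp add: gL2_def Lp_def curry_def)
  ultimately have "TV G u + ereal (- l) \<le> 0"
    using sub[of "\<lambda>_. 0"] F0 Fu by simp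
  then have TVl: "TV G u \<le> ereal l"
    by (cases "TV G u") (auto simp: zero_ereal_def)
  then obtain K where K: "TV G u = ereal K" using TV_nonneg[OF iu] by (cases "TV G u") auto
  \<comment> \<open>Testing with \<open>u + c\<close>, whose total variation is no larger, for
    \<open>c = 1\<close> and \<open>c = -1\<close> forces \<xi> to have mean zero.\<close>
  have shift: "l * c * gint G \<xi> \<le> 0" for c
  proof -
    have T: "TV G (\<lambda>p. u p + c) \<le> ereal K" by (rule TV_add_const_le[OF L2(1)]) (simp add: K)
    have BVc: "gBV G (\<lambda>p. u p + c)"
      by (rule gBV_if_TV_finite[OF gL1_add[OF iu gL1_const] T])
    have L2c: "gL2 G (\<lambda>p. u p + c)"
      unfolding gL2_def
    proof
      fix e assume e: "e \<in> arcs G"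
      have u2: "Lp 2 (len G e) (\<lambda>x. u (e, x))" using L2(1) e by (auto simp: gL2_def curry_def)
      have "integrable (EV e) (\<lambda>x. \<bar>u (e, x)\<bar>\<^sup>2 + 2 * c * u (e, x) + c\<^sup>2)"
        using u2 Lp2_imp_integrable[OF u2] integrable_const_IV
        by (intro Bochner_Integration.integrable_add integrable_mult_right) (auto simp: Lp_def)
      moreover have "\<bar>u (e, x)\<bar>\<^sup>2 + 2 * c * u (e, x) + c\<^sup>2 = \<bar>u (e, x) + c\<bar>\<^sup>2" for x
        by (simp add: power2_sum)
      ultimately show "Lp 2 (len G e) (curry (\<lambda>p. u p + c) e)"
        using u2 by (auto simp: Lp_def curry_def)
    qed
    have eq: "gint G (\<lambda>p. l * \<xi> p * (u p + c - u p)) = (l * c) * gint G \<xi>"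
      unfolding gint_mult_left[symmetric] by (rule gint_cong) simp
    have "ereal K + ereal (l * c * gint G \<xi>) \<le> F_TV G (\<lambda>p. u p + c)"
      using sub[OF L2c] unfolding Fu K eq .
    also have "\<dots> \<le> ereal K" using BVc T by (simp add: F_TV_def)
    finally show ?thesis by simp
  qed
  have "gint G \<xi> = 0" using shift[of 1] shift[of "-1"] l(1) by simp
  then have bal: "balanced \<xi>" using m b(1) by (simp add: balanced_def)
  have "ereal (h * 1) \<le> TV G u" using isoperimetric_TV[OF h bal iu] \<xi>u by simp
  then show ?thesis using TVl by (metis ereal_less_eq(3) mult.right_neutral order_trans)
qed


section \<open>Superlevel sets of minimizers\<close>

lemma glength_mono:
  assumes "gmeasurable G A" "gmeasurable G B" "A \<subseteq> B"
  shows "glength G A \<le> glength G B"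
  unfolding glength_def
  by (rule gint_mono) (use assms in \<open>auto intro: gL1_indicator simp: indicator_def\<close>)

lemma glength_nonneg: "0 \<le> glength G D"
  unfolding glength_def gint_def by (intro sum_nonneg integral_nonneg) simp

lemma gmeasurable_Collect:
  assumes u: "gL1 G u" and B: "B \<in> sets borel"
  shows "gmeasurable G {p \<in> points G. u p \<in> B}"
  unfolding gmeasurable_def
proof (intro conjI ballI)
  fix e assume e: "e \<in> arcs G"
  have "(\<lambda>x. u (e, x)) \<in> borel_measurable (EV e)" using u e by (auto simp: gL1_def)
  from measurable_sets[OF this B] have "(\<lambda>x. u (e, x)) -` B \<inter> {0<..<len G e} \<in> sets (EV e)" by simp
  then have "(\<lambda>x. u (e, x)) -` B \<inter> {0<..<len G e} \<in> sets lebesgue" by (auto simp: sets_restrict_space_iff)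
  moreover have "{x. (e, x) \<in> {p \<in> points G. u p \<in> B}} = (\<lambda>x. u (e, x)) -` B \<inter> {0<..<len G e}"
    using e by (auto simp: points_def)
  ultimately show "{x. (e, x) \<in> {p \<in> points G. u p \<in> B}} \<in> sets lebesgue" by simp
qed auto

lemma gmeasurable_superlevel: "gL1 G u \<Longrightarrow> gmeasurable G (superlevel G u t)"
  using gmeasurable_Collect[of u "{t<..}"] by (simp add: superlevel_def)

text \<open>The median condition says precisely that the excess of one sign set over the other fits
  into the zero set, so a constant in [-1,1] there restores mean zero.\<close>

lemma median_sign:
  assumes u: "gL1 G u" and med: "0 \<in> median G u"
  obtains \<xi> where "balanced \<xi>" "\<forall>p\<in>points G. 0 < u p \<longrightarrow> \<xi> p = 1"
    "\<forall>p\<in>points G. \<xi> p * u p = \<bar>u p\<bar>"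
proof -
  let ?P = "{p \<in> points G. 0 < u p}" and ?M = "{p \<in> points G. u p < 0}" and ?Z = "{p \<in> points G. u p = 0}"
  define a b z where "a = glength G ?P" and "b = glength G ?M" and "z = glength G ?Z"
  have gP: "gmeasurable G ?P" and gM: "gmeasurable G ?M" and gZ: "gmeasurable G ?Z"
    using gmeasurable_Collect[OF u, of "{0<..}"] gmeasurable_Collect[OF u, of "{..<0}"] gmeasurable_Collect[OF u, of "{0}"] by auto
  note iP = gL1_indicator[OF gP] and iM = gL1_indicator[OF gM] and iZ = gL1_indicator[OF gZ]
  have ab: "a \<le> total_length / 2" "b \<le> total_length / 2"
    using med by (auto simp: median_def a_def b_def glength_points)
  have "gint G (\<lambda>p. (indicator ?P p + indicator ?M p) + indicator ?Z p) = gint G (\<lambda>_. 1)"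
    by (rule gint_cong) (auto simp: points_def indicator_def)
  then have total: "a + b + z = total_length"
    unfolding gint_add[OF gL1_add[OF iP iM] iZ] gint_add[OF iP iM] a_def b_def z_def glength_def gint_const by simp
  \<comment> \<open>If the zero set is null, the median bounds force \<open>a = b\<close>, and the
    default \<open>(b - a) / 0 = 0\<close> is a correct value.\<close>
  define c where "c = (b - a) / z"
  have z0: "0 \<le> z" unfolding z_def by (rule glength_nonneg)
  have cz: "c * z = b - a"
  proof (cases "z = 0")
    case True
    then show ?thesis using total ab by (simp add: c_def)
  qed (simp add: c_def)
  have c1: "\<bar>c\<bar> \<le> 1"
  proof (cases "z = 0")
    case False
    then have "\<bar>b - a\<bar> \<le> z" using total ab by linarith
    then show ?thesis using z0 False by (simp add: c_def abs_divide)
  qed (simp add: c_def)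
  define \<xi> where "\<xi> p = (indicator ?P p + (-1) * indicator ?M p) + c * indicator ?Z p" for p
  have i: "gL1 G \<xi>"
    unfolding \<xi>_def by (intro gL1_add gL1_mult_left iP iM iZ)
  have "gint G \<xi> = (a + (-1) * b) + c * z"
    unfolding \<xi>_def gint_add[OF gL1_add[OF iP gL1_mult_left[OF iM]] gL1_mult_left[OF iZ]]
      gint_add[OF iP gL1_mult_left[OF iM]] gint_mult_left a_def b_def z_def glength_def ..
  then have g0: "gint G \<xi> = 0" using cz by simp
  have val: "\<xi> p = (if 0 < u p then 1 else if u p < 0 then -1 else c)" if "p \<in> points G" for p
    using that by (auto simp: \<xi>_def indicator_def)
  have "balanced \<xi>"
    unfolding balanced_def
  proof (intro conjI ballI g0)
    fix e assume e: "e \<in> arcs G"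
    show "(\<lambda>x. \<xi> (e, x)) \<in> borel_measurable (EV e)" using i e by (auto simp: gL1_def)
    fix x assume "x \<in> {0<..<len G e}"
    then show "\<bar>\<xi> (e, x)\<bar> \<le> 1" using val[of "(e, x)"] c1 e by (simp add: points_def)
  qed
  then show ?thesis
    by (rule that) (auto simp: val)
qed

section \<open>Superlevel sets of a function against those of its cell means\<close>

lemma indicator_mesh_level:
  assumes N: "0 < N" and p: "e \<in> arcs G" "x \<in> {0<..<len G e}"
  shows "indicator (mesh N (level_cells N u t)) (e, x)
    = (indicator {..<graph_mean N u (e, cell_index (len G e) N x)} t :: real)"
  unfolding indicator_mesh[OF p] using cell_index_less[OF N p(2)] p by (simp add: cells_def indicator_def)

text \<open>The measure of the symmetric difference of the superlevel sets at \<open>t\<close> of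
  \<open>u\<close> and of its cell means.\<close>

definition level_error :: "nat \<Rightarrow> ('e \<times> real \<Rightarrow> real) \<Rightarrow> real \<Rightarrow> real" where
  "level_error N u t = (\<Sum>e\<in>arcs G. LINT x|EV e.
     \<bar>indicat_real {..<graph_mean N u (e, cell_index (len G e) N x)} t - indicat_real {..<u (e, x)} t\<bar>)"

lemma level_error:
  assumes N: "0 < N" and u: "gL1 G u"
  shows "integrable lborel (level_error N u)" "(LINT t|lborel. level_error N u t) = mean_error N u"
    "0 \<le> level_error N u t"
proof -
  have i: "integrable (EV e) (\<lambda>x. u (e, x))" if "e \<in> arcs G" for e using u that by (simp add: gL1_def)
  note D = level_set_distance[OF integrable_graph_mean[OF N] i]
  show "integrable lborel (level_error N u)"
    unfolding level_error_def by (intro Bochner_Integration.integrable_sum D(1))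
  have "(LINT t|lborel. level_error N u t) = (\<Sum>e\<in>arcs G. LINT x|EV e. \<bar>graph_mean N u (e, cell_index (len G e) N x) - u (e, x)\<bar>)"
    unfolding level_error_def
    by (subst Bochner_Integration.integral_sum) (auto intro!: D sum.cong)
  then show "(LINT t|lborel. level_error N u t) = mean_error N u"
    by (simp add: mean_error_def abs_minus_commute)
  show "0 \<le> level_error N u t" unfolding level_error_def by (intro sum_nonneg) simp
qed

lemma level_error_eq:
  assumes N: "0 < N"
  shows "level_error N u t = (\<Sum>e\<in>arcs G. LINT x|EV e.
     \<bar>indicat_real (mesh N (level_cells N u t)) (e, x) - indicat_real (superlevel G u t) (e, x)\<bar>)"
  unfolding level_error_def
proof (intro sum.cong refl Bochner_Integration.integral_cong)
  fix e x assume e: "e \<in> arcs G" and "x \<in> space (EV e)"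
  then have x: "x \<in> {0<..<len G e}" by simp
  have "indicat_real (superlevel G u t) (e, x) = indicat_real {..<u (e, x)} t"
    using e x by (simp add: superlevel_def points_def indicator_def)
  then show "\<bar>indicat_real {..<graph_mean N u (e, cell_index (len G e) N x)} t - indicat_real {..<u (e, x)} t\<bar> =
    \<bar>indicat_real (mesh N (level_cells N u t)) (e, x) - indicat_real (superlevel G u t) (e, x)\<bar>"
    unfolding indicator_mesh_level[OF N e x] by simp
qed

text \<open>The derivative \<open>g\<close> is only square integrable, so its integral over the
  symmetric difference is not bounded by a multiple of the measure. Young's inequality with a free
  parameter \<open>k\<close> separates the two: the mesh is refined at fixed \<open>k\<close>, and
  only then \<open>k\<close> grows.\<close>

lemma level_set_flux_le:
  assumes \<xi>: "balanced \<xi>" and u: "gL1 G u" and N: "0 < N"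
    and F: "flow G g y" and k: "0 < k"
  shows "pairing G (indicator (superlevel G u t)) g \<le> real (per N (level_cells N u t))
      + k / 2 * level_error N u t + (\<Sum>e\<in>arcs G. LINT x|EV e. \<bar>g e x\<bar>\<^sup>2) / (2 * k)" (is ?flux)
    and "sum (graph_cell_int N \<xi>) (level_cells N u t)
      \<le> gint G (\<lambda>p. \<xi> p * indicator (superlevel G u t) p) + level_error N u t" (is ?mass)
proof -
  let ?S = "(level_cells N u t)" and ?E = "superlevel G u t"
  let ?d = "\<lambda>e x. \<bar>indicat_real (mesh N ?S) (e, x) - indicat_real ?E (e, x)\<bar>"
  have S: "?S \<subseteq> cells N" by auto
  note gE = gmeasurable_superlevel[OF u, of t]
  have iE: "integrable (EV e) (\<lambda>x. indicat_real ?E (e, x))" if "e \<in> arcs G" for e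
    using gL1_indicator[OF gE] that by (simp add: gL1_def)
  have iS: "integrable (EV e) (\<lambda>x. indicat_real (mesh N ?S) (e, x))" if "e \<in> arcs G" for e
    using gL1_indicator[OF gmeasurable_mesh] that by (simp add: gL1_def)
  have id: "integrable (EV e) (?d e)" if "e \<in> arcs G" for e
    by (intro integrable_abs Bochner_Integration.integrable_diff iE iS that)
  have if_mult: "integrable (EV e) (\<lambda>x. indicat_real A (e, x) * f x)"
    if "e \<in> arcs G" "integrable (EV e) (\<lambda>x. indicat_real A (e, x))" "integrable (EV e) f" for e A and f :: "real \<Rightarrow> real"
  proof (rule Bochner_Integration.integrable_bound[OF that(3)])
    have [measurable]: "(\<lambda>x. indicat_real A (e, x)) \<in> borel_measurable (EV e)" "f \<in> borel_measurable (EV e)"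
      using that by auto
    show "(\<lambda>x. indicat_real A (e, x) * f x) \<in> borel_measurable (EV e)"
      by (intro borel_measurable_times) fact+
  qed (auto intro!: AE_I2 simp: indicator_def)
  show ?flux
  proof -
    have "pairing G (indicator ?E) g \<le> (\<Sum>e\<in>arcs G. (LINT x|EV e. indicator (mesh N ?S) (e, x) * g e x)
        + (k / 2 * (LINT x|EV e. ?d e x) + (LINT x|EV e. \<bar>g e x\<bar>\<^sup>2) / (2 * k)))"
      unfolding pairing_def
    proof (rule sum_mono)
      fix e assume e: "e \<in> arcs G"
      have ig: "integrable (EV e) (g e)" by (rule flow_integral(1)[OF F e])
      have ig2: "integrable (EV e) (\<lambda>x. \<bar>g e x\<bar>\<^sup>2)" using flowD(1)[OF F e] by (simp add: Lp_def)
      have i1: "integrable (EV e) (\<lambda>x. indicator (mesh N ?S) (e, x) * g e x)"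
        by (rule if_mult[OF e iS[OF e] ig])
      have i2: "integrable (EV e) (\<lambda>x. k / 2 * ?d e x)" by (intro Bochner_Integration.integrable_mult_right id e)
      have i3: "integrable (EV e) (\<lambda>x. \<bar>g e x\<bar>\<^sup>2 / (2 * k))" using ig2 by simp
      have "(LINT x|EV e. indicat_real ?E (e, x) * g e x)
          \<le> (LINT x|EV e. indicator (mesh N ?S) (e, x) * g e x + (k / 2 * ?d e x + \<bar>g e x\<bar>\<^sup>2 / (2 * k)))"
      proof (rule integral_mono)
        show "integrable (EV e) (\<lambda>x. indicat_real ?E (e, x) * g e x)" by (rule if_mult[OF e iE[OF e] ig])
        show "integrable (EV e) (\<lambda>x. indicator (mesh N ?S) (e, x) * g e x + (k / 2 * ?d e x + \<bar>g e x\<bar>\<^sup>2 / (2 * k)))"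
          by (intro Bochner_Integration.integrable_add i1 i2 i3)
        fix x
        have "0 \<le> (k - \<bar>g e x\<bar>)\<^sup>2 / (2 * k)" using k by simp
        also have "(k - \<bar>g e x\<bar>)\<^sup>2 / (2 * k) = k / 2 + \<bar>g e x\<bar>\<^sup>2 / (2 * k) - \<bar>g e x\<bar>"
          using k by (simp add: power2_diff power2_eq_square field_simps)
        finally have young: "\<bar>g e x\<bar> \<le> k / 2 + \<bar>g e x\<bar>\<^sup>2 / (2 * k)" by simp
        have nn: "0 \<le> \<bar>g e x\<bar>\<^sup>2 / (2 * k)" using k by simp
        show "indicat_real ?E (e, x) * g e x \<le> indicator (mesh N ?S) (e, x) * g e x + (k / 2 * ?d e x + \<bar>g e x\<bar>\<^sup>2 / (2 * k))"
          using young nn by (cases "(e, x) \<in> ?E"; cases "(e, x) \<in> mesh N ?S") auto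
      qed
      also have "\<dots> = (LINT x|EV e. indicator (mesh N ?S) (e, x) * g e x)
          + ((LINT x|EV e. k / 2 * ?d e x) + (LINT x|EV e. \<bar>g e x\<bar>\<^sup>2 / (2 * k)))"
        using i1 i2 i3 by (simp only: Bochner_Integration.integral_add Bochner_Integration.integrable_add)
      also have "(LINT x|EV e. k / 2 * ?d e x) = k / 2 * (LINT x|EV e. ?d e x)"
        by (rule Bochner_Integration.integral_mult_right_zero)
      also have "(LINT x|EV e. \<bar>g e x\<bar>\<^sup>2 / (2 * k)) = (LINT x|EV e. \<bar>g e x\<bar>\<^sup>2) / (2 * k)"
        by (rule Bochner_Integration.integral_divide_zero)
      finally show "(LINT x|EV e. indicat_real ?E (e, x) * g e x)
        \<le> (LINT x|EV e. indicator (mesh N ?S) (e, x) * g e x)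
        + (k / 2 * (LINT x|EV e. ?d e x) + (LINT x|EV e. \<bar>g e x\<bar>\<^sup>2) / (2 * k))" .
    qed
    also have "\<dots> = pairing G (indicator (mesh N ?S)) g + (k / 2 * level_error N u t
        + (\<Sum>e\<in>arcs G. LINT x|EV e. \<bar>g e x\<bar>\<^sup>2) / (2 * k))"
      unfolding sum.distrib pairing_def level_error_eq[OF N] sum_distrib_left sum_divide_distrib ..
    also have "pairing G (indicator (mesh N ?S)) g \<le> real (per N ?S)"
      unfolding flux_mesh[OF F N S] by (rule flux_le_per[OF F N])
    finally show ?thesis by simp
  qed
  show ?mass
  proof -
    have "sum (graph_cell_int N \<xi>) ?S = (\<Sum>e\<in>arcs G. LINT x|EV e. indicator (mesh N ?S) (e, x) * \<xi> (e, x))"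
      unfolding graph_cell_int_mesh[OF \<xi> N S] pairing_def ..
    also have "\<dots> \<le> (\<Sum>e\<in>arcs G. (LINT x|EV e. \<xi> (e, x) * indicator ?E (e, x)) + (LINT x|EV e. ?d e x))"
    proof (rule sum_mono)
      fix e assume e: "e \<in> arcs G"
      have i1: "integrable (EV e) (\<lambda>x. \<xi> (e, x) * indicator ?E (e, x))"
        by (rule balancedD(4)[OF \<xi> e iE[OF e]])
      have "(LINT x|EV e. indicator (mesh N ?S) (e, x) * \<xi> (e, x))
          \<le> (LINT x|EV e. \<xi> (e, x) * indicator ?E (e, x) + ?d e x)"
      proof (rule integral_mono)
        show "integrable (EV e) (\<lambda>x. indicator (mesh N ?S) (e, x) * \<xi> (e, x))"
          by (rule if_mult[OF e iS[OF e] balancedD(3)[OF \<xi> e]])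
        show "integrable (EV e) (\<lambda>x. \<xi> (e, x) * indicator ?E (e, x) + ?d e x)"
          by (intro Bochner_Integration.integrable_add i1 id e)
        fix x assume "x \<in> space (EV e)"
        then have "\<bar>\<xi> (e, x)\<bar> \<le> 1" using balancedD(2)[OF \<xi> e] by simp
        then show "indicator (mesh N ?S) (e, x) * \<xi> (e, x) \<le> \<xi> (e, x) * indicator ?E (e, x) + ?d e x"
          by (cases "(e, x) \<in> ?E"; cases "(e, x) \<in> mesh N ?S") auto
      qed
      also have "\<dots> = (LINT x|EV e. \<xi> (e, x) * indicator ?E (e, x)) + (LINT x|EV e. ?d e x)"
        by (rule Bochner_Integration.integral_add[OF i1 id[OF e]])
      finally show "(LINT x|EV e. indicator (mesh N ?S) (e, x) * \<xi> (e, x))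
        \<le> (LINT x|EV e. \<xi> (e, x) * indicator ?E (e, x)) + (LINT x|EV e. ?d e x)" .
    qed
    also have "\<dots> = gint G (\<lambda>p. \<xi> p * indicator ?E p) + level_error N u t"
      unfolding sum.distrib gint_def level_error_eq[OF N] ..
    finally show ?thesis .
  qed
qed


text \<open>Provides a whole interval of levels whose superlevel sets have positive length, so that
  a level outside an exceptional null set can be picked.\<close>

lemma superlevel_length_pos_near_0:
  assumes u: "gL1 G u" and pos: "0 < glength G (superlevel G u 0)"
  obtains \<delta> where "0 < \<delta>" "0 < glength G (superlevel G u \<delta>)"
proof -
  have i: "integrable (EV e) (\<lambda>x. indicat_real (superlevel G u t) (e, x))" if "e \<in> arcs G" for e t
    using gL1_indicator[OF gmeasurable_superlevel[OF u]] that by (simp add: gL1_def)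
  have "(\<lambda>n. glength G (superlevel G u (1 / real (Suc n)))) \<longlonglongrightarrow> glength G (superlevel G u 0)"
    unfolding glength_def gint_def
  proof (rule tendsto_sum)
    fix e assume e: "e \<in> arcs G"
    show "(\<lambda>n. LINT x|EV e. indicat_real (superlevel G u (1 / real (Suc n))) (e, x))
      \<longlonglongrightarrow> (LINT x|EV e. indicat_real (superlevel G u 0) (e, x))"
    proof (rule integral_dominated_convergence[where w="\<lambda>_. 1"])
      show "integrable (EV e) (\<lambda>_. 1::real)" by (rule integrable_const_IV)
      show "AE x in EV e. (\<lambda>n. indicat_real (superlevel G u (1 / real (Suc n))) (e, x)) \<longlonglongrightarrow> indicat_real (superlevel G u 0) (e, x)"
      proof (rule AE_I2)
        fix x assume x: "x \<in> space (EV e)"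
        have "\<forall>\<^sub>F n in sequentially. indicat_real (superlevel G u (1 / real (Suc n))) (e, x) = indicat_real (superlevel G u 0) (e, x)"
        proof (cases "0 < u (e, x)")
          case True
          have "(\<lambda>n. 1 / real (Suc n)) \<longlonglongrightarrow> 0"
            using LIMSEQ_inverse_real_of_nat by (simp add: inverse_eq_divide)
          then have "\<forall>\<^sub>F n in sequentially. 1 / real (Suc n) < u (e, x)" by (rule order_tendstoD(2)[OF _ True])
          then show ?thesis by eventually_elim (use True in \<open>simp add: superlevel_def indicator_def\<close>)
        next
          case False
          then have "\<not> 1 / real (Suc n) < u (e, x)" for n
            by (metis divide_pos_pos less_trans of_nat_0_less_iff zero_less_Suc zero_less_one)
          then show ?thesis using False by (intro always_eventually) (simp add: superlevel_def indicator_def)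
        qed
        then show "(\<lambda>n. indicat_real (superlevel G u (1 / real (Suc n))) (e, x)) \<longlonglongrightarrow> indicat_real (superlevel G u 0) (e, x)"
          by (rule tendsto_eventually)
      qed
    qed (use i e in \<open>auto intro!: AE_I2 borel_measurable_integrable simp: indicator_def\<close>)
  qed
  from order_tendstoD(1)[OF this pos] obtain n where "0 < glength G (superlevel G u (1 / real (Suc n)))"
    by (auto simp: eventually_sequentially)
  then show ?thesis by (intro that[of "1 / real (Suc n)"]) auto
qed

text \<open>
  For the cell means of a minimizer, the gaps \<open>q\<close> tend to 0 in $L^1$, and so do the distances of their
  superlevel sets from those of \<open>u\<close>; along a subsequence both hold for almost every level.
\<close>

lemma superlevel_cheeger:
  assumes h: "isoperimetric h" and u: "gL1 G u" and TV: "TV G u \<le> ereal h"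
    and L1: "L1_norm G u = 1" and med: "0 \<in> median G u" and pos: "0 < glength G (superlevel G u 0)"
  obtains t where "0 \<le> t" "gmeasurable G (superlevel G u t)" "0 < glength G (superlevel G u t)"
    "glength G (superlevel G u t) \<le> total_length / 2" "Per G (superlevel G u t) \<le> ereal (h * glength G (superlevel G u t))"
proof -
  note h0 = isoperimetric_0[OF h]
  obtain \<xi> where \<xi>: "balanced \<xi>" "\<forall>p\<in>points G. 0 < u p \<longrightarrow> \<xi> p = 1"
    "\<forall>p\<in>points G. \<xi> p * u p = \<bar>u p\<bar>" using median_sign[OF u med] .
  have \<xi>u: "gint G (\<lambda>p. \<xi> p * u p) = 1"
    using gint_cong[of "\<lambda>p. \<xi> p * u p" "\<lambda>p. \<bar>u p\<bar>"] \<xi>(3) L1 by (simp add: L1_norm_def points_def)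
  \<comment> \<open>Since \<open>TV G u \<le> ereal h\<close> and \<xi> pairs with \<open>u\<close>
    to 1, \<open>isoperimetric_TV\<close> is an equality for \<open>u\<close>; only the mean error
    is left for the gap.\<close>
  have ex: "\<exists>q. (\<forall>t. 0 \<le> q t) \<and>
    (\<forall>t. real (per (Suc n) (level_cells (Suc n) u t)) = q t + h * sum (graph_cell_int (Suc n) \<xi>) (level_cells (Suc n) u t)) \<and>
    integrable lborel q \<and> (LINT t|lborel. q t) \<le> h * mean_error (Suc n) u" for n
  proof (rule calibrated_gap[OF h \<xi>(1) zero_less_Suc u, of n], goal_cases)
    case (1 q)
    have "h * (\<Sum>c\<in>cells (Suc n). graph_mean (Suc n) u c * graph_cell_int (Suc n) \<xi> c) + (LINT t|lborel. q t) \<le> h"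
      using order_trans[OF 1(4) TV] by simp
    moreover have "h * (1 - mean_error (Suc n) u) \<le> h * (\<Sum>c\<in>cells (Suc n). graph_mean (Suc n) u c * graph_cell_int (Suc n) \<xi> c)"
      using sum_graph_mean_approx[OF \<xi>(1) zero_less_Suc u, of n] \<xi>u by (intro mult_left_mono h0) simp
    ultimately have "(LINT t|lborel. q t) \<le> h * mean_error (Suc n) u" by (simp add: algebra_simps)
    then show ?case by (intro exI[of _ q] conjI allI 1(1,2,3))
  qed
  obtain Q where "\<forall>n. (\<forall>t. 0 \<le> Q n t) \<and>
    (\<forall>t. real (per (Suc n) (level_cells (Suc n) u t)) = Q n t + h * sum (graph_cell_int (Suc n) \<xi>) (level_cells (Suc n) u t)) \<and>
    integrable lborel (Q n) \<and> (LINT t|lborel. Q n t) \<le> h * mean_error (Suc n) u"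
    using choice[OF allI[OF ex]] ..
  then have Q: "\<And>n t. 0 \<le> Q n t"
    "\<And>n t. real (per (Suc n) (level_cells (Suc n) u t)) = Q n t + h * sum (graph_cell_int (Suc n) \<xi>) (level_cells (Suc n) u t)"
    "\<And>n. integrable lborel (Q n)" "\<And>n. (LINT t|lborel. Q n t) \<le> h * mean_error (Suc n) u"
    by simp_all
  note LE = level_error[OF zero_less_Suc u]
  \<comment> \<open>Gap and level error are added so that one subsequence serves both.\<close>
  define f where "f n t = Q n t + level_error (Suc n) u t" for n t
  have f0: "0 \<le> f n t" for n t unfolding f_def using Q(1) LE(3) by (simp add: add_nonneg_nonneg)
  have fi: "integrable lborel (f n)" for n unfolding f_def using Q(3) LE(1) by (intro Bochner_Integration.integrable_add)
  have "(\<lambda>n. LINT t|lborel. norm (f n t)) \<longlonglongrightarrow> 0"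
  proof (rule tendsto_sandwich[OF _ _ tendsto_const])
    show "(\<lambda>n. (h + 1) * mean_error (Suc n) u) \<longlonglongrightarrow> 0"
      using tendsto_mult[OF tendsto_const mean_error_tendsto[OF u TV], of "h + 1"] by simp
    show "\<forall>\<^sub>F n in sequentially. (LINT t|lborel. norm (f n t)) \<le> (h + 1) * mean_error (Suc n) u"
    proof (intro always_eventually allI)
      fix n
      have "(LINT t|lborel. norm (f n t)) = (LINT t|lborel. Q n t + level_error (Suc n) u t)"
        using f0 by (simp add: f_def)
      also have "\<dots> = (LINT t|lborel. Q n t) + mean_error (Suc n) u"
        using Q(3) LE(1,2) by (subst Bochner_Integration.integral_add) auto
      finally show "(LINT t|lborel. norm (f n t)) \<le> (h + 1) * mean_error (Suc n) u"
        using Q(4)[of n] by (simp add: algebra_simps)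
    qed
  qed simp
  from tendsto_L1_AE_subseq[OF fi this] obtain r where r: "AE t in lborel. (\<lambda>n. f (r n) t) \<longlonglongrightarrow> 0" by blast
  obtain \<delta> where \<delta>: "0 < \<delta>" "0 < glength G (superlevel G u \<delta>)"
    by (rule superlevel_length_pos_near_0[OF u pos])
  obtain t where t: "0 < t" "t < \<delta>" and lim: "(\<lambda>n. f (r n) t) \<longlonglongrightarrow> 0"
    using AE_lborel_meets_interval[OF r \<delta>(1)] .
  let ?E = "superlevel G u t"
  note gE = gmeasurable_superlevel[OF u]
  have "glength G (superlevel G u \<delta>) \<le> glength G ?E"
    by (rule glength_mono[OF gE gE]) (use t in \<open>auto simp: superlevel_def\<close>)
  then have E_pos: "0 < glength G ?E" using \<delta>(2) by linarith
  have "glength G ?E \<le> glength G (superlevel G u 0)"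
    by (rule glength_mono[OF gE gE]) (use t in \<open>auto simp: superlevel_def\<close>)
  also have "\<dots> \<le> total_length / 2"
    using med by (auto simp: median_def superlevel_def glength_points)
  finally have E_half: "glength G ?E \<le> total_length / 2" .
  have \<xi>E: "gint G (\<lambda>p. \<xi> p * indicator ?E p) = glength G ?E"
    unfolding glength_def
    by (rule gint_cong) (use \<xi>(2) t in \<open>auto simp: superlevel_def indicator_def\<close>)
  have "Per G ?E \<le> ereal (h * glength G ?E)"
    unfolding Per_def
  proof (rule TV_le)
    fix g y assume F: "flow G g y"
    define m where "m = (\<Sum>e\<in>arcs G. LINT x|EV e. \<bar>g e x\<bar>\<^sup>2)"
    have m0: "0 \<le> m" unfolding m_def by (intro sum_nonneg) simp
    have bound: "pairing G (indicator ?E) g \<le> h * glength G ?E + m / (2 * k)" if k: "0 < k" for k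
    proof -
      have "pairing G (indicator ?E) g \<le> (h * glength G ?E + m / (2 * k)) + (1 + h + k / 2) * f (r n) t" for n
      proof -
        let ?d = "level_error (Suc (r n)) u t"
        have d: "?d \<le> f (r n) t" "0 \<le> ?d" "Q (r n) t \<le> f (r n) t"
          using Q(1)[of "r n" t] LE(3)[of "r n" t] by (auto simp: f_def)
        have "pairing G (indicator ?E) g \<le> real (per (Suc (r n)) (level_cells (Suc (r n)) u t)) + k / 2 * ?d + m / (2 * k)"
          unfolding m_def by (rule level_set_flux_le(1)[OF \<xi>(1) u zero_less_Suc F k])
        also have "real (per (Suc (r n)) (level_cells (Suc (r n)) u t)) \<le> Q (r n) t + h * (glength G ?E + ?d)"
          unfolding Q(2) using level_set_flux_le(2)[OF \<xi>(1) u zero_less_Suc F k, of "r n" t] \<xi>E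
          by (intro add_left_mono mult_left_mono h0) simp
        finally have "pairing G (indicator ?E) g \<le> h * glength G ?E + m / (2 * k) + (Q (r n) t + h * ?d + k / 2 * ?d)"
          by (simp add: algebra_simps)
        also have "Q (r n) t + h * ?d + k / 2 * ?d \<le> f (r n) t + h * f (r n) t + k / 2 * f (r n) t"
          using d h0 k by (intro add_mono mult_left_mono) auto
        also have "\<dots> = (1 + h + k / 2) * f (r n) t" by (simp add: algebra_simps)
        finally show ?thesis by simp
      qed
      moreover have "(\<lambda>n. (h * glength G ?E + m / (2 * k)) + (1 + h + k / 2) * f (r n) t) \<longlonglongrightarrow> (h * glength G ?E + m / (2 * k)) + (1 + h + k / 2) * 0"
        by (intro tendsto_intros lim)
      ultimately show ?thesis using LIMSEQ_le_const by fastforce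
    qed
    have "pairing G (indicator ?E) g \<le> h * glength G ?E"
    proof (rule field_le_epsilon)
      fix \<epsilon> :: real assume \<epsilon>: "0 < \<epsilon>"
      \<comment> \<open>The parameter is \<open>k = (m + 1) / \<epsilon>\<close>; adding 1 keeps it
        positive when \<open>m = 0\<close>.\<close>
      have "m / (2 * ((m + 1) / \<epsilon>)) \<le> \<epsilon>" using m0 \<epsilon> by (simp add: field_simps)
      moreover have "pairing G (indicator ?E) g \<le> h * glength G ?E + m / (2 * ((m + 1) / \<epsilon>))"
        using m0 \<epsilon> by (intro bound) simp
      ultimately show "pairing G (indicator ?E) g \<le> h * glength G ?E + \<epsilon>" by linarith
    qed
    then show "ereal (pairing G (indicator ?E) g) \<le> ereal (h * glength G ?E)" by simp
  qed
  then show ?thesis using t(1) gE E_pos E_half by (intro that[of t]) auto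
qed

lemma pos_or_neg_part:
  assumes u: "gL1 G u" and L1: "L1_norm G u = 1" and neg: "\<not> 0 < glength G (superlevel G u 0)"
  shows "0 < glength G (superlevel G (\<lambda>p. - u p) 0)"
proof (rule ccontr)
  assume "\<not> 0 < glength G (superlevel G (\<lambda>p. - u p) 0)"
  then have 0: "glength G (superlevel G u 0) = 0" "glength G (superlevel G (\<lambda>p. - u p) 0) = 0"
    using neg glength_nonneg[of "superlevel G u 0"] glength_nonneg[of "superlevel G (\<lambda>p. - u p) 0"] by auto
  have u': "gL1 G (\<lambda>p. - u p)" using u by (simp add: gL1_def)
  have null: "AE x in EV e. (e, x) \<notin> superlevel G w 0"
    if "glength G (superlevel G w 0) = 0" "gL1 G w" "e \<in> arcs G" for w e
  proof -
    have i: "integrable (EV e) (\<lambda>x. indicat_real (superlevel G w 0) (e, x))"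
      using gL1_indicator[OF gmeasurable_superlevel[OF that(2)]] that(3) by (simp add: gL1_def)
    have "(LINT x|EV e. indicat_real (superlevel G w 0) (e, x)) = 0"
      using that(1,3) unfolding glength_def gint_def by (subst (asm) sum_nonneg_eq_0_iff) auto
    then have "AE x in EV e. indicat_real (superlevel G w 0) (e, x) = 0"
      by (subst (asm) integral_nonneg_eq_0_iff_AE[OF i]) auto
    then show ?thesis by eventually_elim (auto simp: indicator_def split: if_splits)
  qed
  have "(LINT x|EV e. \<bar>u (e, x)\<bar>) = (LINT x|EV e. 0)" if e: "e \<in> arcs G" for e
  proof (rule integral_cong_AE)
    show "(\<lambda>x. \<bar>u (e, x)\<bar>) \<in> borel_measurable (EV e)" using u e by (auto simp: gL1_def)
    show "AE x in EV e. \<bar>u (e, x)\<bar> = 0"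
      using null[OF 0(1) u e] null[OF 0(2) u' e] AE_space
      by eventually_elim (use e in \<open>auto simp: superlevel_def points_def\<close>)
  qed simp
  then show False using L1 by (simp add: L1_norm_def gint_def)
qed

section \<open>The Cheeger constant and its attainment\<close>

lemma cheeger_const_eq:
  assumes h: "isoperimetric h" and D: "gmeasurable G D" "0 < glength G D" "glength G D \<le> total_length / 2"
    and P: "Per G D \<le> ereal (h * glength G D)"
  shows "cheeger_const G = ereal h" "cheeger_cut G D"
proof -
  have quot: "Per G D' / ereal (glength G D') = ereal h"
    if "gmeasurable G D'" "0 < glength G D'" "glength G D' \<le> total_length / 2" "Per G D' \<le> ereal (h * glength G D')" for D'
  proof -
    have "Per G D' = ereal (h * glength G D')" using isoperimetric_Per[OF h that(1-3)] that(4) by (rule antisym[rotated])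
    then show ?thesis using that(2) by simp
  qed
  show *: "cheeger_const G = ereal h"
    unfolding cheeger_const_def
  proof (rule antisym)
    show "(INF D\<in>{D. gmeasurable G D \<and> 0 < glength G D \<and> glength G D \<le> glength G (points G) / 2}. Per G D / ereal (glength G D)) \<le> ereal h"
      using quot[OF D P] D by (intro INF_lower2[of D]) (auto simp: glength_points)
    show "ereal h \<le> (INF D\<in>{D. gmeasurable G D \<and> 0 < glength G D \<and> glength G D \<le> glength G (points G) / 2}. Per G D / ereal (glength G D))"
    proof (rule INF_greatest, clarify)
      fix D' assume D': "gmeasurable G D'" "0 < glength G D'" "glength G D' \<le> glength G (points G) / 2"
      have "ereal (h * glength G D') \<le> Per G D'"
        using isoperimetric_Per[OF h D'(1,2)] D'(3) by (simp add: glength_points)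
      then show "ereal h \<le> Per G D' / ereal (glength G D')"
        using D'(2) by (cases "Per G D'") (auto simp: field_simps)
    qed
  qed
  show "cheeger_cut G D"
    unfolding cheeger_cut_def * using D quot[OF D P] by (simp add: glength_points)
qed

lemma normalized_indicator_in_Pi:
  assumes h: "isoperimetric h" and D: "gmeasurable G D" "0 < glength G D" "glength G D \<le> total_length / 2"
    and P: "Per G D \<le> ereal (h * glength G D)"
  shows "(\<lambda>p. indicator D p / glength G D) \<in> Pi_BV G"
proof -
  let ?u = "\<lambda>p. indicator D p / glength G D"
  have "\<not> ?u p < 0" for p using D by (simp add: not_less)
  then have "glength G {p \<in> points G. ?u p < 0} = 0" by (simp add: glength_def gint_def)
  moreover have "glength G {p \<in> points G. 0 < ?u p} = glength G D"
    using D by (intro arg_cong[of _ _ "glength G"]) (auto simp: gmeasurable_def indicator_def)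
  ultimately have "0 \<in> median G ?u"
    unfolding median_def mem_Collect_eq glength_points using D total_length_pos by linarith
  then show ?thesis using normalized_indicator(3,4)[OF h D P] by (simp add: Pi_BV_def)
qed

end

text \<open>A minimizer may be nonpositive, for instance the negative of the normalized indicator of
  a cut; its superlevel sets for \<open>t \<ge> 0\<close> are then null and no cuts. As the
  constraints and \<open>TV\<close> are even, \<open>- u\<close> is a minimizer too, and since the
  norm is 1, one of \<open>u\<close> and \<open>- u\<close> has a positive part that is not
  null.\<close>

theorem theorem5p3:
  fixes G :: "('v, 'e) metric_graph"
  assumes "connected_compact_metric_graph G"
  shows
    "cheeger_const G = (INF l\<in>{l. l \<noteq> 0 \<and> eigenvalue G l}. ereal l) \<and>
     (\<exists>h::real. cheeger_const G = ereal h \<and>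
        h \<noteq> 0 \<and> eigenvalue G h \<and> (\<forall>l. l \<noteq> 0 \<and> eigenvalue G l \<longrightarrow> h \<le> l) \<and>
        (\<forall>u. is_arg_min (TV G) (\<lambda>w. w \<in> Pi_BV G) u \<longrightarrow>
           (let v = (if 0 < glength G (superlevel G u 0) then u else (\<lambda>p. - u p))
            in \<exists>t\<ge>0. cheeger_cut G (superlevel G v t) \<and>
                 eigenpair G h (\<lambda>p. indicator (superlevel G v t) p / glength G (superlevel G v t)))))"
proof -
  interpret mgraph G by unfold_locales (rule assms)
  obtain h D where h: "isoperimetric h" and D: "gmeasurable G D" "0 < glength G D" "glength G D \<le> total_length / 2"
    and P: "Per G D \<le> ereal (h * glength G D)"
    using exists_optimal_set .
  \<comment> \<open>\<open>D\<close> has positive length, at most half of the total, so on a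
    connected graph its perimeter cannot vanish.\<close>
  have h_ne: "h \<noteq> 0"
  proof
    assume "h = 0"
    then have "Per G D \<le> 0" using P by (simp add: zero_ereal_def)
    then show False using TV_indicator_pos[OF D(1,2)] D(3) total_length_pos by simp
  qed
  note const = cheeger_const_eq(1)[OF h D P]
  have ev: "eigenvalue G h"
    unfolding eigenvalue_def using eigenpair_normalized_indicator[OF h D P] by blast
  have least: "h \<le> l" if "l \<noteq> 0" "eigenvalue G l" for l
    by (rule eigenvalue_ge[OF h that])
  have inf_eq: "(INF l\<in>{l. l \<noteq> 0 \<and> eigenvalue G l}. ereal l) = ereal h"
  proof (rule antisym)
    show "(INF l\<in>{l. l \<noteq> 0 \<and> eigenvalue G l}. ereal l) \<le> ereal h"
      by (rule INF_lower) (use h_ne ev in simp)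
    show "ereal h \<le> (INF l\<in>{l. l \<noteq> 0 \<and> eigenvalue G l}. ereal l)"
      by (rule INF_greatest) (use least in simp)
  qed
  have cut: "\<exists>t\<ge>0. cheeger_cut G (superlevel G v t) \<and>
      eigenpair G h (\<lambda>p. indicator (superlevel G v t) p / glength G (superlevel G v t))"
    if min: "is_arg_min (TV G) (\<lambda>w. w \<in> Pi_BV G) u"
      and v: "v = (if 0 < glength G (superlevel G u 0) then u else (\<lambda>p. - u p))" for u v
  proof -
    have Pi: "gBV G u" "L1_norm G u = 1" "0 \<in> median G u"
      using min by (auto simp: is_arg_min_def Pi_BV_def)
    have iu: "gL1 G u" by (rule gL1_gBV[OF Pi(1)])
    \<comment> \<open>The normalized indicator of \<open>D\<close> is a competitor, so the minimum
      is at most \<open>h\<close>.\<close>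
    have "TV G u \<le> TV G (\<lambda>p. indicator D p / glength G D)"
      using min normalized_indicator_in_Pi[OF h D P] unfolding is_arg_min_def by (meson not_le)
    also have "\<dots> \<le> ereal h" by (rule normalized_indicator(2)[OF h D P])
    finally have TVu: "TV G u \<le> ereal h" .
    have iv: "gL1 G v" and TVv: "TV G v \<le> ereal h" and L1v: "L1_norm G v = 1" and medv: "0 \<in> median G v"
      and posv: "0 < glength G (superlevel G v 0)"
    proof -
      show "gL1 G v" using iu by (simp add: v gL1_def)
      show "TV G v \<le> ereal h" using TVu TV_scale_le[OF iu TVu, of "-1"] by (simp add: v)
      show "L1_norm G v = 1" using Pi(2) by (simp add: v L1_norm_def)
      show "0 \<in> median G v" using Pi(3) by (simp add: v median_def)
      show "0 < glength G (superlevel G v 0)" using pos_or_neg_part[OF iu Pi(2)] by (simp add: v)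
    qed
    obtain t where t: "0 \<le> t" "gmeasurable G (superlevel G v t)" "0 < glength G (superlevel G v t)"
      "glength G (superlevel G v t) \<le> total_length / 2" "Per G (superlevel G v t) \<le> ereal (h * glength G (superlevel G v t))"
      using superlevel_cheeger[OF h iv TVv L1v medv posv] .
    show ?thesis
      using t(1) cheeger_const_eq(2)[OF h t(2-5)] eigenpair_normalized_indicator[OF h t(2-5)] by blast
  qed
  show ?thesis
  proof (intro conjI exI[of _ h] allI impI)
    show "cheeger_const G = (INF l\<in>{l. l \<noteq> 0 \<and> eigenvalue G l}. ereal l)"
      unfolding const by (rule inf_eq[symmetric])
    show "h \<le> l" if "l \<noteq> 0 \<and> eigenvalue G l" for l using that least by blast
    show "let v = (if 0 < glength G (superlevel G u 0) then u else (\<lambda>p. - u p))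
      in \<exists>t\<ge>0. cheeger_cut G (superlevel G v t) \<and>
           eigenpair G h (\<lambda>p. indicator (superlevel G v t) p / glength G (superlevel G v t))"
      if "is_arg_min (TV G) (\<lambda>w. w \<in> Pi_BV G) u" for u
      unfolding Let_def by (rule cut[OF that refl])
  qed (fact const h_ne ev)+
qed

end
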